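(* Let $(F,\hat\alpha):(\mathbb X,T_\bullet)\to(\mathbb X',T'_\bullet)$ be a differential functor between tangent categories, where $\mathbb X$ has a terminal object $*$. Let $(A,\zeta,\sigma,\lambda)$ and $(B,\zeta',\sigma',\lambda')$ be differential objects in $\mathbb X$ and let $f:A\to B$ be an additive morphism of differential objects. Then $$(F(f),1_{F( * )}):\bigl(F(A),F( * ),F(!),F(\zeta),F(\sigma),\hat\alpha_{W,A}\circ F(\lambda)\bigr)\to\bigl(F(B),F( * ),F(!),F(\zeta'),F(\sigma'),\hat\alpha_{W,B}\circ F(\lambda')\bigr)$$ is an additive morphism of differential bundles in $\mathbb X'$.
   Context: **Weil algebras and tangent actegories.** $\mathrm{Weil}$ is the category whose objects are the commutative $\mathbb N$-algebras (semirings) $\mathbb N[x_1,\dots,x_n]/\langle x_ix_j\mid i\sim j\rangle$ for an equivalence relation $\sim$ on $\{1,\dots,n\}$, with unital $\mathbb N$-linear semiring homomorphisms as morphisms. It is monoidal under the coproduct $\otimes$ with unit $\mathbb N$ (also terminal). $W=\mathbb N[x]/\langle x^2\rangle$; $W^n=\mathbb N[x_1,\dots,x_n]/\langle x_ix_j \mid \text{all } i,j\rangle$ is the $n$-fold product in $\mathrm{Weil}$; every object has the form $W^{n_1}\otimes\cdots\otimes W^{n_k}$. Distinguished morphisms: $p:W\to\mathbb N$, $ax+b\mapsto b$; $0:\mathbb N\to W$ the inclusion; $+:W\times W\to W$, $ax_1+bx_2+c\mapsto (a+b)x+c$; $\ell:W\to W\otimes W$, $ax+b\mapsto ax_1x_2+b$;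 $c:W\otimes W\to W\otimes W$ swapping $x_1,x_2$. A $\mathrm{Weil}$-actegory $(\mathbb X,T_\bullet)$ is a category with a functor $T_\bullet:\mathrm{Weil}\times\mathbb X\to\mathbb X$ and natural isomorphisms $X\cong T_\bullet(\mathbb N,X)$, $T_\bullet(A,T_\bullet(B,X))\cong T_\bullet(A\otimes B,X)$ satisfying the usual associativity and unit coherences. Write $T_A=T_\bullet(A,-)$ and $T_\theta$ for the natural transformation given by a morphism $\theta$ of $\mathrm{Weil}$. It is a tangent actegory if for each object $X$ the functor $T_{(-)}(X)$ sends to pullbacks: (i) the squares exhibiting $A\otimes(B\times C)$ as the pullback of $A\otimes B\to A\leftarrow A\otimes C$, whenever $B\times C$ exists in $\mathrm{Weil}$; (ii) the squares obtained by applying $W^{\otimes n}\otimes-$, $n\ge0$, to the pullback square with top $\nu:W\times W\to W\otimes W$, $\nu(ax_1+bx_2+c)=ax_1x_2+bx_2+c$, right side $1_W\otimes p:W\otimes W\to W$, left side the unique map $W\times W\to\mathbb N$ and bottom $0:\mathbb N\to W$. Tangent categories are identified with tangent actegories, with tangent functor $T:=T_W$ and structure maps $p:=T_p,\ 0:=T_0,\ +:=T_+,\ \ell:=T_\ell,\ c:=T_c$, under the identifications $T_{W\otimes W}=T\circ T$, $T_n:=T_{W^n}$. **Differential bundles.** An additive bundle $(X,A,p,+,0)$: a morphism $p:X\to A$ with pullback powers $X_n$ of $p$ over $A$, and $+:X_2\to X$, $0:A\to X$ with $p\circ +=p\circ\pi_0=p\circ\pi_1$, $p\circ0=1_A$,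 and $+$ associative, commutative and with unit $0$. An additive bundle morphism $(f,g)$ is a pair $f:X\to Y$, $g:A\to B$ with $p'f=gp$, $f\circ+=+'\circ f_2$, $f\circ0=0'\circ g$. A differential bundle $(E,M,q,\zeta,\sigma,\lambda)$ in $(\mathbb X,T)$ consists of $q:E\to M$ whose finite pullback powers $E_n$ exist and are preserved by all $T^k$; $\zeta:M\to E$, $\sigma:E_2\to E$ making $(E,M,q,\sigma,\zeta)$ an additive bundle; and $\lambda:E\to TE$ such that $(\lambda,0_M)$ is an additive bundle morphism to $(TE,TM,Tq,T\sigma,T\zeta)$, $(\lambda,\zeta)$ is an additive bundle morphism to $(TE,E,p_E,+_E,0_E)$, $\ell_E\circ\lambda=T(\lambda)\circ\lambda$, and the square with top $T(\sigma)\circ\langle\lambda\pi_0,0\pi_1\rangle:E_2\to TE$, left $q\pi_0:E_2\to M$, bottom $0_M:M\to TM$, right $T(q)$ is a pullback. A differential object $(A,\zeta,\sigma,\lambda)$ is a differential bundle over a terminal object $*$, with projection the unique map $!$. A morphism of differential bundles $(f,g)$ is a pair $f:E\to E'$, $g:M\to M'$ with $q'f=gq$; it is additive if $f\sigma=\sigma'f_2$ and $f\zeta=\zeta'g$. For differential objects $g=1_*$. **Differential functors.** An oplax $\mathrm{Weil}$-linear functor $(F,\hat\alpha):(\mathbb X,T_\bullet)\to(\mathbb X',T'_\bullet)$ is a functor $F$ with a natural transformation $\hat\alpha:F\circ T_\bullet\Rightarrow T'_\bullet\circ(1\times F)$, components $\hat\alpha_{A,X}:F(T_AX)\to T'_A(FX)$,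 satisfying (modulo the structure isomorphisms) $\hat\alpha_{A\otimes B,X}=T'_A(\hat\alpha_{B,X})\circ\hat\alpha_{A,T_BX}$ and $\hat\alpha_{\mathbb N,X}=1_{FX}$. Suppose $\mathbb X$ has a terminal object $*$. $(F,\hat\alpha)$ is a (lax) differential functor if for all $A\in\mathrm{Weil}$: (a) $T'_A\circ F$ preserves pullbacks over $*$, and (b) all naturality squares of $\hat\alpha_{A,-}:F\circ T_A\Rightarrow T'_A\circ F$ are pullbacks; it is strong if moreover $F( * )$ is terminal.
   Formalization: That F(A) and F(B) are differential bundles with universal lift is asserted only when T( * ) is terminal, since it can fail otherwise; the additivity of (F(f),1) and all other differential bundle axioms are proved without this condition. *)

theory Defs
  imports "HOL-Library.Poly_Mapping" "HOL-Algebra.Ring"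
begin

section \<open>Categories\<close>

record ('o, 'm) cat =
  Obj :: "'o set"
  Arr :: "'m set"
  Dom :: "'m \<Rightarrow> 'o"
  Cod :: "'m \<Rightarrow> 'o"
  Ide :: "'o \<Rightarrow> 'm"
  Cmp :: "'m \<Rightarrow> 'm \<Rightarrow> 'm"  (infixl "\<bullet>\<index>" 65)

definition Hom :: "('o, 'm) cat \<Rightarrow> 'o \<Rightarrow> 'o \<Rightarrow> 'm set" where
  "Hom C X Y = {f \<in> Arr C. Dom C f = X \<and> Cod C f = Y}"

definition category :: "('o, 'm) cat \<Rightarrow> bool" where
  "category C \<longleftrightarrow>
     (\<forall>f\<in>Arr C. Dom C f \<in> Obj C \<and> Cod C f \<in> Obj C) \<and>
     (\<forall>X\<in>Obj C. Ide C X \<in> Hom C X X) \<and>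
     (\<forall>X Y Z f g. f \<in> Hom C X Y \<longrightarrow> g \<in> Hom C Y Z \<longrightarrow> g \<bullet>\<^bsub>C\<^esub> f \<in> Hom C X Z) \<and>
     (\<forall>X Y f. f \<in> Hom C X Y \<longrightarrow> f \<bullet>\<^bsub>C\<^esub> Ide C X = f \<and> Ide C Y \<bullet>\<^bsub>C\<^esub> f = f) \<and>
     (\<forall>X Y Z V f g h. f \<in> Hom C X Y \<longrightarrow> g \<in> Hom C Y Z \<longrightarrow> h \<in> Hom C Z V \<longrightarrow>
        h \<bullet>\<^bsub>C\<^esub> (g \<bullet>\<^bsub>C\<^esub> f) = (h \<bullet>\<^bsub>C\<^esub> g) \<bullet>\<^bsub>C\<^esub> f)"

definition is_iso :: "('o, 'm) cat \<Rightarrow> 'm \<Rightarrow> bool" where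
  "is_iso C f \<longleftrightarrow> f \<in> Arr C \<and>
     (\<exists>g\<in>Hom C (Cod C f) (Dom C f).
        g \<bullet>\<^bsub>C\<^esub> f = Ide C (Dom C f) \<and> f \<bullet>\<^bsub>C\<^esub> g = Ide C (Cod C f))"

definition inv_arr :: "('o, 'm) cat \<Rightarrow> 'm \<Rightarrow> 'm" where
  "inv_arr C f = (THE g. g \<in> Hom C (Cod C f) (Dom C f) \<and>
     g \<bullet>\<^bsub>C\<^esub> f = Ide C (Dom C f) \<and> f \<bullet>\<^bsub>C\<^esub> g = Ide C (Cod C f))"

definition terminal :: "('o, 'm) cat \<Rightarrow> 'o \<Rightarrow> bool" where
  "terminal C t \<longleftrightarrow> t \<in> Obj C \<and> (\<forall>X\<in>Obj C. \<exists>!f. f \<in> Hom C X t)"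

definition is_product :: "('o, 'm) cat \<Rightarrow> 'o \<Rightarrow> 'o \<Rightarrow> 'o \<Rightarrow> 'm \<Rightarrow> 'm \<Rightarrow> bool" where
  "is_product C X Y P p1 p2 \<longleftrightarrow> p1 \<in> Hom C P X \<and> p2 \<in> Hom C P Y \<and>
     (\<forall>Z a b. a \<in> Hom C Z X \<longrightarrow> b \<in> Hom C Z Y \<longrightarrow>
        (\<exists>!h. h \<in> Hom C Z P \<and> p1 \<bullet>\<^bsub>C\<^esub> h = a \<and> p2 \<bullet>\<^bsub>C\<^esub> h = b))"

(* is_pullback C f g p q:  the square  f p = g q  commutes and p, q exhibit Dom p
   as the pullback of the cospan f, g. *)
definition is_pullback :: "('o, 'm) cat \<Rightarrow> 'm \<Rightarrow> 'm \<Rightarrow> 'm \<Rightarrow> 'm \<Rightarrow> bool" where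
  "is_pullback C f g p q \<longleftrightarrow>
     f \<in> Arr C \<and> g \<in> Arr C \<and> Cod C f = Cod C g \<and>
     p \<in> Hom C (Dom C p) (Dom C f) \<and> q \<in> Hom C (Dom C p) (Dom C g) \<and>
     f \<bullet>\<^bsub>C\<^esub> p = g \<bullet>\<^bsub>C\<^esub> q \<and>
     (\<forall>Z a b. a \<in> Hom C Z (Dom C f) \<longrightarrow> b \<in> Hom C Z (Dom C g) \<longrightarrow>
        f \<bullet>\<^bsub>C\<^esub> a = g \<bullet>\<^bsub>C\<^esub> b \<longrightarrow>
        (\<exists>!h. h \<in> Hom C Z (Dom C p) \<and> p \<bullet>\<^bsub>C\<^esub> h = a \<and> q \<bullet>\<^bsub>C\<^esub> h = b))"

(* The n-fold fibre power of q : E -> M, with projections pr 0, ..., pr (n-1) to E and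
   structure map b to M; the latter makes M the 0-fold power. *)
definition is_fibre_power ::
    "('o, 'm) cat \<Rightarrow> 'm \<Rightarrow> nat \<Rightarrow> 'm \<Rightarrow> (nat \<Rightarrow> 'm) \<Rightarrow> bool" where
  "is_fibre_power C q n b pr \<longleftrightarrow>
     q \<in> Arr C \<and> b \<in> Hom C (Dom C b) (Cod C q) \<and>
     (\<forall>i<n. pr i \<in> Hom C (Dom C b) (Dom C q) \<and> q \<bullet>\<^bsub>C\<^esub> pr i = b) \<and>
     (\<forall>Z c a. c \<in> Hom C Z (Cod C q) \<longrightarrow>
        (\<forall>i<n. a i \<in> Hom C Z (Dom C q) \<and> q \<bullet>\<^bsub>C\<^esub> a i = c) \<longrightarrow>
        (\<exists>!h. h \<in> Hom C Z (Dom C b) \<and> b \<bullet>\<^bsub>C\<^esub> h = c \<and> (\<forall>i<n. pr i \<bullet>\<^bsub>C\<^esub> h = a i)))"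

record ('o, 'm, 'p, 'n) ftor =
  fobj :: "'o \<Rightarrow> 'p"
  farr :: "'m \<Rightarrow> 'n"

definition is_functor ::
    "('o, 'm) cat \<Rightarrow> ('p, 'n) cat \<Rightarrow> ('o, 'm, 'p, 'n) ftor \<Rightarrow> bool" where
  "is_functor C D F \<longleftrightarrow>
     (\<forall>X\<in>Obj C. fobj F X \<in> Obj D) \<and>
     (\<forall>X Y f. f \<in> Hom C X Y \<longrightarrow> farr F f \<in> Hom D (fobj F X) (fobj F Y)) \<and>
     (\<forall>X\<in>Obj C. farr F (Ide C X) = Ide D (fobj F X)) \<and>
     (\<forall>X Y Z f g. f \<in> Hom C X Y \<longrightarrow> g \<in> Hom C Y Z \<longrightarrow>
        farr F (g \<bullet>\<^bsub>C\<^esub> f) = farr F g \<bullet>\<^bsub>D\<^esub> farr F f)"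

definition is_nat_trans ::
    "('o, 'm) cat \<Rightarrow> ('p, 'n) cat \<Rightarrow> ('o, 'm, 'p, 'n) ftor \<Rightarrow> ('o, 'm, 'p, 'n) ftor
       \<Rightarrow> ('o \<Rightarrow> 'n) \<Rightarrow> bool" where
  "is_nat_trans C D F G \<tau> \<longleftrightarrow>
     (\<forall>X\<in>Obj C. \<tau> X \<in> Hom D (fobj F X) (fobj G X)) \<and>
     (\<forall>X Y f. f \<in> Hom C X Y \<longrightarrow> \<tau> Y \<bullet>\<^bsub>D\<^esub> farr F f = farr G f \<bullet>\<^bsub>D\<^esub> \<tau> X)"

definition is_nat_iso ::
    "('o, 'm) cat \<Rightarrow> ('p, 'n) cat \<Rightarrow> ('o, 'm, 'p, 'n) ftor \<Rightarrow> ('o, 'm, 'p, 'n) ftor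
       \<Rightarrow> ('o \<Rightarrow> 'n) \<Rightarrow> bool" where
  "is_nat_iso C D F G \<tau> \<longleftrightarrow> is_nat_trans C D F G \<tau> \<and> (\<forall>X\<in>Obj C. is_iso D (\<tau> X))"

definition prod_cat ::
    "('o, 'm) cat \<Rightarrow> ('p, 'n) cat \<Rightarrow> ('o \<times> 'p, 'm \<times> 'n) cat"  (infixr "\<times>\<^sub>c" 80) where
  "C \<times>\<^sub>c D = \<lparr>Obj = Obj C \<times> Obj D, Arr = Arr C \<times> Arr D,
     Dom = map_prod (Dom C) (Dom D), Cod = map_prod (Cod C) (Cod D),
     Ide = map_prod (Ide C) (Ide D),
     Cmp = (\<lambda>g f. (fst g \<bullet>\<^bsub>C\<^esub> fst f, snd g \<bullet>\<^bsub>D\<^esub> snd f))\<rparr>"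


section \<open>The category of Weil algebras\<close>

type_synonym npoly = "(nat \<Rightarrow>\<^sub>0 nat) \<Rightarrow>\<^sub>0 nat"

definition var :: "nat \<Rightarrow> npoly" where
  "var i = Poly_Mapping.single (Poly_Mapping.single i 1) 1"

definition npolys :: "nat \<Rightarrow> npoly set" where
  "npolys n = {p. \<forall>m\<in>Poly_Mapping.keys p. Poly_Mapping.keys m \<subseteq> {..<n}}"

(* (n, r) stands for N[x_0, ..., x_(n-1)] / (x_i x_j | (i,j) in r). *)
type_synonym wobj = "nat \<times> (nat \<times> nat) set"

(* The least semiring congruence identifying x_i x_j with 0 for all (i,j) in the relation. *)
inductive wcong :: "wobj \<Rightarrow> npoly \<Rightarrow> npoly \<Rightarrow> bool" for A :: wobj where
  gen: "(i, j) \<in> snd A \<Longrightarrow> wcong A (var i * var j) 0"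
| refl: "p \<in> npolys (fst A) \<Longrightarrow> wcong A p p"
| sym: "wcong A p q \<Longrightarrow> wcong A q p"
| trans: "wcong A p q \<Longrightarrow> wcong A q s \<Longrightarrow> wcong A p s"
| add: "wcong A p q \<Longrightarrow> wcong A p' q' \<Longrightarrow> wcong A (p + p') (q + q')"
| mult: "wcong A p q \<Longrightarrow> wcong A p' q' \<Longrightarrow> wcong A (p * p') (q * q')"

definition wclass :: "wobj \<Rightarrow> npoly \<Rightarrow> npoly set" where
  "wclass A p = {q. wcong A p q}"

definition weil_alg :: "wobj \<Rightarrow> npoly set ring" where
  "weil_alg A = \<lparr>carrier = wclass A ` npolys (fst A),
     mult = (\<lambda>P Q. \<Union>p\<in>P. \<Union>q\<in>Q. wclass A (p * q)),
     one = wclass A 1,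
     zero = wclass A 0,
     add = (\<lambda>P Q. \<Union>p\<in>P. \<Union>q\<in>Q. wclass A (p + q))\<rparr>"

(* (A, h, B) is an arrow A -> B with underlying function h. *)
type_synonym warr = "wobj \<times> (npoly set \<Rightarrow> npoly set) \<times> wobj"

abbreviation wfun :: "warr \<Rightarrow> npoly set \<Rightarrow> npoly set" where
  "wfun \<theta> \<equiv> fst (snd \<theta>)"

definition weil_objs :: "wobj set" where
  "weil_objs = {A. equiv {..<fst A} (snd A)}"

(* ring_hom does not demand preservation of zero, which is needed for N-linearity. *)
definition Weil :: "(wobj, warr) cat" where
  "Weil = \<lparr>Obj = weil_objs,
     Arr = {(A, h, B). A \<in> weil_objs \<and> B \<in> weil_objs \<and>
       h \<in> extensional (carrier (weil_alg A)) \<and>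
       h \<in> ring_hom (weil_alg A) (weil_alg B) \<and>
       h \<zero>\<^bsub>weil_alg A\<^esub> = \<zero>\<^bsub>weil_alg B\<^esub>},
     Dom = (\<lambda>\<theta>. fst \<theta>),
     Cod = (\<lambda>\<theta>. snd (snd \<theta>)),
     Ide = (\<lambda>A. (A, (\<lambda>P\<in>carrier (weil_alg A). P), A)),
     Cmp = (\<lambda>\<psi> \<theta>. (fst \<theta>, compose (carrier (weil_alg (fst \<theta>))) (wfun \<psi>) (wfun \<theta>),
                    snd (snd \<psi>)))\<rparr>"

definition wN :: wobj where "wN = (0, {})"
definition wW :: wobj where "wW = (1, {(0, 0)})"
definition wW2 :: wobj where "wW2 = (2, {..<2} \<times> {..<2})"

definition weil_p :: warr where
  "weil_p = (THE \<theta>. \<theta> \<in> Hom Weil wW wN \<and>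
     (\<forall>a b. wfun \<theta> (wclass wW (of_nat a * var 0 + of_nat b)) = wclass wN (of_nat b)))"

definition weil_zero :: warr where
  "weil_zero = (THE \<theta>. \<theta> \<in> Hom Weil wN wW \<and>
     (\<forall>a. wfun \<theta> (wclass wN (of_nat a)) = wclass wW (of_nat a)))"

definition weil_pr :: "nat \<Rightarrow> warr" where
  "weil_pr i = (THE \<theta>. \<theta> \<in> Hom Weil wW2 wW \<and>
     (\<forall>a b c. wfun \<theta> (wclass wW2 (of_nat a * var 0 + of_nat b * var 1 + of_nat c)) =
        wclass wW (of_nat (if i = 0 then a else b) * var 0 + of_nat c)))"

definition weil_plus :: warr where
  "weil_plus = (THE \<theta>. \<theta> \<in> Hom Weil wW2 wW \<and>
     (\<forall>a b c. wfun \<theta> (wclass wW2 (of_nat a * var 0 + of_nat b * var 1 + of_nat c)) =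
        wclass wW (of_nat (a + b) * var 0 + of_nat c)))"

definition weil_bang :: "wobj \<Rightarrow> warr" where
  "weil_bang A = (THE \<theta>. \<theta> \<in> Hom Weil A wN)"

(* The coproduct. On these presentations it is strictly associative and unital on objects,
   and, as the injections send generators to generators, the associativity and unit
   isomorphisms of the monoidal structure are identities. *)
definition wtensor :: "wobj \<Rightarrow> wobj \<Rightarrow> wobj"  (infixr "\<otimes>\<^sub>w" 75) where
  "A \<otimes>\<^sub>w B = (fst A + fst B, snd A \<union> (\<lambda>(i, j). (fst A + i, fst A + j)) ` snd B)"

lemma wtensor_assoc: "(A \<otimes>\<^sub>w B) \<otimes>\<^sub>w C = A \<otimes>\<^sub>w B \<otimes>\<^sub>w C"
  by (auto simp: wtensor_def image_Un image_image case_prod_unfold add.assoc)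

lemma wtensor_unit: "wN \<otimes>\<^sub>w A = A" "A \<otimes>\<^sub>w wN = A"
  by (auto simp: wtensor_def wN_def)

lemma wtensor_W_W: "wW \<otimes>\<^sub>w wW = (2, {(0, 0), (1, 1)})"
  by (auto simp: wtensor_def wW_def)

definition winl :: "wobj \<Rightarrow> wobj \<Rightarrow> warr" where
  "winl A B = (THE \<theta>. \<theta> \<in> Hom Weil A (A \<otimes>\<^sub>w B) \<and>
     (\<forall>i<fst A. wfun \<theta> (wclass A (var i)) = wclass (A \<otimes>\<^sub>w B) (var i)))"

definition winr :: "wobj \<Rightarrow> wobj \<Rightarrow> warr" where
  "winr A B = (THE \<theta>. \<theta> \<in> Hom Weil B (A \<otimes>\<^sub>w B) \<and>
     (\<forall>i<fst B. wfun \<theta> (wclass B (var i)) = wclass (A \<otimes>\<^sub>w B) (var (fst A + i))))"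

definition wtensor_arr :: "warr \<Rightarrow> warr \<Rightarrow> warr"  (infixr "\<otimes>\<^sub>a" 75) where
  "\<theta> \<otimes>\<^sub>a \<psi> = (THE \<chi>. \<chi> \<in> Hom Weil (Dom Weil \<theta> \<otimes>\<^sub>w Dom Weil \<psi>) (Cod Weil \<theta> \<otimes>\<^sub>w Cod Weil \<psi>) \<and>
     \<chi> \<bullet>\<^bsub>Weil\<^esub> winl (Dom Weil \<theta>) (Dom Weil \<psi>) = winl (Cod Weil \<theta>) (Cod Weil \<psi>) \<bullet>\<^bsub>Weil\<^esub> \<theta> \<and>
     \<chi> \<bullet>\<^bsub>Weil\<^esub> winr (Dom Weil \<theta>) (Dom Weil \<psi>) = winr (Cod Weil \<theta>) (Cod Weil \<psi>) \<bullet>\<^bsub>Weil\<^esub> \<psi>)"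

definition weil_l :: warr where
  "weil_l = (THE \<theta>. \<theta> \<in> Hom Weil wW (wW \<otimes>\<^sub>w wW) \<and>
     (\<forall>a b. wfun \<theta> (wclass wW (of_nat a * var 0 + of_nat b)) =
        wclass (wW \<otimes>\<^sub>w wW) (of_nat a * (var 0 * var 1) + of_nat b)))"

definition weil_nu :: warr where
  "weil_nu = (THE \<theta>. \<theta> \<in> Hom Weil wW2 (wW \<otimes>\<^sub>w wW) \<and>
     (\<forall>a b c. wfun \<theta> (wclass wW2 (of_nat a * var 0 + of_nat b * var 1 + of_nat c)) =
        wclass (wW \<otimes>\<^sub>w wW) (of_nat a * (var 0 * var 1) + of_nat b * var 1 + of_nat c)))"

primrec wW_pow :: "nat \<Rightarrow> wobj" where
  "wW_pow 0 = wN"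
| "wW_pow (Suc n) = wW \<otimes>\<^sub>w wW_pow n"


section \<open>Weil-actegories and tangent actegories\<close>

(* act is T_\<bullet>; act_unit X : X -> T(N,X) and act_mult A B X : T(A,T(B,X)) -> T(A \<otimes> B,X)
   are the structure isomorphisms. *)
record ('o, 'm) weil_action =
  act :: "(wobj \<times> 'o, warr \<times> 'm, 'o, 'm) ftor"
  act_unit :: "'o \<Rightarrow> 'm"
  act_mult :: "wobj \<Rightarrow> wobj \<Rightarrow> 'o \<Rightarrow> 'm"

definition T_at :: "('o, 'm) weil_action \<Rightarrow> wobj \<Rightarrow> ('o, 'm, 'o, 'm) ftor" where
  "T_at T A = \<lparr>fobj = (\<lambda>X. fobj (act T) (A, X)), farr = (\<lambda>f. farr (act T) (Ide Weil A, f))\<rparr>"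

definition T_nat :: "('o, 'm) cat \<Rightarrow> ('o, 'm) weil_action \<Rightarrow> warr \<Rightarrow> 'o \<Rightarrow> 'm" where
  "T_nat C T \<theta> X = farr (act T) (\<theta>, Ide C X)"

definition weil_actegory :: "('o, 'm) cat \<Rightarrow> ('o, 'm) weil_action \<Rightarrow> bool" where
  "weil_actegory C T \<longleftrightarrow>
     category C \<and> is_functor (Weil \<times>\<^sub>c C) C (act T) \<and>
     is_nat_iso C C \<lparr>fobj = (\<lambda>X. X), farr = (\<lambda>f. f)\<rparr> (T_at T wN) (act_unit T) \<and>
     is_nat_iso (Weil \<times>\<^sub>c Weil \<times>\<^sub>c C) C
       \<lparr>fobj = (\<lambda>(A, B, X). fobj (act T) (A, fobj (act T) (B, X))),
        farr = (\<lambda>(\<theta>, \<psi>, f). farr (act T) (\<theta>, farr (act T) (\<psi>, f)))\<rparr>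
       \<lparr>fobj = (\<lambda>(A, B, X). fobj (act T) (A \<otimes>\<^sub>w B, X)),
        farr = (\<lambda>(\<theta>, \<psi>, f). farr (act T) (\<theta> \<otimes>\<^sub>a \<psi>, f))\<rparr>
       (\<lambda>(A, B, X). act_mult T A B X) \<and>
     (\<forall>A\<in>Obj Weil. \<forall>B\<in>Obj Weil. \<forall>D\<in>Obj Weil. \<forall>X\<in>Obj C.
        act_mult T (A \<otimes>\<^sub>w B) D X \<bullet>\<^bsub>C\<^esub> act_mult T A B (fobj (T_at T D) X) =
        act_mult T A (B \<otimes>\<^sub>w D) X \<bullet>\<^bsub>C\<^esub> farr (T_at T A) (act_mult T B D X)) \<and>
     (\<forall>A\<in>Obj Weil. \<forall>X\<in>Obj C.
        act_mult T wN A X \<bullet>\<^bsub>C\<^esub> act_unit T (fobj (T_at T A) X) = Ide C (fobj (T_at T A) X) \<and>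
        act_mult T A wN X \<bullet>\<^bsub>C\<^esub> farr (T_at T A) (act_unit T X) = Ide C (fobj (T_at T A) X))"

definition tangent_actegory :: "('o, 'm) cat \<Rightarrow> ('o, 'm) weil_action \<Rightarrow> bool" where
  "tangent_actegory C T \<longleftrightarrow> weil_actegory C T \<and>
     (\<forall>X\<in>Obj C. \<forall>A\<in>Obj Weil. \<forall>B\<in>Obj Weil. \<forall>D\<in>Obj Weil. \<forall>P \<pi>1 \<pi>2.
        is_product Weil B D P \<pi>1 \<pi>2 \<longrightarrow>
        is_pullback C
          (T_nat C T (Ide Weil A \<otimes>\<^sub>a weil_bang B) X) (T_nat C T (Ide Weil A \<otimes>\<^sub>a weil_bang D) X)
          (T_nat C T (Ide Weil A \<otimes>\<^sub>a \<pi>1) X) (T_nat C T (Ide Weil A \<otimes>\<^sub>a \<pi>2) X)) \<and>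
     (\<forall>X\<in>Obj C. \<forall>n.
        is_pullback C
          (T_nat C T (Ide Weil (wW_pow n) \<otimes>\<^sub>a weil_zero) X)
          (T_nat C T (Ide Weil (wW_pow n) \<otimes>\<^sub>a (Ide Weil wW \<otimes>\<^sub>a weil_p)) X)
          (T_nat C T (Ide Weil (wW_pow n) \<otimes>\<^sub>a weil_bang wW2) X)
          (T_nat C T (Ide Weil (wW_pow n) \<otimes>\<^sub>a weil_nu) X))"

abbreviation tan_obj :: "('o, 'm) weil_action \<Rightarrow> 'o \<Rightarrow> 'o" where
  "tan_obj T \<equiv> fobj (T_at T wW)"

abbreviation tan_arr :: "('o, 'm) weil_action \<Rightarrow> 'm \<Rightarrow> 'm" where
  "tan_arr T \<equiv> farr (T_at T wW)"

definition tan_p :: "('o, 'm) cat \<Rightarrow> ('o, 'm) weil_action \<Rightarrow> 'o \<Rightarrow> 'm" where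
  "tan_p C T X = inv_arr C (act_unit T X) \<bullet>\<^bsub>C\<^esub> T_nat C T weil_p X"

definition tan_zero :: "('o, 'm) cat \<Rightarrow> ('o, 'm) weil_action \<Rightarrow> 'o \<Rightarrow> 'm" where
  "tan_zero C T X = T_nat C T weil_zero X \<bullet>\<^bsub>C\<^esub> act_unit T X"

definition tan_l :: "('o, 'm) cat \<Rightarrow> ('o, 'm) weil_action \<Rightarrow> 'o \<Rightarrow> 'm" where
  "tan_l C T X = inv_arr C (act_mult T wW wW X) \<bullet>\<^bsub>C\<^esub> T_nat C T weil_l X"


section \<open>Differential bundles\<close>

(* tot2 with projections pr0, pr1 is the chosen pullback of proj along itself. *)
record ('o, 'm) abundle =
  tot :: 'o
  base :: 'o
  proj :: 'm
  tot2 :: 'o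
  pr0 :: 'm
  pr1 :: 'm
  plus :: 'm
  null :: 'm

(* is_pair C B a b h:  h = <a,b> : Z -> tot2 B. *)
definition is_pair ::
    "('o, 'm) cat \<Rightarrow> ('o, 'm, 'z) abundle_scheme \<Rightarrow> 'm \<Rightarrow> 'm \<Rightarrow> 'm \<Rightarrow> bool" where
  "is_pair C B a b h \<longleftrightarrow> h \<in> Hom C (Dom C a) (tot2 B) \<and>
     pr0 B \<bullet>\<^bsub>C\<^esub> h = a \<and> pr1 B \<bullet>\<^bsub>C\<^esub> h = b"

(* The laws for the addition are stated on generalised elements a, b, c : Z -> tot B over
   the same map to base B; taking the projections of the fibre powers gives the diagrams. *)
definition additive_bundle :: "('o, 'm) cat \<Rightarrow> ('o, 'm, 'z) abundle_scheme \<Rightarrow> bool" where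
  "additive_bundle C B \<longleftrightarrow>
     proj B \<in> Hom C (tot B) (base B) \<and>
     (\<forall>n. \<exists>b pr. is_fibre_power C (proj B) n b pr) \<and>
     pr0 B \<in> Hom C (tot2 B) (tot B) \<and> pr1 B \<in> Hom C (tot2 B) (tot B) \<and>
     is_pullback C (proj B) (proj B) (pr0 B) (pr1 B) \<and>
     plus B \<in> Hom C (tot2 B) (tot B) \<and>
     null B \<in> Hom C (base B) (tot B) \<and>
     proj B \<bullet>\<^bsub>C\<^esub> plus B = proj B \<bullet>\<^bsub>C\<^esub> pr0 B \<and>
     proj B \<bullet>\<^bsub>C\<^esub> null B = Ide C (base B) \<and>
     (\<forall>Z a b c ab bc l r.
        a \<in> Hom C Z (tot B) \<longrightarrow> b \<in> Hom C Z (tot B) \<longrightarrow> c \<in> Hom C Z (tot B) \<longrightarrow>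
        is_pair C B a b ab \<longrightarrow> is_pair C B b c bc \<longrightarrow>
        is_pair C B (plus B \<bullet>\<^bsub>C\<^esub> ab) c l \<longrightarrow> is_pair C B a (plus B \<bullet>\<^bsub>C\<^esub> bc) r \<longrightarrow>
        plus B \<bullet>\<^bsub>C\<^esub> l = plus B \<bullet>\<^bsub>C\<^esub> r) \<and>
     (\<forall>Z a b h h'.
        a \<in> Hom C Z (tot B) \<longrightarrow> b \<in> Hom C Z (tot B) \<longrightarrow>
        is_pair C B a b h \<longrightarrow> is_pair C B b a h' \<longrightarrow>
        plus B \<bullet>\<^bsub>C\<^esub> h = plus B \<bullet>\<^bsub>C\<^esub> h') \<and>
     (\<forall>Z a h.
        a \<in> Hom C Z (tot B) \<longrightarrow> is_pair C B a (null B \<bullet>\<^bsub>C\<^esub> (proj B \<bullet>\<^bsub>C\<^esub> a)) h \<longrightarrow>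
        plus B \<bullet>\<^bsub>C\<^esub> h = a)"

definition bundle_morphism ::
    "('o, 'm) cat \<Rightarrow> ('o, 'm, 'y) abundle_scheme \<Rightarrow> ('o, 'm, 'z) abundle_scheme
       \<Rightarrow> 'm \<Rightarrow> 'm \<Rightarrow> bool" where
  "bundle_morphism C B B' f g \<longleftrightarrow>
     f \<in> Hom C (tot B) (tot B') \<and> g \<in> Hom C (base B) (base B') \<and>
     proj B' \<bullet>\<^bsub>C\<^esub> f = g \<bullet>\<^bsub>C\<^esub> proj B"

(* f2 below is the map tot2 B -> tot2 B' induced by f; the additivity conditions are the
   same for additive bundles and for differential bundles. *)
definition additive_morphism ::
    "('o, 'm) cat \<Rightarrow> ('o, 'm, 'y) abundle_scheme \<Rightarrow> ('o, 'm, 'z) abundle_scheme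
       \<Rightarrow> 'm \<Rightarrow> 'm \<Rightarrow> bool" where
  "additive_morphism C B B' f g \<longleftrightarrow> bundle_morphism C B B' f g \<and>
     (\<exists>f2. is_pair C B' (f \<bullet>\<^bsub>C\<^esub> pr0 B) (f \<bullet>\<^bsub>C\<^esub> pr1 B) f2 \<and>
        f \<bullet>\<^bsub>C\<^esub> plus B = plus B' \<bullet>\<^bsub>C\<^esub> f2) \<and>
     f \<bullet>\<^bsub>C\<^esub> null B = null B' \<bullet>\<^bsub>C\<^esub> g"

record ('o, 'm) dbundle = "('o, 'm) abundle" +
  lift :: 'm

(* (TE, TM, Tq, T\<sigma>, T\<zeta>) *)
definition tan_image ::
    "('o, 'm) weil_action \<Rightarrow> ('o, 'm, 'z) abundle_scheme \<Rightarrow> ('o, 'm) abundle" where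
  "tan_image T B = \<lparr>tot = tan_obj T (tot B), base = tan_obj T (base B),
     proj = tan_arr T (proj B), tot2 = tan_obj T (tot2 B),
     pr0 = tan_arr T (pr0 B), pr1 = tan_arr T (pr1 B),
     plus = tan_arr T (plus B), null = tan_arr T (null B)\<rparr>"

(* (TE, E, p_E, +_E, 0_E), with T_2 E given by the action of the product of W with itself *)
definition tan_bundle ::
    "('o, 'm) cat \<Rightarrow> ('o, 'm) weil_action \<Rightarrow> 'o \<Rightarrow> ('o, 'm) abundle" where
  "tan_bundle C T E = \<lparr>tot = tan_obj T E, base = E,
     proj = tan_p C T E, tot2 = fobj (T_at T wW2) E,
     pr0 = T_nat C T (weil_pr 0) E, pr1 = T_nat C T (weil_pr 1) E,
     plus = T_nat C T weil_plus E, null = tan_zero C T E\<rparr>"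

(* All the axioms of a differential bundle except the universality of the lift. *)
definition pre_differential_bundle ::
    "('o, 'm) cat \<Rightarrow> ('o, 'm) weil_action \<Rightarrow> ('o, 'm) dbundle \<Rightarrow> bool" where
  "pre_differential_bundle C T B \<longleftrightarrow>
     additive_bundle C B \<and>
     (\<forall>n k b pr. is_fibre_power C (proj B) n b pr \<longrightarrow>
        is_fibre_power C ((tan_arr T ^^ k) (proj B)) n
          ((tan_arr T ^^ k) b) (\<lambda>i. (tan_arr T ^^ k) (pr i))) \<and>
     lift B \<in> Hom C (tot B) (tan_obj T (tot B)) \<and>
     additive_morphism C B (tan_image T B) (lift B) (tan_zero C T (base B)) \<and>
     additive_morphism C B (tan_bundle C T (tot B)) (lift B) (null B) \<and>
     tan_l C T (tot B) \<bullet>\<^bsub>C\<^esub> lift B = tan_arr T (lift B) \<bullet>\<^bsub>C\<^esub> lift B"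

definition universal_lift ::
    "('o, 'm) cat \<Rightarrow> ('o, 'm) weil_action \<Rightarrow> ('o, 'm) dbundle \<Rightarrow> bool" where
  "universal_lift C T B \<longleftrightarrow>
     (\<exists>v. is_pair C (tan_image T B)
            (lift B \<bullet>\<^bsub>C\<^esub> pr0 B) (tan_zero C T (tot B) \<bullet>\<^bsub>C\<^esub> pr1 B) v \<and>
        is_pullback C (tan_zero C T (base B)) (tan_arr T (proj B))
          (proj B \<bullet>\<^bsub>C\<^esub> pr0 B) (tan_arr T (plus B) \<bullet>\<^bsub>C\<^esub> v))"

definition differential_bundle ::
    "('o, 'm) cat \<Rightarrow> ('o, 'm) weil_action \<Rightarrow> ('o, 'm) dbundle \<Rightarrow> bool" where
  "differential_bundle C T B \<longleftrightarrow> pre_differential_bundle C T B \<and> universal_lift C T B"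

definition differential_object ::
    "('o, 'm) cat \<Rightarrow> ('o, 'm) weil_action \<Rightarrow> 'o \<Rightarrow> ('o, 'm) dbundle \<Rightarrow> bool" where
  "differential_object C T t B \<longleftrightarrow> terminal C t \<and> base B = t \<and> differential_bundle C T B"


section \<open>Differential functors\<close>

(* al A X : F(T_A X) -> T'_A(F X) is the component of the oplax structure. *)
definition oplax_weil_functor ::
    "('o, 'm) cat \<Rightarrow> ('o, 'm) weil_action \<Rightarrow> ('p, 'n) cat \<Rightarrow> ('p, 'n) weil_action
       \<Rightarrow> ('o, 'm, 'p, 'n) ftor \<Rightarrow> (wobj \<Rightarrow> 'o \<Rightarrow> 'n) \<Rightarrow> bool" where
  "oplax_weil_functor C T C' T' F al \<longleftrightarrow>
     is_functor C C' F \<and>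
     is_nat_trans (Weil \<times>\<^sub>c C) C'
       \<lparr>fobj = (\<lambda>(A, X). fobj F (fobj (act T) (A, X))),
        farr = (\<lambda>(\<theta>, f). farr F (farr (act T) (\<theta>, f)))\<rparr>
       \<lparr>fobj = (\<lambda>(A, X). fobj (act T') (A, fobj F X)),
        farr = (\<lambda>(\<theta>, f). farr (act T') (\<theta>, farr F f))\<rparr>
       (\<lambda>(A, X). al A X) \<and>
     (\<forall>A\<in>Obj Weil. \<forall>B\<in>Obj Weil. \<forall>X\<in>Obj C.
        al (A \<otimes>\<^sub>w B) X \<bullet>\<^bsub>C'\<^esub> farr F (act_mult T A B X) =
        act_mult T' A B (fobj F X) \<bullet>\<^bsub>C'\<^esub>
          (farr (T_at T' A) (al B X) \<bullet>\<^bsub>C'\<^esub> al A (fobj (T_at T B) X))) \<and>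
     (\<forall>X\<in>Obj C. al wN X \<bullet>\<^bsub>C'\<^esub> farr F (act_unit T X) = act_unit T' (fobj F X))"

definition differential_functor ::
    "('o, 'm) cat \<Rightarrow> ('o, 'm) weil_action \<Rightarrow> ('p, 'n) cat \<Rightarrow> ('p, 'n) weil_action
       \<Rightarrow> 'o \<Rightarrow> ('o, 'm, 'p, 'n) ftor \<Rightarrow> (wobj \<Rightarrow> 'o \<Rightarrow> 'n) \<Rightarrow> bool" where
  "differential_functor C T C' T' t F al \<longleftrightarrow>
     terminal C t \<and> oplax_weil_functor C T C' T' F al \<and>
     (\<forall>A\<in>Obj Weil. \<forall>f g p q.
        is_pullback C f g p q \<longrightarrow> Cod C f = t \<longrightarrow>
        is_pullback C' (farr (T_at T' A) (farr F f)) (farr (T_at T' A) (farr F g))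
          (farr (T_at T' A) (farr F p)) (farr (T_at T' A) (farr F q))) \<and>
     (\<forall>A\<in>Obj Weil. \<forall>X Y. \<forall>f\<in>Hom C X Y.
        is_pullback C' (farr (T_at T' A) (farr F f)) (al A Y)
          (al A X) (farr F (farr (T_at T A) f)))"

(* The domain of F(\<sigma>) is F(A_2), so F(A_2) with the images of the projections is the
   chosen second fibre power. *)
definition functor_image ::
    "('p, 'n) cat \<Rightarrow> ('o, 'm, 'p, 'n) ftor \<Rightarrow> (wobj \<Rightarrow> 'o \<Rightarrow> 'n)
       \<Rightarrow> ('o, 'm) dbundle \<Rightarrow> ('p, 'n) dbundle" where
  "functor_image C' F al B = \<lparr>tot = fobj F (tot B), base = fobj F (base B),
     proj = farr F (proj B), tot2 = fobj F (tot2 B),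
     pr0 = farr F (pr0 B), pr1 = farr F (pr1 B),
     plus = farr F (plus B), null = farr F (null B),
     lift = al wW (tot B) \<bullet>\<^bsub>C'\<^esub> farr F (lift B)\<rparr>"

end

theory Submission
  imports Defs
begin

text \<open>
  The data of a differential bundle consist of limits over its base, namely the fibre powers of
  the projection, and of equations between maps built from the projection, the addition, the zero
  section, the lift and the natural transformations \<open>p\<close>, \<open>0\<close>, \<open>+\<close>, \<open>\<ell>\<close> of the tangent
  structure. Over a terminal object both survive a differential functor, for different reasons.

  \<^emph>\<open>Limits.\<close> The fibre powers of \<open>q : E \<rightarrow> t\<close> are iterated pullbacks over \<open>t\<close>
  (\<open>fibre_power_Suc_pullback\<close>, \<open>fibre_power_SucI\<close>), starting from isomorphisms onto \<open>t\<close>. Each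
  \<open>T'\<^sub>A F\<close> preserves pullbacks over \<open>t\<close>, and the \<open>k\<close>-th iterate of \<open>T'\<close> is isomorphic to the
  action of the \<open>k\<close>-th tensor power of \<open>W\<close> (\<open>tan_power_nat_iso\<close>); so \<open>T'\<^sup>k F\<close> preserves all
  fibre powers of \<open>q\<close> (\<open>tan_power_fibre_power\<close>). In particular \<open>F\<close> itself does, which is the case
  \<open>k = 0\<close>. The associativity of the addition of \<open>F E\<close> is then the image of the corresponding
  equation between maps out of \<open>E\<^sub>3\<close>, because every compatible triple of generalised elements of
  \<open>F E\<close> factors through \<open>F E\<^sub>3\<close>; commutativity and unit are treated in the same way.

  \<^emph>\<open>Equations.\<close> The oplax structure \<open>\<alpha>\<close>, the family \<open>al\<close>, is natural in the Weil algebra as well as in the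
  object, and is compatible with the unit and the multiplication of the two actions. Hence it
  commutes with \<open>p\<close>, \<open>0\<close>, \<open>+\<close> and \<open>\<ell>\<close> (\<open>al_tan_p\<close>, \<open>al_tan_zero\<close>, \<open>al_T_nat\<close>, \<open>al_tan_l\<close>). In
  other words, the components of \<open>\<alpha>\<close> form maps of additive bundle diagrams from the \<open>F\<close>-image of
  a tangent bundle to the tangent bundle of the \<open>F\<close>-image, and composing them with the \<open>F\<close>-image
  of the lift gives a lift with the required linearity (\<open>additive_morphism_image\<close>).

  \<^emph>\<open>Universality of the lift.\<close> The defining square lies over \<open>T t\<close> rather than over \<open>t\<close>. If \<open>T t\<close>
  is terminal, it is isomorphic to \<open>t\<close>, so \<open>F\<close> preserves the square; pasting the result with the
  naturality square of \<open>\<alpha>\<close> at \<open>q\<close>, a pullback by the definition of a differential functor, gives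
  the square of the image.

  The naturality arguments need \<open>p\<close>, \<open>0\<close>, \<open>+\<close>, \<open>\<ell>\<close> and the projections of \<open>W\<^sup>2\<close> to be morphisms
  of \<open>Weil\<close>. Since they are specified by definite description, this is an existence and uniqueness
  statement, and it follows from the universal property of the presented algebras: a homomorphism
  is determined by the images of the generators (\<open>weil_hom_eqI\<close>), and these may be chosen freely
  subject to the relations (\<open>weil_hom_exists\<close>).
\<close>

section \<open>Polynomials with natural coefficients\<close>

lemma npolys_zero: "0 \<in> npolys n"
  and npolys_one: "1 \<in> npolys n"
  by (auto simp: npolys_def)

lemma npolys_var: "i < n \<Longrightarrow> var i \<in> npolys n"
  by (auto simp: npolys_def var_def split: if_splits)

lemma npolys_add: "p \<in> npolys n \<Longrightarrow> q \<in> npolys n \<Longrightarrow> p + q \<in> npolys n"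
  using keys_add[of p q] by (fastforce simp: npolys_def)

lemma npolys_mult:
  assumes "p \<in> npolys n" "q \<in> npolys n"
  shows "p * q \<in> npolys n"
  unfolding npolys_def
proof clarify
  fix m i assume m: "m \<in> Poly_Mapping.keys (p * q)" and i: "i \<in> Poly_Mapping.keys m"
  obtain a b where "a \<in> Poly_Mapping.keys p" "b \<in> Poly_Mapping.keys q" "m = a + b"
    using keys_mult[of p q] m by blast
  then show "i < n"
    using assms keys_add[of a b] i by (fastforce simp: npolys_def)
qed

lemma npolys_of_nat: "of_nat a \<in> npolys n"
  by (induction a) (auto intro: npolys_zero npolys_one npolys_add)

lemmas npolys_closed = npolys_zero npolys_one npolys_var npolys_add npolys_mult npolys_of_nat

lemma var_power: "Poly_Mapping.single (Poly_Mapping.single i k) 1 = var i ^ k"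
proof (induction k)
  case (Suc k)
  have "Poly_Mapping.single (Poly_Mapping.single i (Suc k)) (1::nat) =
      Poly_Mapping.single (Poly_Mapping.single i 1 + Poly_Mapping.single i k) (1 * 1)"
    by (simp add: single_add[symmetric])
  also have "\<dots> = var i * var i ^ k"
    unfolding mult_single[symmetric] Suc.IH var_def[symmetric] ..
  finally show ?case by simp
qed (simp add: single_one[symmetric] del: single_one One_nat_def)

lemma single_eq_prod_var:
  fixes f :: "nat \<Rightarrow> nat"
  assumes "finite S"
  shows "Poly_Mapping.single (\<Sum>i\<in>S. Poly_Mapping.single i (f i)) 1 = (\<Prod>i\<in>S. var i ^ f i)"
  using assms
proof (induction S)
  case (insert i S)
  have "Poly_Mapping.single (\<Sum>i\<in>insert i S. Poly_Mapping.single i (f i)) (1::nat) =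
     Poly_Mapping.single (Poly_Mapping.single i (f i)) 1 *
     Poly_Mapping.single (\<Sum>i\<in>S. Poly_Mapping.single i (f i)) 1"
    using insert.hyps by (simp add: mult_single)
  then show ?case using insert by (simp only: var_power prod.insert not_False_eq_True)
qed (simp add: single_one[symmetric] del: single_one One_nat_def)

lemma sum_single_lookup:
  fixes p :: "'a \<Rightarrow>\<^sub>0 'b::comm_monoid_add"
  shows "(\<Sum>m\<in>Poly_Mapping.keys p. Poly_Mapping.single m (Poly_Mapping.lookup p m)) = p"
  by (rule poly_mapping_eqI)
     (auto simp: lookup_sum lookup_single when_def in_keys_iff)

text \<open>Every polynomial arises from the variables by the semiring operations. This is the tool for
showing that a homomorphism is determined by its values on generators, and that a substitution
preserves membership in a set closed under the operations.\<close>

lemma npolys_induct [consumes 1, case_names zero one var add mult]: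
  assumes p: "p \<in> npolys n"
    and zero: "P 0" and one: "P 1" and var: "\<And>i. i < n \<Longrightarrow> P (var i)"
    and add: "\<And>p q. p \<in> npolys n \<Longrightarrow> q \<in> npolys n \<Longrightarrow> P p \<Longrightarrow> P q \<Longrightarrow> P (p + q)"
    and mult: "\<And>p q. p \<in> npolys n \<Longrightarrow> q \<in> npolys n \<Longrightarrow> P p \<Longrightarrow> P q \<Longrightarrow> P (p * q)"
  shows "P p"
proof -
  let ?Q = "\<lambda>p. p \<in> npolys n \<and> P p"
  have Q0: "?Q 0" and Q1: "?Q 1" and Qv: "\<And>i. i < n \<Longrightarrow> ?Q (var i)"
    and Qa: "\<And>p q. ?Q p \<Longrightarrow> ?Q q \<Longrightarrow> ?Q (p + q)"
    and Qm: "\<And>p q. ?Q p \<Longrightarrow> ?Q q \<Longrightarrow> ?Q (p * q)"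
    using zero one var add mult by (auto intro: npolys_closed)
  have Qn: "?Q (of_nat a)" for a by (induction a) (auto simp del: of_nat_Suc simp: of_nat_Suc Q0 Q1 Qa)
  have Qp: "?Q (var i ^ k)" if "i < n" for i k by (induction k) (use Q1 Qv[OF that] Qm in auto)
  have Qprod: "?Q (\<Prod>i\<in>S. var i ^ f i)" if "finite S" "S \<subseteq> {..<n}" for S and f :: "nat \<Rightarrow> nat"
    using that by (induction S) (use Q1 Qp Qm in auto)
  have Qs: "?Q (Poly_Mapping.single m a)" if "Poly_Mapping.keys m \<subseteq> {..<n}" for m :: "nat \<Rightarrow>\<^sub>0 nat" and a :: nat
  proof -
    have "Poly_Mapping.single m a = of_nat a * Poly_Mapping.single m 1"
      by (simp add: single_of_nat[symmetric] mult_single)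
    moreover have "Poly_Mapping.single m 1 =
        (\<Prod>i\<in>Poly_Mapping.keys m. var i ^ Poly_Mapping.lookup m i)"
      using single_eq_prod_var[of "Poly_Mapping.keys m" "Poly_Mapping.lookup m"]
      by (simp add: sum_single_lookup)
    ultimately show ?thesis
      using Qm[OF Qn Qprod[OF _ that]] by simp
  qed
  have "?Q (\<Sum>m\<in>S. Poly_Mapping.single m (Poly_Mapping.lookup p m))"
    if "finite S" "S \<subseteq> Poly_Mapping.keys p" for S
    using that
  proof (induction S)
    case (insert m S)
    have "Poly_Mapping.keys m \<subseteq> {..<n}" using insert.prems p by (auto simp: npolys_def)
    from Qa[OF Qs[OF this]] insert show ?case by simp
  qed (simp add: Q0)
  from this[of "Poly_Mapping.keys p"] show ?thesis by (simp add: sum_single_lookup)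
qed

definition monomial_subst :: "(nat \<Rightarrow> npoly) \<Rightarrow> (nat \<Rightarrow>\<^sub>0 nat) \<Rightarrow> npoly" where
  "monomial_subst g m = (\<Prod>i\<in>Poly_Mapping.keys m. g i ^ Poly_Mapping.lookup m i)"

text \<open>Simultaneous substitution of polynomials for the variables: the universal property of the
polynomial semiring, given by an explicit formula.\<close>

definition poly_subst :: "(nat \<Rightarrow> npoly) \<Rightarrow> npoly \<Rightarrow> npoly" where
  "poly_subst g p = (\<Sum>m\<in>Poly_Mapping.keys p. of_nat (Poly_Mapping.lookup p m) * monomial_subst g m)"

lemma monomial_subst_superset:
  assumes "finite S" "Poly_Mapping.keys m \<subseteq> S"
  shows "monomial_subst g m = (\<Prod>i\<in>S. g i ^ Poly_Mapping.lookup m i)"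
  unfolding monomial_subst_def
  by (rule prod.mono_neutral_left) (use assms in \<open>auto simp: in_keys_iff\<close>)

lemma monomial_subst_add: "monomial_subst g (m + m') = monomial_subst g m * monomial_subst g m'"
proof -
  let ?S = "Poly_Mapping.keys m \<union> Poly_Mapping.keys m'"
  have "monomial_subst g (m + m') = (\<Prod>i\<in>?S. g i ^ Poly_Mapping.lookup (m + m') i)"
    by (rule monomial_subst_superset) (use keys_add[of m m'] in auto)
  also have "\<dots> = (\<Prod>i\<in>?S. g i ^ Poly_Mapping.lookup m i) * (\<Prod>i\<in>?S. g i ^ Poly_Mapping.lookup m' i)"
    by (simp add: lookup_add power_add prod.distrib)
  also have "\<dots> = monomial_subst g m * monomial_subst g m'"
    by (simp add: monomial_subst_superset[of ?S])
  finally show ?thesis .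
qed

lemma poly_subst_add: "poly_subst g (p + q) = poly_subst g p + poly_subst g q"
  unfolding poly_subst_def by (rule setsum_keys_plus_distrib) (simp_all add: algebra_simps)

lemma poly_subst_zero: "poly_subst g 0 = 0"
  by (simp add: poly_subst_def)

lemma poly_subst_single: "poly_subst g (Poly_Mapping.single m a) = of_nat a * monomial_subst g m"
  by (simp add: poly_subst_def)

lemma poly_subst_of_nat: "poly_subst g (of_nat a) = of_nat a"
  unfolding single_of_nat[symmetric] poly_subst_single by (simp add: monomial_subst_def)

lemma poly_subst_one: "poly_subst g 1 = 1"
  using poly_subst_of_nat[of g 1] by simp

lemma poly_subst_var: "poly_subst g (var i) = g i"
  unfolding var_def poly_subst_single by (simp add: monomial_subst_def)

lemma poly_induct_single [case_names zero single add]: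
  fixes p :: "'a \<Rightarrow>\<^sub>0 'b::comm_monoid_add"
  assumes "P 0" "\<And>m a. P (Poly_Mapping.single m a)" "\<And>p q. P p \<Longrightarrow> P q \<Longrightarrow> P (p + q)"
  shows "P p"
proof -
  have "P (\<Sum>m\<in>S. Poly_Mapping.single m (Poly_Mapping.lookup p m))" if "finite S" for S
    using that by (induction S) (use assms in auto)
  from this[of "Poly_Mapping.keys p"] show ?thesis
    by (simp add: sum_single_lookup)
qed

lemma poly_subst_mult: "poly_subst g (p * q) = poly_subst g p * poly_subst g q"
proof (induction p rule: poly_induct_single)
  case (single m a)
  show ?case
    by (induction q rule: poly_induct_single)
       (simp_all add: poly_subst_zero poly_subst_add poly_subst_single mult_single monomial_subst_add algebra_simps)
qed (simp_all add: poly_subst_zero poly_subst_add algebra_simps)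

lemmas poly_subst_simps = poly_subst_zero poly_subst_one poly_subst_of_nat poly_subst_var poly_subst_add poly_subst_mult

lemma poly_subst_npolys:
  assumes "p \<in> npolys n" "\<And>i. i < n \<Longrightarrow> g i \<in> npolys k"
  shows "poly_subst g p \<in> npolys k"
  using assms(1) by (induction rule: npolys_induct) (auto simp: poly_subst_simps assms intro: npolys_closed)

section \<open>Homomorphisms of Weil algebras\<close>

lemma weil_objs_rel_bound: "A \<in> weil_objs \<Longrightarrow> (i, j) \<in> snd A \<Longrightarrow> i < fst A \<and> j < fst A"
  unfolding weil_objs_def equiv_def refl_on_def by auto

lemma wclass_eq: "wcong A p q \<Longrightarrow> wclass A p = wclass A q"
  by (auto simp: wclass_def intro: wcong.sym wcong.trans)

text \<open>A substitution that respects the relations of \<open>A\<close> descends to the quotients, since its effect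
on the congruence of \<open>A\<close> can be followed along each generating rule.\<close>

lemma wcong_subst:
  assumes "wcong A p q" "\<And>i. i < fst A \<Longrightarrow> g i \<in> npolys (fst B)"
    "\<And>i j. (i, j) \<in> snd A \<Longrightarrow> wcong B (g i * g j) 0"
  shows "wcong B (poly_subst g p) (poly_subst g q)"
  using assms(1)
  by induction (auto simp: poly_subst_simps assms(2,3) intro: wcong.intros poly_subst_npolys[OF _ assms(2)])

text \<open>The union that defines the sum of two classes ranges over a constant family, because the
congruence is compatible with addition; so classes can be added on representatives. Products
behave in the same way.\<close>

lemma weil_alg_add:
  assumes "p \<in> npolys (fst A)" "q \<in> npolys (fst A)"
  shows "wclass A p \<oplus>\<^bsub>weil_alg A\<^esub> wclass A q = wclass A (p + q)"
proof -
  have "wclass A (p' + q') = wclass A (p + q)" if "p' \<in> wclass A p" "q' \<in> wclass A q" for p' q'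
    by (rule wclass_eq[OF wcong.sym]) (use that in \<open>simp add: wclass_def wcong.add\<close>)
  moreover have "p \<in> wclass A p" "q \<in> wclass A q" using assms by (auto simp: wclass_def intro: wcong.refl)
  ultimately have "(\<Union>p'\<in>wclass A p. \<Union>q'\<in>wclass A q. wclass A (p' + q')) = wclass A (p + q)"
    by blast
  then show ?thesis by (simp add: weil_alg_def)
qed

lemma weil_alg_mult:
  assumes "p \<in> npolys (fst A)" "q \<in> npolys (fst A)"
  shows "wclass A p \<otimes>\<^bsub>weil_alg A\<^esub> wclass A q = wclass A (p * q)"
proof -
  have "wclass A (p' * q') = wclass A (p * q)" if "p' \<in> wclass A p" "q' \<in> wclass A q" for p' q'
    by (rule wclass_eq[OF wcong.sym]) (use that in \<open>simp add: wclass_def wcong.mult\<close>)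
  moreover have "p \<in> wclass A p" "q \<in> wclass A q" using assms by (auto simp: wclass_def intro: wcong.refl)
  ultimately have "(\<Union>p'\<in>wclass A p. \<Union>q'\<in>wclass A q. wclass A (p' * q')) = wclass A (p * q)"
    by blast
  then show ?thesis by (simp add: weil_alg_def)
qed

lemma weil_alg_carrier: "carrier (weil_alg A) = wclass A ` npolys (fst A)"
  and weil_alg_one: "\<one>\<^bsub>weil_alg A\<^esub> = wclass A 1"
  and weil_alg_zero: "\<zero>\<^bsub>weil_alg A\<^esub> = wclass A 0"
  by (simp_all add: weil_alg_def)

text \<open>Splitting the triple that represents a morphism once and for all; later arguments use only these
components.\<close>

lemma weil_Hom_iff:
  "\<theta> \<in> Hom Weil A B \<longleftrightarrow> A \<in> weil_objs \<and> B \<in> weil_objs \<and> fst \<theta> = A \<and> snd (snd \<theta>) = B \<and>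
     wfun \<theta> \<in> extensional (carrier (weil_alg A)) \<and> wfun \<theta> \<in> ring_hom (weil_alg A) (weil_alg B) \<and>
     wfun \<theta> \<zero>\<^bsub>weil_alg A\<^esub> = \<zero>\<^bsub>weil_alg B\<^esub>"
  by (cases \<theta>) (auto simp: Hom_def Weil_def)

text \<open>The uniqueness half of the universal property of \<open>A\<close>: two homomorphisms agree on a class
\<open>[p]\<close> by induction on the way in which \<open>p\<close> is built from the variables, and they agree outside the
carrier because both are extensional.\<close>

lemma weil_hom_eqI:
  assumes "\<theta> \<in> Hom Weil A B" "\<theta>' \<in> Hom Weil A B"
    and eq: "\<And>i. i < fst A \<Longrightarrow> wfun \<theta> (wclass A (var i)) = wfun \<theta>' (wclass A (var i))"
  shows "\<theta> = \<theta>'"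
proof -
  let ?h = "wfun \<theta>" and ?h' = "wfun \<theta>'"
  have ext: "?h \<in> extensional (carrier (weil_alg A))" "?h' \<in> extensional (carrier (weil_alg A))"
    and hom: "?h \<in> ring_hom (weil_alg A) (weil_alg B)" "?h' \<in> ring_hom (weil_alg A) (weil_alg B)"
    and z: "?h \<zero>\<^bsub>weil_alg A\<^esub> = \<zero>\<^bsub>weil_alg B\<^esub>" "?h' \<zero>\<^bsub>weil_alg A\<^esub> = \<zero>\<^bsub>weil_alg B\<^esub>"
    using assms(1,2) by (simp_all add: weil_Hom_iff)
  have "?h (wclass A p) = ?h' (wclass A p)" if "p \<in> npolys (fst A)" for p
    using that
  proof (induction rule: npolys_induct)
    case zero then show ?case using z by (simp add: weil_alg_zero)
  next
    case one then show ?case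
      using ring_hom_one[OF hom(1)] ring_hom_one[OF hom(2)] by (simp add: weil_alg_one)
  next
    case (var i) then show ?case using eq by simp
  next
    case (add p q) then show ?case
      using ring_hom_add[OF hom(1), of "wclass A p" "wclass A q"]
        ring_hom_add[OF hom(2), of "wclass A p" "wclass A q"]
      by (simp add: weil_alg_carrier weil_alg_add)
  next
    case (mult p q) then show ?case
      using ring_hom_mult[OF hom(1), of "wclass A p" "wclass A q"]
        ring_hom_mult[OF hom(2), of "wclass A p" "wclass A q"]
      by (simp add: weil_alg_carrier weil_alg_mult)
  qed
  then have "?h = ?h'"
    by (intro extensionalityI[OF ext]) (auto simp: weil_alg_carrier)
  then show ?thesis using assms(1,2) by (simp add: weil_Hom_iff prod_eq_iff)
qed

text \<open>The existence half: \<open>[p] \<mapsto> [p(g)]\<close> is well defined on classes because the substitution \<open>g\<close>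
respects the relations of \<open>A\<close>.\<close>

lemma weil_hom_exists:
  assumes AB: "A \<in> weil_objs" "B \<in> weil_objs"
    and g: "\<And>i. i < fst A \<Longrightarrow> g i \<in> npolys (fst B)"
    and rel: "\<And>i j. (i, j) \<in> snd A \<Longrightarrow> wcong B (g i * g j) 0"
  obtains \<theta> where "\<theta> \<in> Hom Weil A B"
    "\<And>p. p \<in> npolys (fst A) \<Longrightarrow> wfun \<theta> (wclass A p) = wclass B (poly_subst g p)"
proof -
  define h where "h = restrict (\<lambda>P. \<Union>p\<in>P. wclass B (poly_subst g p)) (carrier (weil_alg A))"
  have h: "h (wclass A p) = wclass B (poly_subst g p)" if "p \<in> npolys (fst A)" for p
  proof -
    have "wclass B (poly_subst g p') = wclass B (poly_subst g p)" if "p' \<in> wclass A p" for p'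
      by (rule wclass_eq[OF wcong_subst[OF wcong.sym g rel]]) (use that in \<open>auto simp: wclass_def\<close>)
    moreover have "p \<in> wclass A p" using that by (auto simp: wclass_def intro: wcong.refl)
    ultimately have "(\<Union>p'\<in>wclass A p. wclass B (poly_subst g p')) = wclass B (poly_subst g p)"
      by blast
    then show ?thesis using that by (simp add: h_def weil_alg_carrier)
  qed
  have sub: "poly_subst g p \<in> npolys (fst B)" if "p \<in> npolys (fst A)" for p
    using poly_subst_npolys[OF that] g by blast
  have "h \<in> ring_hom (weil_alg A) (weil_alg B)"
    by (rule ring_hom_memI)
       (auto simp: weil_alg_carrier weil_alg_one weil_alg_add weil_alg_mult h sub npolys_closed poly_subst_simps)
  moreover have "h \<zero>\<^bsub>weil_alg A\<^esub> = \<zero>\<^bsub>weil_alg B\<^esub>"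
    by (simp add: weil_alg_zero h npolys_closed poly_subst_simps)
  ultimately have "(A, h, B) \<in> Hom Weil A B"
    using AB by (simp add: weil_Hom_iff h_def)
  with h show ?thesis by (intro that[of "(A, h, B)"]) auto
qed

text \<open>Any property \<open>P\<close> that holds for the substitution homomorphism of \<open>g\<close> and forces the values on the
generators has exactly one witness. All the definite descriptions of morphisms below are of this
form; it remains to name \<open>g\<close> and to read off the values on the variables.\<close>

lemma weil_hom_the_spec:
  assumes AB: "A \<in> weil_objs" "B \<in> weil_objs"
    and g: "\<And>i. i < fst A \<Longrightarrow> g i \<in> npolys (fst B)"
    and rel: "\<And>i j. (i, j) \<in> snd A \<Longrightarrow> wcong B (g i * g j) 0"
    and P: "\<And>\<theta>. \<theta> \<in> Hom Weil A B \<Longrightarrow>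
       (\<And>p. p \<in> npolys (fst A) \<Longrightarrow> wfun \<theta> (wclass A p) = wclass B (poly_subst g p)) \<Longrightarrow> P \<theta>"
    and vars: "\<And>\<theta> i. \<theta> \<in> Hom Weil A B \<Longrightarrow> P \<theta> \<Longrightarrow> i < fst A \<Longrightarrow>
       wfun \<theta> (wclass A (var i)) = wclass B (g i)"
  shows "(THE \<theta>. \<theta> \<in> Hom Weil A B \<and> P \<theta>) \<in> Hom Weil A B \<and> P (THE \<theta>. \<theta> \<in> Hom Weil A B \<and> P \<theta>)"
proof (rule theI')
  obtain \<theta> where \<theta>: "\<theta> \<in> Hom Weil A B"
    "\<And>p. p \<in> npolys (fst A) \<Longrightarrow> wfun \<theta> (wclass A p) = wclass B (poly_subst g p)"
    by (rule weil_hom_exists[OF AB g rel]) auto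
  show "\<exists>!\<theta>. \<theta> \<in> Hom Weil A B \<and> P \<theta>"
  proof (rule ex1I[of _ \<theta>])
    show "\<theta> \<in> Hom Weil A B \<and> P \<theta>" using \<theta> P by blast
    fix \<theta>' assume \<theta>': "\<theta>' \<in> Hom Weil A B \<and> P \<theta>'"
    then show "\<theta>' = \<theta>"
      using \<theta>(1) vars[of \<theta>] vars[of \<theta>'] P[OF \<theta>] by (intro weil_hom_eqI[of _ A B]) simp_all
  qed
qed

section \<open>The distinguished morphisms and the tensor product\<close>

lemma wN_obj: "wN \<in> weil_objs"
  and wW_obj: "wW \<in> weil_objs"
  and wW2_obj: "wW2 \<in> weil_objs"
  by (auto simp: weil_objs_def wN_def wW_def wW2_def equiv_def refl_on_def sym_def trans_def)

lemma wtensor_obj: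
  assumes "A \<in> weil_objs" "B \<in> weil_objs"
  shows "A \<otimes>\<^sub>w B \<in> weil_objs"
proof -
  have A: "equiv {..<fst A} (snd A)" and B: "equiv {..<fst B} (snd B)"
    using assms by (auto simp: weil_objs_def)
  note bA = weil_objs_rel_bound[OF assms(1)] and bB = weil_objs_rel_bound[OF assms(2)]
  show ?thesis unfolding weil_objs_def mem_Collect_eq
  proof (rule equivI)
    show "snd (A \<otimes>\<^sub>w B) \<subseteq> {..<fst (A \<otimes>\<^sub>w B)} \<times> {..<fst (A \<otimes>\<^sub>w B)}"
      using bA bB by (force simp: wtensor_def)
    show "refl_on {..<fst (A \<otimes>\<^sub>w B)} (snd (A \<otimes>\<^sub>w B))"
    proof (rule refl_onI)
      fix i assume i: "i \<in> {..<fst (A \<otimes>\<^sub>w B)}"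
      show "(i, i) \<in> snd (A \<otimes>\<^sub>w B)"
      proof (cases "i < fst A")
        case True then show ?thesis using A by (auto simp: wtensor_def equiv_def refl_on_def)
      next
        case False
        then have "(i - fst A, i - fst A) \<in> snd B"
          using i B by (auto simp: wtensor_def equiv_def refl_on_def)
        then show ?thesis using False by (force simp: wtensor_def)
      qed
    qed
    show "sym (snd (A \<otimes>\<^sub>w B))"
      using A B by (force simp: wtensor_def equiv_def sym_def)
    have tA: "\<And>i j k. (i, j) \<in> snd A \<Longrightarrow> (j, k) \<in> snd A \<Longrightarrow> (i, k) \<in> snd A"
      and tB: "\<And>i j k. (i, j) \<in> snd B \<Longrightarrow> (j, k) \<in> snd B \<Longrightarrow> (i, k) \<in> snd B"
      using A B by (meson equiv_def transD)+
    show "trans (snd (A \<otimes>\<^sub>w B))"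
    proof (rule transI)
      fix i j k assume ij: "(i, j) \<in> snd (A \<otimes>\<^sub>w B)" and jk: "(j, k) \<in> snd (A \<otimes>\<^sub>w B)"
      show "(i, k) \<in> snd (A \<otimes>\<^sub>w B)"
      proof (cases "(i, j) \<in> snd A")
        case True
        then have "(j, k) \<in> snd A" using jk bA[OF True] by (auto simp: wtensor_def)
        then show ?thesis using tA[OF True] by (auto simp: wtensor_def)
      next
        case False
        then obtain i' j' where i: "i = fst A + i'" "j = fst A + j'" "(i', j') \<in> snd B"
          using ij by (auto simp: wtensor_def)
        then have "(j, k) \<notin> snd A" using bA[of j k] by auto
        then obtain k' where "k = fst A + k'" "(j', k') \<in> snd B"
          using jk i by (auto simp: wtensor_def)
        then show ?thesis using i tB by (force simp: wtensor_def)
      qed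
    qed
  qed
qed

lemma wW_pow_obj: "wW_pow n \<in> weil_objs"
  by (induction n) (auto intro: wN_obj wW_obj wtensor_obj)

lemma wcong_refl_rel: "A \<in> weil_objs \<Longrightarrow> i < fst A \<Longrightarrow> wcong A (var i * var i) 0"
  by (rule wcong.gen) (auto simp: weil_objs_def equiv_def refl_on_def)

lemma wcong_0_mult:
  assumes "wcong A p 0" "q \<in> npolys (fst A)"
  shows "wcong A (p * q) 0"
  using wcong.mult[OF assms(1) wcong.refl[OF assms(2)]] by simp


lemma fst_wtensor: "fst (A \<otimes>\<^sub>w B) = fst A + fst B"
  and snd_wtensor: "snd (A \<otimes>\<^sub>w B) = snd A \<union> (\<lambda>(i, j). (fst A + i, fst A + j)) ` snd B"
  by (simp_all add: wtensor_def)

lemma weil_simps: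
  "fst wN = 0" "snd wN = {}" "fst wW = 1" "snd wW = {(0, 0)}" "fst wW2 = 2" "snd wW2 = {..<2} \<times> {..<2}"
  "fst (wW \<otimes>\<^sub>w wW) = 2" "snd (wW \<otimes>\<^sub>w wW) = {(0, 0), (1, 1)}"
  by (simp_all add: wtensor_W_W) (simp_all add: wN_def wW_def wW2_def)

lemma less_2_nat: "i < 2 \<longleftrightarrow> i = 0 \<or> i = (1::nat)"
  by auto

lemma weil_p_Hom: "weil_p \<in> Hom Weil wW wN"
  unfolding weil_p_def
proof (rule weil_hom_the_spec[where g = "\<lambda>_. 0", THEN conjunct1])
  fix \<theta> i
  assume "\<forall>a b. wfun \<theta> (wclass wW (of_nat a * var 0 + of_nat b)) = wclass wN (of_nat b)"
    and "i < fst wW"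
  from this(1)[rule_format, of 1 0] this(2)
  show "wfun \<theta> (wclass wW (var i)) = wclass wN 0" by (simp add: weil_simps)
qed (auto simp: wW_obj wN_obj weil_simps poly_subst_simps simp: npolys_closed intro!: wcong.refl)

lemma weil_zero_Hom: "weil_zero \<in> Hom Weil wN wW"
  unfolding weil_zero_def
  by (rule weil_hom_the_spec[where g = "\<lambda>_. 0", THEN conjunct1])
     (auto simp: wW_obj wN_obj weil_simps poly_subst_simps simp: npolys_closed intro!: wcong.refl)

lemma weil_pr_Hom: "weil_pr k \<in> Hom Weil wW2 wW"
  unfolding weil_pr_def
\<comment> \<open>The projection with index \<open>k\<close> keeps one of the two generators and kills the other; every nonzero index names the second projection.\<close>
proof (rule weil_hom_the_spec[where g = "\<lambda>i. if (i = 0) = (k = 0) then var 0 else 0", THEN conjunct1])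
  fix \<theta> i
  assume *: "\<forall>a b c. wfun \<theta> (wclass wW2 (of_nat a * var 0 + of_nat b * var 1 + of_nat c)) =
        wclass wW (of_nat (if k = 0 then a else b) * var 0 + of_nat c)"
    and "i < fst wW2"
  then show "wfun \<theta> (wclass wW2 (var i)) = wclass wW (if (i = 0) = (k = 0) then var 0 else 0)"
    using *[rule_format, of 1 0 0] *[rule_format, of 0 1 0] by (auto simp: weil_simps less_2_nat)
qed (auto simp: wW_obj wW2_obj weil_simps poly_subst_simps less_2_nat
       simp: npolys_closed intro!: wcong.refl wcong_refl_rel)

lemma weil_plus_Hom: "weil_plus \<in> Hom Weil wW2 wW"
  unfolding weil_plus_def
proof (rule weil_hom_the_spec[where g = "\<lambda>_. var 0", THEN conjunct1])
  fix \<theta> i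
  assume *: "\<forall>a b c. wfun \<theta> (wclass wW2 (of_nat a * var 0 + of_nat b * var 1 + of_nat c)) =
        wclass wW (of_nat (a + b) * var 0 + of_nat c)"
    and "i < fst wW2"
  then show "wfun \<theta> (wclass wW2 (var i)) = wclass wW (var 0)"
    using *[rule_format, of 1 0 0] *[rule_format, of 0 1 0] by (auto simp: weil_simps less_2_nat)
qed (auto simp: wW_obj wW2_obj weil_simps poly_subst_simps less_2_nat algebra_simps
       simp: npolys_closed intro!: wcong.refl wcong_refl_rel)

text \<open>Here \<open>x \<mapsto> x\<^sub>1 x\<^sub>2\<close> respects \<open>x\<^sup>2 = 0\<close> because \<open>(x\<^sub>1 x\<^sub>2)\<^sup>2\<close> has the factor \<open>x\<^sub>1\<^sup>2\<close>.\<close>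

lemma weil_l_Hom: "weil_l \<in> Hom Weil wW (wW \<otimes>\<^sub>w wW)"
  unfolding weil_l_def
proof (rule weil_hom_the_spec[where g = "\<lambda>_. var 0 * var 1", THEN conjunct1])
  fix i j assume "(i, j) \<in> snd wW"
  have "wcong (wW \<otimes>\<^sub>w wW) ((var 0 * var 0) * (var 1 * var 1)) 0"
    by (rule wcong_0_mult[OF wcong_refl_rel])
       (auto simp: wtensor_obj wW_obj weil_simps intro!: npolys_closed)
  then show "wcong (wW \<otimes>\<^sub>w wW) (var 0 * var 1 * (var 0 * var 1)) 0"
    by (simp add: ac_simps)
next
  fix \<theta> i
  assume *: "\<forall>a b. wfun \<theta> (wclass wW (of_nat a * var 0 + of_nat b)) =
        wclass (wW \<otimes>\<^sub>w wW) (of_nat a * (var 0 * var 1) + of_nat b)"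
    and "i < fst wW"
  then show "wfun \<theta> (wclass wW (var i)) = wclass (wW \<otimes>\<^sub>w wW) (var 0 * var 1)"
    using *[rule_format, of 1 0] by (simp add: weil_simps)
qed (auto simp: wW_obj wtensor_obj weil_simps poly_subst_simps npolys_closed)

lemma winl_spec:
  assumes "A \<in> weil_objs" "B \<in> weil_objs"
  shows "winl A B \<in> Hom Weil A (A \<otimes>\<^sub>w B) \<and>
    (\<forall>i<fst A. wfun (winl A B) (wclass A (var i)) = wclass (A \<otimes>\<^sub>w B) (var i))"
  unfolding winl_def
  by (rule weil_hom_the_spec[where g = var])
     (use weil_objs_rel_bound[OF assms(1)] in
       \<open>auto simp: assms wtensor_obj fst_wtensor snd_wtensor poly_subst_simps npolys_closed intro!: wcong.gen\<close>)

lemma winr_spec: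
  assumes "A \<in> weil_objs" "B \<in> weil_objs"
  shows "winr A B \<in> Hom Weil B (A \<otimes>\<^sub>w B) \<and>
    (\<forall>i<fst B. wfun (winr A B) (wclass B (var i)) = wclass (A \<otimes>\<^sub>w B) (var (fst A + i)))"
  unfolding winr_def
  by (rule weil_hom_the_spec[where g = "\<lambda>i. var (fst A + i)"])
     (use weil_objs_rel_bound[OF assms(2)] in
       \<open>auto simp: assms wtensor_obj fst_wtensor snd_wtensor poly_subst_simps npolys_closed intro!: wcong.gen\<close>)

lemma weil_Obj: "Obj Weil = weil_objs"
  by (simp add: Weil_def)

lemma weil_Ide_Hom:
  assumes "A \<in> weil_objs"
  shows "Ide Weil A \<in> Hom Weil A A"
proof -
  have "restrict (\<lambda>P. P) (carrier (weil_alg A)) \<in> ring_hom (weil_alg A) (weil_alg A)"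
    by (rule ring_hom_memI)
       (auto simp: weil_alg_carrier weil_alg_one weil_alg_add weil_alg_mult npolys_closed)
  moreover have "Ide Weil A = (A, restrict (\<lambda>P. P) (carrier (weil_alg A)), A)"
    by (simp add: Weil_def)
  ultimately show ?thesis
    using assms by (simp add: weil_Hom_iff weil_alg_zero weil_alg_carrier npolys_zero)
qed

lemma weil_Cmp_apply:
  "x \<in> carrier (weil_alg (fst \<theta>)) \<Longrightarrow> wfun (\<psi> \<bullet>\<^bsub>Weil\<^esub> \<theta>) x = wfun \<psi> (wfun \<theta> x)"
  by (simp add: Weil_def compose_def)

lemma weil_Hom_carrier:
  "\<theta> \<in> Hom Weil A B \<Longrightarrow> x \<in> carrier (weil_alg A) \<Longrightarrow> wfun \<theta> x \<in> carrier (weil_alg B)"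
  unfolding weil_Hom_iff by (auto simp: ring_hom_closed)

lemma weil_Cmp_Ide:
  assumes "\<theta> \<in> Hom Weil A B"
  shows "Ide Weil B \<bullet>\<^bsub>Weil\<^esub> \<theta> = \<theta>" "\<theta> \<bullet>\<^bsub>Weil\<^esub> Ide Weil A = \<theta>"
proof -
  have ext: "wfun \<theta> \<in> extensional (carrier (weil_alg A))" and AB: "fst \<theta> = A" "snd (snd \<theta>) = B"
    using assms by (auto simp: weil_Hom_iff)
  have 1: "compose (carrier (weil_alg A)) (restrict (\<lambda>P. P) (carrier (weil_alg B))) (wfun \<theta>) = wfun \<theta>"
    and 2: "compose (carrier (weil_alg A)) (wfun \<theta>) (restrict (\<lambda>P. P) (carrier (weil_alg A))) = wfun \<theta>"
    using ext by (auto simp: fun_eq_iff compose_def weil_Hom_carrier[OF assms] extensional_def)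
  show "Ide Weil B \<bullet>\<^bsub>Weil\<^esub> \<theta> = \<theta>" "\<theta> \<bullet>\<^bsub>Weil\<^esub> Ide Weil A = \<theta>"
    using 1 2 AB by (cases \<theta>; simp add: Weil_def)+
qed

text \<open>The two coproduct injections are jointly epic, since together they hit all the generators;
hence the identity is the only morphism compatible with both. This is what makes the structure
isomorphisms of an action natural between \<open>T\<^sub>A T\<^sub>B\<close> and \<open>T\<close> at \<open>A \<otimes> B\<close>.\<close>

lemma wtensor_arr_Ide:
  assumes A: "A \<in> weil_objs" and B: "B \<in> weil_objs"
  shows "Ide Weil A \<otimes>\<^sub>a Ide Weil B = Ide Weil (A \<otimes>\<^sub>w B)"
proof -
  note AB = wtensor_obj[OF A B]
  note l = winl_spec[OF A B] and r = winr_spec[OF A B]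
  have dc: "Dom Weil (Ide Weil C) = C" "Cod Weil (Ide Weil C) = C" for C
    by (simp_all add: Weil_def)
  show ?thesis
    unfolding wtensor_arr_def dc
  proof (rule the_equality)
    show "Ide Weil (A \<otimes>\<^sub>w B) \<in> Hom Weil (A \<otimes>\<^sub>w B) (A \<otimes>\<^sub>w B) \<and>
      Ide Weil (A \<otimes>\<^sub>w B) \<bullet>\<^bsub>Weil\<^esub> winl A B = winl A B \<bullet>\<^bsub>Weil\<^esub> Ide Weil A \<and>
      Ide Weil (A \<otimes>\<^sub>w B) \<bullet>\<^bsub>Weil\<^esub> winr A B = winr A B \<bullet>\<^bsub>Weil\<^esub> Ide Weil B"
      using weil_Ide_Hom[OF AB] weil_Cmp_Ide[OF conjunct1[OF l]] weil_Cmp_Ide[OF conjunct1[OF r]]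
      by simp
  next
    fix \<chi>
    assume *: "\<chi> \<in> Hom Weil (A \<otimes>\<^sub>w B) (A \<otimes>\<^sub>w B) \<and>
      \<chi> \<bullet>\<^bsub>Weil\<^esub> winl A B = winl A B \<bullet>\<^bsub>Weil\<^esub> Ide Weil A \<and>
      \<chi> \<bullet>\<^bsub>Weil\<^esub> winr A B = winr A B \<bullet>\<^bsub>Weil\<^esub> Ide Weil B"
    then have cl: "\<chi> \<bullet>\<^bsub>Weil\<^esub> winl A B = winl A B" and cr: "\<chi> \<bullet>\<^bsub>Weil\<^esub> winr A B = winr A B"
      using weil_Cmp_Ide[OF conjunct1[OF l]] weil_Cmp_Ide[OF conjunct1[OF r]] by simp_all
    show "\<chi> = Ide Weil (A \<otimes>\<^sub>w B)"
    proof (rule weil_hom_eqI)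
      fix i assume i: "i < fst (A \<otimes>\<^sub>w B)"
      have "wfun \<chi> (wclass (A \<otimes>\<^sub>w B) (var i)) = wclass (A \<otimes>\<^sub>w B) (var i)"
      proof (cases "i < fst A")
        case True
        then have "wclass A (var i) \<in> carrier (weil_alg (fst (winl A B)))"
          using l by (auto simp: weil_alg_carrier weil_Hom_iff intro: npolys_var)
        from weil_Cmp_apply[OF this, of \<chi>] show ?thesis using cl l True by simp
      next
        case False
        then obtain j where j: "i = fst A + j" "j < fst B"
          using i le_Suc_ex[of "fst A" i] by (auto simp: wtensor_def)
        then have "wclass B (var j) \<in> carrier (weil_alg (fst (winr A B)))"
          using r by (auto simp: weil_alg_carrier weil_Hom_iff intro: npolys_var)
        from weil_Cmp_apply[OF this, of \<chi>] show ?thesis using cr r j by simp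
      qed
      moreover have "wclass (A \<otimes>\<^sub>w B) (var i) \<in> carrier (weil_alg (A \<otimes>\<^sub>w B))"
        using i by (auto simp: weil_alg_carrier intro: npolys_var)
      ultimately show "wfun \<chi> (wclass (A \<otimes>\<^sub>w B) (var i)) =
          wfun (Ide Weil (A \<otimes>\<^sub>w B)) (wclass (A \<otimes>\<^sub>w B) (var i))"
        by (simp add: Weil_def)
    qed (use * weil_Ide_Hom[OF AB] in auto)
  qed
qed

section \<open>Categories and pullbacks\<close>

lemma HomD:
  assumes "f \<in> Hom C X Y"
  shows "f \<in> Arr C" "Dom C f = X" "Cod C f = Y"
  using assms by (auto simp: Hom_def)

locale is_category =
  fixes C :: "('o, 'm) cat"
  assumes category: "category C"
begin

lemma Dom_Obj [simp]: "f \<in> Arr C \<Longrightarrow> Dom C f \<in> Obj C"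
  and Cod_Obj [simp]: "f \<in> Arr C \<Longrightarrow> Cod C f \<in> Obj C"
  using category by (auto simp: category_def)

lemma Ide_simps [simp]:
  assumes "X \<in> Obj C"
  shows "Ide C X \<in> Arr C" "Dom C (Ide C X) = X" "Cod C (Ide C X) = X"
  using category assms by (auto simp: category_def Hom_def)

lemma Cmp_simps [simp]:
  assumes "f \<in> Arr C" "g \<in> Arr C" "Cod C f = Dom C g"
  shows "g \<bullet>\<^bsub>C\<^esub> f \<in> Arr C" "Dom C (g \<bullet>\<^bsub>C\<^esub> f) = Dom C f" "Cod C (g \<bullet>\<^bsub>C\<^esub> f) = Cod C g"
proof -
  have "g \<bullet>\<^bsub>C\<^esub> f \<in> Hom C (Dom C f) (Cod C g)"
    using category assms unfolding category_def Hom_def by blast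
  then show "g \<bullet>\<^bsub>C\<^esub> f \<in> Arr C" "Dom C (g \<bullet>\<^bsub>C\<^esub> f) = Dom C f" "Cod C (g \<bullet>\<^bsub>C\<^esub> f) = Cod C g"
    by (auto simp: Hom_def)
qed

lemma Ide_Cmp [simp]:
  "f \<in> Arr C \<Longrightarrow> Cod C f = X \<Longrightarrow> Ide C X \<bullet>\<^bsub>C\<^esub> f = f"
  "f \<in> Arr C \<Longrightarrow> Dom C f = X \<Longrightarrow> f \<bullet>\<^bsub>C\<^esub> Ide C X = f"
  using category unfolding category_def Hom_def by blast+

lemma assoc [simp]:
  assumes "f \<in> Arr C" "g \<in> Arr C" "h \<in> Arr C" "Cod C f = Dom C g" "Cod C g = Dom C h"
  shows "(h \<bullet>\<^bsub>C\<^esub> g) \<bullet>\<^bsub>C\<^esub> f = h \<bullet>\<^bsub>C\<^esub> (g \<bullet>\<^bsub>C\<^esub> f)"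
proof -
  have "\<forall>X Y Z V f g h. f \<in> Hom C X Y \<longrightarrow> g \<in> Hom C Y Z \<longrightarrow> h \<in> Hom C Z V \<longrightarrow>
        h \<bullet>\<^bsub>C\<^esub> (g \<bullet>\<^bsub>C\<^esub> f) = (h \<bullet>\<^bsub>C\<^esub> g) \<bullet>\<^bsub>C\<^esub> f"
    using category unfolding category_def by (elim conjE)
  from this[rule_format, of f "Dom C f" "Dom C g" g "Dom C h" h "Cod C h"] assms
  show ?thesis by (simp add: Hom_def)
qed

text \<open>The simplifier keeps composites associated to the right, so that an equation between binary
composites has to be available with a further factor on the right.\<close>

lemma Cmp_eq_assoc:
  assumes eq: "g \<bullet>\<^bsub>C\<^esub> f = g' \<bullet>\<^bsub>C\<^esub> f'"
    and "f \<in> Arr C" "g \<in> Arr C" "Cod C f = Dom C g" "f' \<in> Arr C" "g' \<in> Arr C" "Cod C f' = Dom C g'"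
    and "x \<in> Arr C" "Cod C x = Dom C f" "Dom C f' = Dom C f"
  shows "g \<bullet>\<^bsub>C\<^esub> (f \<bullet>\<^bsub>C\<^esub> x) = g' \<bullet>\<^bsub>C\<^esub> (f' \<bullet>\<^bsub>C\<^esub> x)"
  using arg_cong[OF eq, of "\<lambda>y. y \<bullet>\<^bsub>C\<^esub> x"] assms(2-) by simp

lemma Cmp_eq_assoc1:
  assumes "g \<bullet>\<^bsub>C\<^esub> f = k"
    and "f \<in> Arr C" "g \<in> Arr C" "Cod C f = Dom C g" "x \<in> Arr C" "Cod C x = Dom C f"
  shows "g \<bullet>\<^bsub>C\<^esub> (f \<bullet>\<^bsub>C\<^esub> x) = k \<bullet>\<^bsub>C\<^esub> x"
  using arg_cong[OF assms(1), of "\<lambda>y. y \<bullet>\<^bsub>C\<^esub> x"] assms(2-) by simp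

lemma inv_arr:
  assumes "is_iso C f"
  shows "f \<in> Arr C" "inv_arr C f \<in> Arr C" "Dom C (inv_arr C f) = Cod C f" "Cod C (inv_arr C f) = Dom C f"
    "inv_arr C f \<bullet>\<^bsub>C\<^esub> f = Ide C (Dom C f)" "f \<bullet>\<^bsub>C\<^esub> inv_arr C f = Ide C (Cod C f)"
proof -
  let ?P = "\<lambda>g. g \<in> Hom C (Cod C f) (Dom C f) \<and>
     g \<bullet>\<^bsub>C\<^esub> f = Ide C (Dom C f) \<and> f \<bullet>\<^bsub>C\<^esub> g = Ide C (Cod C f)"
  obtain g where f: "f \<in> Arr C" and g: "?P g" using assms by (auto simp: is_iso_def)
  have "\<exists>!g. ?P g"
  proof (rule ex1I[of _ g], rule g)
    fix g' assume g': "?P g'"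
    have "g' = g' \<bullet>\<^bsub>C\<^esub> (f \<bullet>\<^bsub>C\<^esub> g)" using f g g' by (simp add: Hom_def)
    also have "\<dots> = (g' \<bullet>\<^bsub>C\<^esub> f) \<bullet>\<^bsub>C\<^esub> g" using f g g' by (subst assoc) (auto simp: Hom_def)
    also have "\<dots> = g" using f g g' by (simp add: Hom_def)
    finally show "g' = g" .
  qed
  from theI'[OF this] have "?P (inv_arr C f)" unfolding inv_arr_def .
  with f show "f \<in> Arr C" "inv_arr C f \<in> Arr C" "Dom C (inv_arr C f) = Cod C f"
    "Cod C (inv_arr C f) = Dom C f"
    "inv_arr C f \<bullet>\<^bsub>C\<^esub> f = Ide C (Dom C f)" "f \<bullet>\<^bsub>C\<^esub> inv_arr C f = Ide C (Cod C f)"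
    by (auto simp: Hom_def)
qed

lemma inv_arr_cancel:
  assumes "is_iso C f"
  shows "x \<in> Arr C \<Longrightarrow> Cod C x = Dom C f \<Longrightarrow> inv_arr C f \<bullet>\<^bsub>C\<^esub> (f \<bullet>\<^bsub>C\<^esub> x) = x"
    "x \<in> Arr C \<Longrightarrow> Cod C x = Cod C f \<Longrightarrow> f \<bullet>\<^bsub>C\<^esub> (inv_arr C f \<bullet>\<^bsub>C\<^esub> x) = x"
proof -
  note i = inv_arr[OF assms]
  show "inv_arr C f \<bullet>\<^bsub>C\<^esub> (f \<bullet>\<^bsub>C\<^esub> x) = x" if "x \<in> Arr C" "Cod C x = Dom C f"
    using that by (subst assoc[symmetric]) (simp_all add: i)
  show "f \<bullet>\<^bsub>C\<^esub> (inv_arr C f \<bullet>\<^bsub>C\<^esub> x) = x" if "x \<in> Arr C" "Cod C x = Cod C f"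
    using that by (subst assoc[symmetric]) (simp_all add: i)
qed

lemma is_isoI:
  assumes "f \<in> Arr C" "g \<in> Arr C" "Dom C g = Cod C f" "Cod C g = Dom C f"
    "g \<bullet>\<^bsub>C\<^esub> f = Ide C (Dom C f)" "f \<bullet>\<^bsub>C\<^esub> g = Ide C (Cod C f)"
  shows "is_iso C f"
  using assms unfolding is_iso_def Hom_def by blast

lemma is_iso_Cmp:
  assumes "is_iso C f" "is_iso C g" "Cod C f = Dom C g"
  shows "is_iso C (g \<bullet>\<^bsub>C\<^esub> f)"
proof (rule is_isoI[where g = "inv_arr C f \<bullet>\<^bsub>C\<^esub> inv_arr C g"])
qed (use assms inv_arr[OF assms(1)] inv_arr[OF assms(2)] inv_arr_cancel[OF assms(1)]
      inv_arr_cancel[OF assms(2)] in simp_all)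

lemma pullbackD:
  assumes "is_pullback C f g p q"
  shows "f \<in> Arr C" "g \<in> Arr C" "Cod C g = Cod C f" "p \<in> Arr C" "q \<in> Arr C"
    "Cod C p = Dom C f" "Cod C q = Dom C g" "Dom C q = Dom C p" "f \<bullet>\<^bsub>C\<^esub> p = g \<bullet>\<^bsub>C\<^esub> q"
  using assms by (auto simp: is_pullback_def Hom_def)

lemma pullback_ex1:
  assumes "is_pullback C f g p q"
    and "a \<in> Arr C" "b \<in> Arr C" "Dom C b = Dom C a" "Cod C a = Dom C f" "Cod C b = Dom C g"
    and "f \<bullet>\<^bsub>C\<^esub> a = g \<bullet>\<^bsub>C\<^esub> b"
  shows "\<exists>!h. h \<in> Hom C (Dom C a) (Dom C p) \<and> p \<bullet>\<^bsub>C\<^esub> h = a \<and> q \<bullet>\<^bsub>C\<^esub> h = b"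
proof -
  have "a \<in> Hom C (Dom C a) (Dom C f)" "b \<in> Hom C (Dom C a) (Dom C g)"
    using assms by (auto simp: Hom_def)
  then show ?thesis using assms(1,7) unfolding is_pullback_def by blast
qed

lemma pullback_pair:
  assumes "is_pullback C f g p q"
    and "a \<in> Arr C" "b \<in> Arr C" "Dom C b = Dom C a" "Cod C a = Dom C f" "Cod C b = Dom C g"
    and "f \<bullet>\<^bsub>C\<^esub> a = g \<bullet>\<^bsub>C\<^esub> b"
  obtains h where "h \<in> Arr C" "Dom C h = Dom C a" "Cod C h = Dom C p" "p \<bullet>\<^bsub>C\<^esub> h = a" "q \<bullet>\<^bsub>C\<^esub> h = b"
  using pullback_ex1[OF assms] by (auto simp: Hom_def)

lemma pullback_eqI:
  assumes "is_pullback C f g p q"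
    and "h \<in> Arr C" "h' \<in> Arr C" "Dom C h' = Dom C h" "Cod C h = Dom C p" "Cod C h' = Dom C p"
    and "p \<bullet>\<^bsub>C\<^esub> h = p \<bullet>\<^bsub>C\<^esub> h'" "q \<bullet>\<^bsub>C\<^esub> h = q \<bullet>\<^bsub>C\<^esub> h'"
  shows "h = h'"
proof -
  note pb = pullbackD[OF assms(1)]
  have "f \<bullet>\<^bsub>C\<^esub> (p \<bullet>\<^bsub>C\<^esub> h) = g \<bullet>\<^bsub>C\<^esub> (q \<bullet>\<^bsub>C\<^esub> h)"
    using pb assms by (metis assoc)
  then have "\<exists>!k. k \<in> Hom C (Dom C h) (Dom C p) \<and> p \<bullet>\<^bsub>C\<^esub> k = p \<bullet>\<^bsub>C\<^esub> h \<and> q \<bullet>\<^bsub>C\<^esub> k = q \<bullet>\<^bsub>C\<^esub> h"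
    using pullback_ex1[OF assms(1), of "p \<bullet>\<^bsub>C\<^esub> h" "q \<bullet>\<^bsub>C\<^esub> h"] pb assms by simp
  moreover have "h \<in> Hom C (Dom C h) (Dom C p)" "h' \<in> Hom C (Dom C h) (Dom C p)"
    using assms by (auto simp: Hom_def)
  ultimately show ?thesis using assms(7,8) by metis
qed

lemma is_pullbackI:
  assumes "f \<in> Arr C" "g \<in> Arr C" "Cod C g = Cod C f" "p \<in> Arr C" "q \<in> Arr C"
    "Cod C p = Dom C f" "Cod C q = Dom C g" "Dom C q = Dom C p" "f \<bullet>\<^bsub>C\<^esub> p = g \<bullet>\<^bsub>C\<^esub> q"
    and ex: "\<And>a b. a \<in> Arr C \<Longrightarrow> b \<in> Arr C \<Longrightarrow> Dom C b = Dom C a \<Longrightarrow> Cod C a = Dom C f \<Longrightarrow>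
       Cod C b = Dom C g \<Longrightarrow> f \<bullet>\<^bsub>C\<^esub> a = g \<bullet>\<^bsub>C\<^esub> b \<Longrightarrow>
       \<exists>h. h \<in> Arr C \<and> Dom C h = Dom C a \<and> Cod C h = Dom C p \<and> p \<bullet>\<^bsub>C\<^esub> h = a \<and> q \<bullet>\<^bsub>C\<^esub> h = b"
    and un: "\<And>h h'. h \<in> Arr C \<Longrightarrow> h' \<in> Arr C \<Longrightarrow> Dom C h' = Dom C h \<Longrightarrow> Cod C h = Dom C p \<Longrightarrow>
       Cod C h' = Dom C p \<Longrightarrow> p \<bullet>\<^bsub>C\<^esub> h = p \<bullet>\<^bsub>C\<^esub> h' \<Longrightarrow> q \<bullet>\<^bsub>C\<^esub> h = q \<bullet>\<^bsub>C\<^esub> h' \<Longrightarrow> h = h'"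
  shows "is_pullback C f g p q"
  unfolding is_pullback_def
proof (intro conjI allI impI)
  fix Z a b
  assume ab: "a \<in> Hom C Z (Dom C f)" "b \<in> Hom C Z (Dom C g)" "f \<bullet>\<^bsub>C\<^esub> a = g \<bullet>\<^bsub>C\<^esub> b"
  then obtain h where "h \<in> Hom C Z (Dom C p)" "p \<bullet>\<^bsub>C\<^esub> h = a" "q \<bullet>\<^bsub>C\<^esub> h = b"
    using ex[of a b] by (auto simp: Hom_def)
  then show "\<exists>!h. h \<in> Hom C Z (Dom C p) \<and> p \<bullet>\<^bsub>C\<^esub> h = a \<and> q \<bullet>\<^bsub>C\<^esub> h = b"
    by (intro ex1I[of _ h]) (auto simp: Hom_def intro: un)
qed (use assms in \<open>auto simp: Hom_def\<close>)

text \<open>The common side is \<open>g\<close>, and the orientation is the one in which the left square is the image of the square of a lift and the right one is a naturality square.\<close>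

lemma pullback_paste:
  assumes pb: "is_pullback C f g p q" and pb': "is_pullback C h k m g"
  shows "is_pullback C (k \<bullet>\<^bsub>C\<^esub> f) h p (m \<bullet>\<^bsub>C\<^esub> q)"
proof -
  note d = pullbackD(1,2,4-8)[OF pb] pullbackD(3)[OF pb, symmetric] and d' = pullbackD(1,2,4-8)[OF pb'] pullbackD(3)[OF pb']
  note e = pullbackD(9)[OF pb] and e' = pullbackD(9)[OF pb']
  have e1: "f \<bullet>\<^bsub>C\<^esub> (p \<bullet>\<^bsub>C\<^esub> x) = g \<bullet>\<^bsub>C\<^esub> (q \<bullet>\<^bsub>C\<^esub> x)" if "x \<in> Arr C" "Cod C x = Dom C p" for x
    by (rule Cmp_eq_assoc[OF e]) (use that d in simp_all)
  have e2: "h \<bullet>\<^bsub>C\<^esub> (m \<bullet>\<^bsub>C\<^esub> x) = k \<bullet>\<^bsub>C\<^esub> (g \<bullet>\<^bsub>C\<^esub> x)" if "x \<in> Arr C" "Cod C x = Dom C g" for x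
    by (rule Cmp_eq_assoc[OF e']) (use that d d' in simp_all)
  have kf: "Cod C f = Dom C k" and gm: "Dom C m = Dom C g" using d d' by simp_all
  show ?thesis
  proof (rule is_pullbackI)
    show "(k \<bullet>\<^bsub>C\<^esub> f) \<bullet>\<^bsub>C\<^esub> p = h \<bullet>\<^bsub>C\<^esub> (m \<bullet>\<^bsub>C\<^esub> q)"
      using e2[of q] e d(1-7) d'(1-3) kf by simp
    fix a b
    assume ab: "a \<in> Arr C" "b \<in> Arr C" "Dom C b = Dom C a" "Cod C a = Dom C (k \<bullet>\<^bsub>C\<^esub> f)"
      "Cod C b = Dom C h" "(k \<bullet>\<^bsub>C\<^esub> f) \<bullet>\<^bsub>C\<^esub> a = h \<bullet>\<^bsub>C\<^esub> b"
    then have ca: "Cod C a = Dom C f" and kfa: "h \<bullet>\<^bsub>C\<^esub> b = k \<bullet>\<^bsub>C\<^esub> (f \<bullet>\<^bsub>C\<^esub> a)"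
      using d(1,2) d'(2) kf by simp_all
    obtain x where x: "x \<in> Arr C" "Dom C x = Dom C b" "Cod C x = Dom C m" "m \<bullet>\<^bsub>C\<^esub> x = b" "g \<bullet>\<^bsub>C\<^esub> x = f \<bullet>\<^bsub>C\<^esub> a"
      by (rule pullback_pair[OF pb', of b "f \<bullet>\<^bsub>C\<^esub> a"]) (use ab ca kfa d(1) kf in simp_all)
    obtain y where y: "y \<in> Arr C" "Dom C y = Dom C a" "Cod C y = Dom C p" "p \<bullet>\<^bsub>C\<^esub> y = a" "q \<bullet>\<^bsub>C\<^esub> y = x"
      by (rule pullback_pair[OF pb, of a x]) (use ab ca x gm in simp_all)
    show "\<exists>h. h \<in> Arr C \<and> Dom C h = Dom C a \<and> Cod C h = Dom C p \<and> p \<bullet>\<^bsub>C\<^esub> h = a \<and> (m \<bullet>\<^bsub>C\<^esub> q) \<bullet>\<^bsub>C\<^esub> h = b"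
      using x y d(3-7) d'(3) gm by (intro exI[of _ y]) simp
  next
    fix y y'
    assume y: "y \<in> Arr C" "y' \<in> Arr C" "Dom C y' = Dom C y" "Cod C y = Dom C p" "Cod C y' = Dom C p"
      "p \<bullet>\<^bsub>C\<^esub> y = p \<bullet>\<^bsub>C\<^esub> y'" "(m \<bullet>\<^bsub>C\<^esub> q) \<bullet>\<^bsub>C\<^esub> y = (m \<bullet>\<^bsub>C\<^esub> q) \<bullet>\<^bsub>C\<^esub> y'"
    have "q \<bullet>\<^bsub>C\<^esub> y = q \<bullet>\<^bsub>C\<^esub> y'"
    proof (rule pullback_eqI[OF pb'])
      show "m \<bullet>\<^bsub>C\<^esub> (q \<bullet>\<^bsub>C\<^esub> y) = m \<bullet>\<^bsub>C\<^esub> (q \<bullet>\<^bsub>C\<^esub> y')" using y d(3-7) d'(3) gm by simp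
      show "g \<bullet>\<^bsub>C\<^esub> (q \<bullet>\<^bsub>C\<^esub> y) = g \<bullet>\<^bsub>C\<^esub> (q \<bullet>\<^bsub>C\<^esub> y')" using e1[of y] e1[of y'] y by simp
    qed (use y d(3-7) gm in simp_all)
    then show "y = y'" by - (rule pullback_eqI[OF pb], use y in simp_all)
  qed (use d(1-7) d'(1-6) kf gm pullbackD(3)[OF pb'] in simp_all)
qed

text \<open>An isomorphism is monic, so postcomposing a cospan with it does not change which pairs of maps
are compatible. Together with the next lemma this moves a pullback to an isomorphic base and
back again after a functor has been applied.\<close>

lemma pullback_postcomp_iso:
  assumes pb: "is_pullback C f g p q" and iso: "is_iso C i" "Dom C i = Cod C f"
  shows "is_pullback C (i \<bullet>\<^bsub>C\<^esub> f) (i \<bullet>\<^bsub>C\<^esub> g) p q"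
proof -
  note d = pullbackD[OF pb] and ii = inv_arr(1)[OF iso(1)] and ic = inv_arr_cancel(1)[OF iso(1)]
  show ?thesis
  proof (rule is_pullbackI)
    fix a b
    assume ab: "a \<in> Arr C" "b \<in> Arr C" "Dom C b = Dom C a" "Cod C a = Dom C (i \<bullet>\<^bsub>C\<^esub> f)"
      "Cod C b = Dom C (i \<bullet>\<^bsub>C\<^esub> g)" "(i \<bullet>\<^bsub>C\<^esub> f) \<bullet>\<^bsub>C\<^esub> a = (i \<bullet>\<^bsub>C\<^esub> g) \<bullet>\<^bsub>C\<^esub> b"
    then have ab': "Cod C a = Dom C f" "Cod C b = Dom C g" "i \<bullet>\<^bsub>C\<^esub> (f \<bullet>\<^bsub>C\<^esub> a) = i \<bullet>\<^bsub>C\<^esub> (g \<bullet>\<^bsub>C\<^esub> b)"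
      using d(1-3) ii iso by simp_all
    have "f \<bullet>\<^bsub>C\<^esub> a = inv_arr C i \<bullet>\<^bsub>C\<^esub> (i \<bullet>\<^bsub>C\<^esub> (f \<bullet>\<^bsub>C\<^esub> a))"
      by (rule ic[symmetric]) (use ab(1) ab'(1) d(1) iso(2) in simp_all)
    also have "\<dots> = g \<bullet>\<^bsub>C\<^esub> b"
      unfolding ab'(3) by (rule ic) (use ab(2) ab'(2) d(2,3) iso(2) in simp_all)
    finally have "f \<bullet>\<^bsub>C\<^esub> a = g \<bullet>\<^bsub>C\<^esub> b" .
    then show "\<exists>h. h \<in> Arr C \<and> Dom C h = Dom C a \<and> Cod C h = Dom C p \<and> p \<bullet>\<^bsub>C\<^esub> h = a \<and> q \<bullet>\<^bsub>C\<^esub> h = b"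
      by - (rule pullback_pair[OF pb ab(1-3) ab'(1,2)], auto)
  qed (use d ii iso in \<open>auto intro: pullback_eqI[OF pb]\<close>)
qed

lemma pullback_cancel_postcomp:
  assumes pb: "is_pullback C (j \<bullet>\<^bsub>C\<^esub> f) (j \<bullet>\<^bsub>C\<^esub> g) p q"
    and arr: "j \<in> Arr C" "f \<in> Arr C" "g \<in> Arr C" "Cod C f = Dom C j" "Cod C g = Dom C j"
    and comm: "f \<bullet>\<^bsub>C\<^esub> p = g \<bullet>\<^bsub>C\<^esub> q"
  shows "is_pullback C f g p q"
proof -
  note d = pullbackD(4-8)[OF pb]
  show ?thesis
  proof (rule is_pullbackI)
    fix a b
    assume ab: "a \<in> Arr C" "b \<in> Arr C" "Dom C b = Dom C a" "Cod C a = Dom C f"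
      "Cod C b = Dom C g" "f \<bullet>\<^bsub>C\<^esub> a = g \<bullet>\<^bsub>C\<^esub> b"
    show "\<exists>h. h \<in> Arr C \<and> Dom C h = Dom C a \<and> Cod C h = Dom C p \<and> p \<bullet>\<^bsub>C\<^esub> h = a \<and> q \<bullet>\<^bsub>C\<^esub> h = b"
      by (rule pullback_pair[OF pb ab(1-3)]) (use ab arr in auto)
  qed (use d arr comm in \<open>auto intro: pullback_eqI[OF pb]\<close>)
qed

lemma terminal_eq:
  assumes "terminal C t" "f \<in> Arr C" "g \<in> Arr C" "Dom C f = Dom C g" "Cod C f = t" "Cod C g = t"
  shows "f = g"
proof -
  have "\<exists>!h. h \<in> Hom C (Dom C g) t" using assms by (simp add: terminal_def)
  moreover have "f \<in> Hom C (Dom C g) t" "g \<in> Hom C (Dom C g) t" using assms by (simp_all add: Hom_def)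
  ultimately show ?thesis by blast
qed

section \<open>Fibre powers\<close>

lemma fibre_powerD:
  assumes "is_fibre_power C q n b pr"
  shows "q \<in> Arr C" "b \<in> Arr C" "Cod C b = Cod C q"
    "\<And>i. i < n \<Longrightarrow> pr i \<in> Arr C" "\<And>i. i < n \<Longrightarrow> Dom C (pr i) = Dom C b"
    "\<And>i. i < n \<Longrightarrow> Cod C (pr i) = Dom C q" "\<And>i. i < n \<Longrightarrow> q \<bullet>\<^bsub>C\<^esub> pr i = b"
  using assms by (auto simp: is_fibre_power_def Hom_def)

lemma fibre_power_tuple:
  assumes "is_fibre_power C q n b pr" "c \<in> Arr C" "Cod C c = Cod C q"
    "\<And>i. i < n \<Longrightarrow> a i \<in> Arr C" "\<And>i. i < n \<Longrightarrow> Dom C (a i) = Dom C c"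
    "\<And>i. i < n \<Longrightarrow> Cod C (a i) = Dom C q" "\<And>i. i < n \<Longrightarrow> q \<bullet>\<^bsub>C\<^esub> a i = c"
  obtains h where "h \<in> Arr C" "Dom C h = Dom C c" "Cod C h = Dom C b" "b \<bullet>\<^bsub>C\<^esub> h = c"
    "\<And>i. i < n \<Longrightarrow> pr i \<bullet>\<^bsub>C\<^esub> h = a i"
proof -
  have "c \<in> Hom C (Dom C c) (Cod C q)"
    "\<forall>i<n. a i \<in> Hom C (Dom C c) (Dom C q) \<and> q \<bullet>\<^bsub>C\<^esub> a i = c"
    using assms by (auto simp: Hom_def)
  then have "\<exists>!h. h \<in> Hom C (Dom C c) (Dom C b) \<and> b \<bullet>\<^bsub>C\<^esub> h = c \<and> (\<forall>i<n. pr i \<bullet>\<^bsub>C\<^esub> h = a i)"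
    using assms(1) unfolding is_fibre_power_def by blast
  then show ?thesis using that by (auto simp: Hom_def)
qed

lemma fibre_power_eqI:
  assumes fp: "is_fibre_power C q n b pr"
    and h: "h \<in> Arr C" "h' \<in> Arr C" "Dom C h' = Dom C h" "Cod C h = Dom C b" "Cod C h' = Dom C b"
    and eq: "b \<bullet>\<^bsub>C\<^esub> h = b \<bullet>\<^bsub>C\<^esub> h'" "\<And>i. i < n \<Longrightarrow> pr i \<bullet>\<^bsub>C\<^esub> h = pr i \<bullet>\<^bsub>C\<^esub> h'"
  shows "h = h'"
proof -
  note d = fibre_powerD[OF fp]
  have "b \<bullet>\<^bsub>C\<^esub> h \<in> Hom C (Dom C h) (Cod C q)" using d h by (simp add: Hom_def)
  moreover have "\<forall>i<n. pr i \<bullet>\<^bsub>C\<^esub> h \<in> Hom C (Dom C h) (Dom C q) \<and> q \<bullet>\<^bsub>C\<^esub> (pr i \<bullet>\<^bsub>C\<^esub> h) = b \<bullet>\<^bsub>C\<^esub> h"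
    using d h by (auto simp: Hom_def Cmp_eq_assoc1)
  ultimately have "\<exists>!k. k \<in> Hom C (Dom C h) (Dom C b) \<and> b \<bullet>\<^bsub>C\<^esub> k = b \<bullet>\<^bsub>C\<^esub> h \<and>
      (\<forall>i<n. pr i \<bullet>\<^bsub>C\<^esub> k = pr i \<bullet>\<^bsub>C\<^esub> h)"
    using fp unfolding is_fibre_power_def by (elim conjE) (drule spec, drule spec, drule spec, drule mp, assumption, drule mp, assumption, assumption)
  moreover have "h \<in> Hom C (Dom C h) (Dom C b)" "h' \<in> Hom C (Dom C h) (Dom C b)"
    using h by (auto simp: Hom_def)
  ultimately show ?thesis using eq by metis
qed

lemma is_fibre_powerI:
  assumes "q \<in> Arr C" "b \<in> Arr C" "Cod C b = Cod C q"
    "\<And>i. i < n \<Longrightarrow> pr i \<in> Arr C" "\<And>i. i < n \<Longrightarrow> Dom C (pr i) = Dom C b"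
    "\<And>i. i < n \<Longrightarrow> Cod C (pr i) = Dom C q" "\<And>i. i < n \<Longrightarrow> q \<bullet>\<^bsub>C\<^esub> pr i = b"
    and ex: "\<And>c a. c \<in> Arr C \<Longrightarrow> Cod C c = Cod C q \<Longrightarrow>
      (\<And>i. i < n \<Longrightarrow> a i \<in> Arr C) \<Longrightarrow> (\<And>i. i < n \<Longrightarrow> Dom C (a i) = Dom C c) \<Longrightarrow>
      (\<And>i. i < n \<Longrightarrow> Cod C (a i) = Dom C q) \<Longrightarrow> (\<And>i. i < n \<Longrightarrow> q \<bullet>\<^bsub>C\<^esub> a i = c) \<Longrightarrow>
      \<exists>h. h \<in> Arr C \<and> Dom C h = Dom C c \<and> Cod C h = Dom C b \<and> b \<bullet>\<^bsub>C\<^esub> h = c \<and>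
        (\<forall>i<n. pr i \<bullet>\<^bsub>C\<^esub> h = a i)"
    and un: "\<And>h h'. h \<in> Arr C \<Longrightarrow> h' \<in> Arr C \<Longrightarrow> Dom C h' = Dom C h \<Longrightarrow> Cod C h = Dom C b \<Longrightarrow>
       Cod C h' = Dom C b \<Longrightarrow> b \<bullet>\<^bsub>C\<^esub> h = b \<bullet>\<^bsub>C\<^esub> h' \<Longrightarrow>
       (\<And>i. i < n \<Longrightarrow> pr i \<bullet>\<^bsub>C\<^esub> h = pr i \<bullet>\<^bsub>C\<^esub> h') \<Longrightarrow> h = h'"
  shows "is_fibre_power C q n b pr"
  unfolding is_fibre_power_def
proof (intro conjI allI impI)
  fix Z c a
  assume ca: "c \<in> Hom C Z (Cod C q)" "\<forall>i<n. a i \<in> Hom C Z (Dom C q) \<and> q \<bullet>\<^bsub>C\<^esub> a i = c"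
  have "\<exists>h. h \<in> Arr C \<and> Dom C h = Dom C c \<and> Cod C h = Dom C b \<and> b \<bullet>\<^bsub>C\<^esub> h = c \<and>
        (\<forall>i<n. pr i \<bullet>\<^bsub>C\<^esub> h = a i)"
    by (rule ex) (use ca in \<open>auto simp: Hom_def\<close>)
  then obtain h where "h \<in> Hom C Z (Dom C b)" "b \<bullet>\<^bsub>C\<^esub> h = c" "\<forall>i<n. pr i \<bullet>\<^bsub>C\<^esub> h = a i"
    using ca(1) by (auto simp: Hom_def)
  then show "\<exists>!h. h \<in> Hom C Z (Dom C b) \<and> b \<bullet>\<^bsub>C\<^esub> h = c \<and> (\<forall>i<n. pr i \<bullet>\<^bsub>C\<^esub> h = a i)"
    by (intro ex1I[of _ h]) (auto simp: Hom_def intro: un)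
qed (use assms in \<open>auto simp: Hom_def\<close>)

text \<open>The \<open>n+1\<close>-st fibre power is the pullback of the \<open>n\<close>-th one and one further copy of the total
object. For given fibre powers the map between them is the tuple of the first \<open>n\<close> projections.\<close>

lemma fibre_power_Suc_pullback:
  assumes fp: "is_fibre_power C q n b pr" and fp': "is_fibre_power C q (Suc n) b' pr'"
  obtains p where "is_pullback C b q p (pr' n)" "p \<in> Arr C" "b \<bullet>\<^bsub>C\<^esub> p = b'" "\<And>i. i < n \<Longrightarrow> pr i \<bullet>\<^bsub>C\<^esub> p = pr' i"
proof -
  note d = fibre_powerD[OF fp] and d' = fibre_powerD[OF fp']
  obtain p where p: "p \<in> Arr C" "Dom C p = Dom C b'" "Cod C p = Dom C b" "b \<bullet>\<^bsub>C\<^esub> p = b'"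
    "\<And>i. i < n \<Longrightarrow> pr i \<bullet>\<^bsub>C\<^esub> p = pr' i"
    by (rule fibre_power_tuple[OF fp, of b' pr']) (simp_all add: d')
  have "is_pullback C b q p (pr' n)"
  proof (rule is_pullbackI)
    fix u v assume uv: "u \<in> Arr C" "v \<in> Arr C" "Dom C v = Dom C u" "Cod C u = Dom C b"
       "Cod C v = Dom C q" "b \<bullet>\<^bsub>C\<^esub> u = q \<bullet>\<^bsub>C\<^esub> v"
    obtain h where h: "h \<in> Arr C" "Dom C h = Dom C (b \<bullet>\<^bsub>C\<^esub> u)" "Cod C h = Dom C b'" "b' \<bullet>\<^bsub>C\<^esub> h = b \<bullet>\<^bsub>C\<^esub> u"
       "\<And>i. i < Suc n \<Longrightarrow> pr' i \<bullet>\<^bsub>C\<^esub> h = (if i < n then pr i \<bullet>\<^bsub>C\<^esub> u else v)"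
      by (rule fibre_power_tuple[OF fp', of "b \<bullet>\<^bsub>C\<^esub> u" "\<lambda>i. if i < n then pr i \<bullet>\<^bsub>C\<^esub> u else v"])
         (use uv d in \<open>auto simp: Cmp_eq_assoc1\<close>)
    have "p \<bullet>\<^bsub>C\<^esub> h = u"
      by (rule fibre_power_eqI[OF fp])
         (use h p uv d in \<open>auto simp: Cmp_eq_assoc1\<close>)
    then show "\<exists>h. h \<in> Arr C \<and> Dom C h = Dom C u \<and> Cod C h = Dom C p \<and> p \<bullet>\<^bsub>C\<^esub> h = u \<and> pr' n \<bullet>\<^bsub>C\<^esub> h = v"
      using h(1-3) h(5)[of n] p uv d by (intro exI[of _ h]) simp
  next
    fix h h' assume h: "h \<in> Arr C" "h' \<in> Arr C" "Dom C h' = Dom C h" "Cod C h = Dom C p"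
      "Cod C h' = Dom C p" "p \<bullet>\<^bsub>C\<^esub> h = p \<bullet>\<^bsub>C\<^esub> h'" "pr' n \<bullet>\<^bsub>C\<^esub> h = pr' n \<bullet>\<^bsub>C\<^esub> h'"
    have "b' \<bullet>\<^bsub>C\<^esub> h = b' \<bullet>\<^bsub>C\<^esub> h'"
      using h p(1,3) d Cmp_eq_assoc1[OF p(4), of h] Cmp_eq_assoc1[OF p(4), of h'] by simp
    moreover have "pr' i \<bullet>\<^bsub>C\<^esub> h = pr' i \<bullet>\<^bsub>C\<^esub> h'" if "i < Suc n" for i
    proof (cases "i < n")
      case True then show ?thesis using h p(1,3) d Cmp_eq_assoc1[OF p(5)[OF True], of h] Cmp_eq_assoc1[OF p(5)[OF True], of h'] by simp
    next
      case False with that have "i = n" by simp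
      then show ?thesis using h by simp
    qed
    ultimately show "h = h'"
      by - (rule fibre_power_eqI[OF fp'], use h p in auto)
  qed (use p d d' in auto)
  then show ?thesis using that p by blast
qed

lemma fibre_power_SucI:
  assumes fp: "is_fibre_power C q n b pr" and pb: "is_pullback C b q p r"
    and b': "b' = b \<bullet>\<^bsub>C\<^esub> p" and pr': "\<And>i. i < n \<Longrightarrow> pr' i = pr i \<bullet>\<^bsub>C\<^esub> p" "pr' n = r"
  shows "is_fibre_power C q (Suc n) b' pr'"
proof -
  note d = fibre_powerD[OF fp] and pd = pullbackD(4-8)[OF pb]
  have pr'_cases: "pr' i = (if i < n then pr i \<bullet>\<^bsub>C\<^esub> p else r)" if "i < Suc n" for i
    using that pr' by (auto simp: less_Suc_eq)
  show ?thesis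
  proof (rule is_fibre_powerI)
    fix c a
    assume c: "c \<in> Arr C" "Cod C c = Cod C q" and a:
      "\<And>i. i < Suc n \<Longrightarrow> a i \<in> Arr C" "\<And>i. i < Suc n \<Longrightarrow> Dom C (a i) = Dom C c"
      "\<And>i. i < Suc n \<Longrightarrow> Cod C (a i) = Dom C q" "\<And>i. i < Suc n \<Longrightarrow> q \<bullet>\<^bsub>C\<^esub> a i = c"
    obtain u where u: "u \<in> Arr C" "Dom C u = Dom C c" "Cod C u = Dom C b" "b \<bullet>\<^bsub>C\<^esub> u = c"
      "\<And>i. i < n \<Longrightarrow> pr i \<bullet>\<^bsub>C\<^esub> u = a i"
      by (rule fibre_power_tuple[OF fp, of c a]) (use c a in auto)
    obtain h where h: "h \<in> Arr C" "Dom C h = Dom C u" "Cod C h = Dom C p" "p \<bullet>\<^bsub>C\<^esub> h = u" "r \<bullet>\<^bsub>C\<^esub> h = a n"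
      by (rule pullback_pair[OF pb, of u "a n"]) (use u a in auto)
    show "\<exists>h. h \<in> Arr C \<and> Dom C h = Dom C c \<and> Cod C h = Dom C b' \<and> b' \<bullet>\<^bsub>C\<^esub> h = c \<and>
        (\<forall>i<Suc n. pr' i \<bullet>\<^bsub>C\<^esub> h = a i)"
    proof (intro exI[of _ h] conjI allI impI)
      show "pr' i \<bullet>\<^bsub>C\<^esub> h = a i" if "i < Suc n" for i
        using that h u d pd by (cases "i = n") (simp_all add: pr')
    qed (use h u d pd in \<open>simp_all add: b'\<close>)
  next
    fix h h' assume h: "h \<in> Arr C" "h' \<in> Arr C" "Dom C h' = Dom C h" "Cod C h = Dom C b'"
      "Cod C h' = Dom C b'" "b' \<bullet>\<^bsub>C\<^esub> h = b' \<bullet>\<^bsub>C\<^esub> h'"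
      and eq: "\<And>i. i < Suc n \<Longrightarrow> pr' i \<bullet>\<^bsub>C\<^esub> h = pr' i \<bullet>\<^bsub>C\<^esub> h'"
    have h2: "Cod C h = Dom C p" "Cod C h' = Dom C p" using h pd d by (simp_all add: b')
    have "p \<bullet>\<^bsub>C\<^esub> h = p \<bullet>\<^bsub>C\<^esub> h'"
    proof (rule fibre_power_eqI[OF fp])
      show "b \<bullet>\<^bsub>C\<^esub> (p \<bullet>\<^bsub>C\<^esub> h) = b \<bullet>\<^bsub>C\<^esub> (p \<bullet>\<^bsub>C\<^esub> h')"
        using h h2 d pd by (simp add: b')
      show "pr i \<bullet>\<^bsub>C\<^esub> (p \<bullet>\<^bsub>C\<^esub> h) = pr i \<bullet>\<^bsub>C\<^esub> (p \<bullet>\<^bsub>C\<^esub> h')" if "i < n" for i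
        using eq[of i] that h h2 d pd by (simp add: pr')
    qed (use h h2 pd d in auto)
    moreover have "r \<bullet>\<^bsub>C\<^esub> h = r \<bullet>\<^bsub>C\<^esub> h'" using eq[of n] by (simp add: pr')
    ultimately show "h = h'" by - (rule pullback_eqI[OF pb], use h h2 in auto)
  qed (use d pd pullbackD(9)[OF pb] in \<open>auto simp: b' pr'_cases Cmp_eq_assoc1\<close>)
qed

text \<open>The universal property of the empty fibre power says that every map to the base factors uniquely
through \<open>b\<close>, so that \<open>b\<close> is invertible.\<close>

lemma fibre_power_0_iff:
  assumes "q \<in> Arr C"
  shows "is_fibre_power C q 0 b pr \<longleftrightarrow> is_iso C b \<and> Cod C b = Cod C q"
proof
  assume fp: "is_fibre_power C q 0 b pr"
  note d = fibre_powerD[OF fp]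
  obtain h where h: "h \<in> Arr C" "Dom C h = Cod C q" "Cod C h = Dom C b" "b \<bullet>\<^bsub>C\<^esub> h = Ide C (Cod C q)"
    by (rule fibre_power_tuple[OF fp, of "Ide C (Cod C q)"]) (use assms in auto)
  have "h \<bullet>\<^bsub>C\<^esub> b = Ide C (Dom C b)"
    by (rule fibre_power_eqI[OF fp]) (use d h in \<open>auto simp: Cmp_eq_assoc1\<close>)
  then show "is_iso C b \<and> Cod C b = Cod C q"
    using d h by (auto intro: is_isoI[of b h])
next
  assume b: "is_iso C b \<and> Cod C b = Cod C q"
  then have iso: "is_iso C b" and cod: "Cod C b = Cod C q" by auto
  note i = inv_arr[OF iso] and ic = inv_arr_cancel[OF iso]
  show "is_fibre_power C q 0 b pr"
  proof (rule is_fibre_powerI)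
    fix c assume "c \<in> Arr C" "Cod C c = Cod C q"
    then show "\<exists>h. h \<in> Arr C \<and> Dom C h = Dom C c \<and> Cod C h = Dom C b \<and> b \<bullet>\<^bsub>C\<^esub> h = c \<and>
        (\<forall>i<0. pr i \<bullet>\<^bsub>C\<^esub> h = a i)" for a
      using i ic cod by (intro exI[of _ "inv_arr C b \<bullet>\<^bsub>C\<^esub> c"]) auto
  next
    fix h h' assume "h \<in> Arr C" "h' \<in> Arr C" "Dom C h' = Dom C h" "Cod C h = Dom C b"
       "Cod C h' = Dom C b" "b \<bullet>\<^bsub>C\<^esub> h = b \<bullet>\<^bsub>C\<^esub> h'"
    then show "h = h'" using ic by metis
  qed (use assms i cod in auto)
qed

lemma fibre_power_cong:
  assumes "is_fibre_power C q n b pr" "\<And>i. i < n \<Longrightarrow> pr' i = pr i"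
  shows "is_fibre_power C q n b pr'"
  using assms unfolding is_fibre_power_def by (simp cong: conj_cong)

lemma fibre_power_iso:
  assumes fp: "is_fibre_power C q n b pr" and iso: "is_iso C e" and e: "Cod C e = Dom C b"
  shows "is_fibre_power C q n (b \<bullet>\<^bsub>C\<^esub> e) (\<lambda>i. pr i \<bullet>\<^bsub>C\<^esub> e)"
proof -
  note d = fibre_powerD[OF fp] and i = inv_arr[OF iso] and ic = inv_arr_cancel[OF iso]
  show ?thesis
  proof (rule is_fibre_powerI)
    fix c a
    assume c: "c \<in> Arr C" "Cod C c = Cod C q" and a:
      "\<And>i. i < n \<Longrightarrow> a i \<in> Arr C" "\<And>i. i < n \<Longrightarrow> Dom C (a i) = Dom C c"
      "\<And>i. i < n \<Longrightarrow> Cod C (a i) = Dom C q" "\<And>i. i < n \<Longrightarrow> q \<bullet>\<^bsub>C\<^esub> a i = c"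
    obtain u where u: "u \<in> Arr C" "Dom C u = Dom C c" "Cod C u = Dom C b" "b \<bullet>\<^bsub>C\<^esub> u = c"
      "\<And>i. i < n \<Longrightarrow> pr i \<bullet>\<^bsub>C\<^esub> u = a i"
      by (rule fibre_power_tuple[OF fp, of c a]) (use c a in auto)
    show "\<exists>h. h \<in> Arr C \<and> Dom C h = Dom C c \<and> Cod C h = Dom C (b \<bullet>\<^bsub>C\<^esub> e) \<and> (b \<bullet>\<^bsub>C\<^esub> e) \<bullet>\<^bsub>C\<^esub> h = c \<and>
        (\<forall>i<n. (pr i \<bullet>\<^bsub>C\<^esub> e) \<bullet>\<^bsub>C\<^esub> h = a i)"
      using u d i ic e by (intro exI[of _ "inv_arr C e \<bullet>\<^bsub>C\<^esub> u"]) simp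
  next
    fix h h' assume h: "h \<in> Arr C" "h' \<in> Arr C" "Dom C h' = Dom C h" "Cod C h = Dom C (b \<bullet>\<^bsub>C\<^esub> e)"
      "Cod C h' = Dom C (b \<bullet>\<^bsub>C\<^esub> e)" "(b \<bullet>\<^bsub>C\<^esub> e) \<bullet>\<^bsub>C\<^esub> h = (b \<bullet>\<^bsub>C\<^esub> e) \<bullet>\<^bsub>C\<^esub> h'"
      and eq: "\<And>i. i < n \<Longrightarrow> (pr i \<bullet>\<^bsub>C\<^esub> e) \<bullet>\<^bsub>C\<^esub> h = (pr i \<bullet>\<^bsub>C\<^esub> e) \<bullet>\<^bsub>C\<^esub> h'"
    have h2: "Cod C h = Dom C e" "Cod C h' = Dom C e" using h d i e by simp_all
    have "e \<bullet>\<^bsub>C\<^esub> h = e \<bullet>\<^bsub>C\<^esub> h'"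
    proof (rule fibre_power_eqI[OF fp])
      show "b \<bullet>\<^bsub>C\<^esub> (e \<bullet>\<^bsub>C\<^esub> h) = b \<bullet>\<^bsub>C\<^esub> (e \<bullet>\<^bsub>C\<^esub> h')" using h h2 d i e by simp
      show "pr i \<bullet>\<^bsub>C\<^esub> (e \<bullet>\<^bsub>C\<^esub> h) = pr i \<bullet>\<^bsub>C\<^esub> (e \<bullet>\<^bsub>C\<^esub> h')" if "i < n" for i
        using eq[OF that] that h h2 d i e by simp
    qed (use h h2 i e in auto)
    then show "h = h'" using ic h h2 by metis
  qed (use d i e in \<open>auto simp: Cmp_eq_assoc1\<close>)
qed

lemma fibre_power_comparison:
  assumes fp: "is_fibre_power C q n b pr" and fp': "is_fibre_power C q n b' pr'"
  obtains e where "is_iso C e" "Dom C e = Dom C b'" "Cod C e = Dom C b" "b \<bullet>\<^bsub>C\<^esub> e = b'"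
    "\<And>i. i < n \<Longrightarrow> pr i \<bullet>\<^bsub>C\<^esub> e = pr' i"
proof -
  note d = fibre_powerD[OF fp] and d' = fibre_powerD[OF fp']
  obtain e where e: "e \<in> Arr C" "Dom C e = Dom C b'" "Cod C e = Dom C b" "b \<bullet>\<^bsub>C\<^esub> e = b'"
    "\<And>i. i < n \<Longrightarrow> pr i \<bullet>\<^bsub>C\<^esub> e = pr' i"
    by (rule fibre_power_tuple[OF fp, of b' pr']) (simp_all add: d')
  obtain k where k: "k \<in> Arr C" "Dom C k = Dom C b" "Cod C k = Dom C b'" "b' \<bullet>\<^bsub>C\<^esub> k = b"
    "\<And>i. i < n \<Longrightarrow> pr' i \<bullet>\<^bsub>C\<^esub> k = pr i"
    by (rule fibre_power_tuple[OF fp', of b pr]) (simp_all add: d)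
  have "k \<bullet>\<^bsub>C\<^esub> e = Ide C (Dom C b')"
    by (rule fibre_power_eqI[OF fp']) (use e k d d' in \<open>auto simp: Cmp_eq_assoc1\<close>)
  moreover have "e \<bullet>\<^bsub>C\<^esub> k = Ide C (Dom C b)"
    by (rule fibre_power_eqI[OF fp]) (use e k d d' in \<open>auto simp: Cmp_eq_assoc1\<close>)
  ultimately have "is_iso C e" using e k by (auto intro: is_isoI[of e k])
  then show ?thesis using that e by blast
qed

end

section \<open>Functors and natural isomorphisms\<close>

lemma Hom_prod_cat:
  "(f, g) \<in> Hom (C \<times>\<^sub>c D) (A, X) (B, Y) \<longleftrightarrow> f \<in> Hom C A B \<and> g \<in> Hom D X Y"
  by (auto simp: Hom_def prod_cat_def)

lemma Obj_prod_cat: "Obj (C \<times>\<^sub>c D) = Obj C \<times> Obj D"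
  and Ide_prod_cat: "Ide (C \<times>\<^sub>c D) (A, X) = (Ide C A, Ide D X)"
  and Cmp_prod_cat: "(f', g') \<bullet>\<^bsub>C \<times>\<^sub>c D\<^esub> (f, g) = (f' \<bullet>\<^bsub>C\<^esub> f, g' \<bullet>\<^bsub>D\<^esub> g)"
  by (simp_all add: prod_cat_def)

lemma functorD:
  assumes "is_functor C D F"
  shows "X \<in> Obj C \<Longrightarrow> fobj F X \<in> Obj D"
    "f \<in> Hom C X Y \<Longrightarrow> farr F f \<in> Hom D (fobj F X) (fobj F Y)"
    "X \<in> Obj C \<Longrightarrow> farr F (Ide C X) = Ide D (fobj F X)"
    "f \<in> Hom C X Y \<Longrightarrow> g \<in> Hom C Y Z \<Longrightarrow> farr F (g \<bullet>\<^bsub>C\<^esub> f) = farr F g \<bullet>\<^bsub>D\<^esub> farr F f"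
  using assms unfolding is_functor_def by blast+

locale functor_between = C: is_category C + D: is_category D
  for C :: "('o, 'm) cat" and D :: "('p, 'n) cat" +
  fixes F :: "('o, 'm, 'p, 'n) ftor"
  assumes is_functor: "is_functor C D F"
begin

lemma obj [simp]: "X \<in> Obj C \<Longrightarrow> fobj F X \<in> Obj D"
  using functorD(1)[OF is_functor] .

lemma arr [simp]:
  assumes "f \<in> Arr C"
  shows "farr F f \<in> Arr D" "Dom D (farr F f) = fobj F (Dom C f)" "Cod D (farr F f) = fobj F (Cod C f)"
  using functorD(2)[OF is_functor, of f "Dom C f" "Cod C f"] assms by (auto simp: Hom_def)

lemma Ide [simp]: "X \<in> Obj C \<Longrightarrow> farr F (Ide C X) = Ide D (fobj F X)"
  using functorD(3)[OF is_functor] .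

lemma Cmp [simp]:
  "f \<in> Arr C \<Longrightarrow> g \<in> Arr C \<Longrightarrow> Cod C f = Dom C g \<Longrightarrow> farr F (g \<bullet>\<^bsub>C\<^esub> f) = farr F g \<bullet>\<^bsub>D\<^esub> farr F f"
  using functorD(4)[OF is_functor, of f "Dom C f" "Cod C f" g "Cod C g"] by (simp add: Hom_def)

lemma Cmp_eqD:
  assumes "g \<bullet>\<^bsub>C\<^esub> f = g' \<bullet>\<^bsub>C\<^esub> f'"
    and "f \<in> Arr C" "g \<in> Arr C" "Cod C f = Dom C g" "f' \<in> Arr C" "g' \<in> Arr C" "Cod C f' = Dom C g'"
  shows "farr F g \<bullet>\<^bsub>D\<^esub> farr F f = farr F g' \<bullet>\<^bsub>D\<^esub> farr F f'"
  using arg_cong[OF assms(1), of "farr F"] assms(2-) by simp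

lemma Cmp_eqD1:
  assumes "g \<bullet>\<^bsub>C\<^esub> f = k"
    and "f \<in> Arr C" "g \<in> Arr C" "Cod C f = Dom C g"
  shows "farr F g \<bullet>\<^bsub>D\<^esub> farr F f = farr F k"
  using arg_cong[OF assms(1), of "farr F"] assms(2-) by simp

lemma is_iso:
  assumes "is_iso C f"
  shows "is_iso D (farr F f)"
proof (rule D.is_isoI[where g = "farr F (inv_arr C f)"])
  note i = C.inv_arr[OF assms]
  show "farr F (inv_arr C f) \<bullet>\<^bsub>D\<^esub> farr F f = Ide D (Dom D (farr F f))"
    "farr F f \<bullet>\<^bsub>D\<^esub> farr F (inv_arr C f) = Ide D (Cod D (farr F f))"
    using Cmp_eqD1[OF i(5)] Cmp_eqD1[OF i(6)] i(1-4) by simp_all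
qed (use C.inv_arr[OF assms] in simp_all)

text \<open>Fibre powers are built from isomorphisms by pullbacks over the base \<open>t\<close>, and the functor preserves
both. The induction passes from the given \<open>n+1\<close>-st fibre power to any \<open>n\<close>-th one, which is why
all fibre powers have to exist.\<close>

lemma fibre_power:
  assumes pres: "\<And>f g p q. is_pullback C f g p q \<Longrightarrow> Cod C f = t \<Longrightarrow>
      is_pullback D (farr F f) (farr F g) (farr F p) (farr F q)"
    and q: "q \<in> Arr C" "Cod C q = t"
    and ex: "\<And>n. \<exists>b pr. is_fibre_power C q n b pr"
  shows "is_fibre_power C q n b pr \<Longrightarrow> is_fibre_power D (farr F q) n (farr F b) (\<lambda>i. farr F (pr i))"
proof (induction n arbitrary: b pr)
  case 0
  then show ?case using q is_iso[of b] C.inv_arr(1)[of b] by (simp add: C.fibre_power_0_iff D.fibre_power_0_iff)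
next
  case (Suc n)
  obtain b0 pr0 where fp0: "is_fibre_power C q n b0 pr0" using ex by blast
  note d0 = C.fibre_powerD[OF fp0] and d = C.fibre_powerD[OF Suc.prems]
  obtain p where p: "is_pullback C b0 q p (pr n)" "p \<in> Arr C" "b0 \<bullet>\<^bsub>C\<^esub> p = b"
    "\<And>i. i < n \<Longrightarrow> pr0 i \<bullet>\<^bsub>C\<^esub> p = pr i"
    by (rule C.fibre_power_Suc_pullback[OF fp0 Suc.prems]) blast
  note pd = C.pullbackD(6)[OF p(1)]
  show ?case
  proof (rule D.fibre_power_SucI[OF Suc.IH[OF fp0]])
    show "is_pullback D (farr F b0) (farr F q) (farr F p) (farr F (pr n))"
      using pres[OF p(1)] q d0 by simp
    show "farr F b = farr F b0 \<bullet>\<^bsub>D\<^esub> farr F p"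
      using Cmp_eqD1[OF p(3) p(2)] d0 pd by simp
    show "farr F (pr i) = farr F (pr0 i) \<bullet>\<^bsub>D\<^esub> farr F p" if "i < n" for i
      using Cmp_eqD1[OF p(4)[OF that] p(2)] d0 pd that by simp
  qed simp
qed

text \<open>Whether a fibre power is preserved does not depend on the choice of the limit cone, because two
cones differ by an isomorphism and functors preserve isomorphisms. In this way preservation is
extended from cones that come from the source of a functor to all cones in its target.\<close>

lemma fibre_power_transfer:
  assumes fp: "is_fibre_power C q n b pr"
    and Ffp: "is_fibre_power D (farr F q) n (farr F b) (\<lambda>i. farr F (pr i))"
    and fp': "is_fibre_power C q n b' pr'"
  shows "is_fibre_power D (farr F q) n (farr F b') (\<lambda>i. farr F (pr' i))"
proof -
  note d = C.fibre_powerD[OF fp]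
  obtain e where e: "is_iso C e" "Dom C e = Dom C b'" "Cod C e = Dom C b" "b \<bullet>\<^bsub>C\<^esub> e = b'"
    "\<And>i. i < n \<Longrightarrow> pr i \<bullet>\<^bsub>C\<^esub> e = pr' i"
    by (rule C.fibre_power_comparison[OF fp fp']) blast
  note ei = C.inv_arr(1)[OF e(1)]
  have "farr F b \<bullet>\<^bsub>D\<^esub> farr F e = farr F b'"
    by (rule Cmp_eqD1[OF e(4)]) (use d e ei in auto)
  moreover have "farr F (pr' i) = farr F (pr i) \<bullet>\<^bsub>D\<^esub> farr F e" if "i < n" for i
    by (rule Cmp_eqD1[OF e(5)[OF that], symmetric]) (use d e ei that in auto)
  ultimately show ?thesis
    using D.fibre_power_cong[OF D.fibre_power_iso[OF Ffp is_iso[OF e(1)]], of "\<lambda>i. farr F (pr' i)"]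
      d e ei by simp
qed

end

lemma nat_isoD:
  assumes "is_nat_iso C D G H \<tau>"
  shows "X \<in> Obj C \<Longrightarrow> \<tau> X \<in> Hom D (fobj G X) (fobj H X)"
    "f \<in> Hom C X Y \<Longrightarrow> \<tau> Y \<bullet>\<^bsub>D\<^esub> farr G f = farr H f \<bullet>\<^bsub>D\<^esub> \<tau> X"
    "X \<in> Obj C \<Longrightarrow> is_iso D (\<tau> X)"
  using assms unfolding is_nat_iso_def is_nat_trans_def by blast+

text \<open>Preservation of a commutative square as a pullback is invariant under isomorphism of functors:
cones over the two images correspond by composition with the components of \<open>\<tau>\<close>.\<close>

lemma pullback_along_nat_iso:
  assumes "functor_between C D G" "functor_between C D H" and nat: "is_nat_iso C D G H \<tau>"
    and sq: "f \<in> Arr C" "g \<in> Arr C" "Cod C f = Cod C g" "p \<in> Arr C" "q \<in> Arr C"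
    "Cod C p = Dom C f" "Cod C q = Dom C g" "Dom C p = Dom C q" "f \<bullet>\<^bsub>C\<^esub> p = g \<bullet>\<^bsub>C\<^esub> q"
    and pb: "is_pullback D (farr H f) (farr H g) (farr H p) (farr H q)"
  shows "is_pullback D (farr G f) (farr G g) (farr G p) (farr G q)"
proof -
  interpret G: functor_between C D G by fact
  interpret H: functor_between C D H by fact
  have \<tau>: "\<tau> X \<in> Arr D" "Dom D (\<tau> X) = fobj G X" "Cod D (\<tau> X) = fobj H X"
    "is_iso D (\<tau> X)" if "X \<in> Obj C" for X
    using nat_isoD[OF nat] that by (auto simp: Hom_def)
  have nt: "\<tau> (Cod C k) \<bullet>\<^bsub>D\<^esub> farr G k = farr H k \<bullet>\<^bsub>D\<^esub> \<tau> (Dom C k)" if "k \<in> Arr C" for k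
    using nat_isoD(2)[OF nat, of k "Dom C k" "Cod C k"] that by (simp add: Hom_def)
  have nt': "\<tau> (Cod C k) \<bullet>\<^bsub>D\<^esub> (farr G k \<bullet>\<^bsub>D\<^esub> x) = farr H k \<bullet>\<^bsub>D\<^esub> (\<tau> (Dom C k) \<bullet>\<^bsub>D\<^esub> x)"
    if "k \<in> Arr C" "x \<in> Arr D" "Cod D x = fobj G (Dom C k)" for k x
    by (rule G.D.Cmp_eq_assoc[OF nt[OF that(1)]]) (use that \<tau> in simp_all)
  have mono: "x = y" if "X \<in> Obj C" "\<tau> X \<bullet>\<^bsub>D\<^esub> x = \<tau> X \<bullet>\<^bsub>D\<^esub> y" "x \<in> Arr D" "y \<in> Arr D"
    "Cod D x = fobj G X" "Cod D y = fobj G X" for X x y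
    using G.D.inv_arr_cancel(1)[OF \<tau>(4)[OF that(1)]] \<tau>(2)[OF that(1)] that by metis
  let ?P = "Dom C q"
  show ?thesis
  proof (rule G.D.is_pullbackI)
    show "farr G f \<bullet>\<^bsub>D\<^esub> farr G p = farr G g \<bullet>\<^bsub>D\<^esub> farr G q"
      using G.Cmp_eqD[OF sq(9)] sq by simp
    fix a b
    assume ab: "a \<in> Arr D" "b \<in> Arr D" "Dom D b = Dom D a" "Cod D a = Dom D (farr G f)"
      "Cod D b = Dom D (farr G g)" "farr G f \<bullet>\<^bsub>D\<^esub> a = farr G g \<bullet>\<^bsub>D\<^esub> b"
    have "farr H f \<bullet>\<^bsub>D\<^esub> (\<tau> (Dom C f) \<bullet>\<^bsub>D\<^esub> a) = farr H g \<bullet>\<^bsub>D\<^esub> (\<tau> (Dom C g) \<bullet>\<^bsub>D\<^esub> b)"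
      using nt'[of f a] nt'[of g b] ab sq by simp
    then obtain h where h: "h \<in> Arr D" "Dom D h = Dom D a" "Cod D h = fobj H ?P"
      "farr H p \<bullet>\<^bsub>D\<^esub> h = \<tau> (Dom C f) \<bullet>\<^bsub>D\<^esub> a" "farr H q \<bullet>\<^bsub>D\<^esub> h = \<tau> (Dom C g) \<bullet>\<^bsub>D\<^esub> b"
      by - (rule G.D.pullback_pair[OF pb, of "\<tau> (Dom C f) \<bullet>\<^bsub>D\<^esub> a" "\<tau> (Dom C g) \<bullet>\<^bsub>D\<^esub> b"],
        use ab sq \<tau> in simp_all)
    have isoP: "is_iso D (\<tau> ?P)" using \<tau> sq by simp
    let ?k = "inv_arr D (\<tau> ?P) \<bullet>\<^bsub>D\<^esub> h"
    note i = G.D.inv_arr[OF isoP] and ic = G.D.inv_arr_cancel[OF isoP]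
    have k: "?k \<in> Arr D" "Dom D ?k = Dom D a" "Cod D ?k = fobj G ?P" "\<tau> ?P \<bullet>\<^bsub>D\<^esub> ?k = h"
      using i(2-4) ic h sq \<tau>[of ?P] by simp_all
    have "farr G p \<bullet>\<^bsub>D\<^esub> ?k = a"
      by (rule mono[of "Dom C f"]) (use nt'[of p ?k] k h sq ab in simp_all)
    moreover have "farr G q \<bullet>\<^bsub>D\<^esub> ?k = b"
      by (rule mono[of "Dom C g"]) (use nt'[of q ?k] k h sq ab in simp_all)
    ultimately show "\<exists>h. h \<in> Arr D \<and> Dom D h = Dom D a \<and> Cod D h = Dom D (farr G p) \<and>
        farr G p \<bullet>\<^bsub>D\<^esub> h = a \<and> farr G q \<bullet>\<^bsub>D\<^esub> h = b"
      using k(1-3) sq by (intro exI[of _ ?k]) simp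
  next
    fix h h'
    assume h: "h \<in> Arr D" "h' \<in> Arr D" "Dom D h' = Dom D h" "Cod D h = Dom D (farr G p)"
      "Cod D h' = Dom D (farr G p)" "farr G p \<bullet>\<^bsub>D\<^esub> h = farr G p \<bullet>\<^bsub>D\<^esub> h'"
      "farr G q \<bullet>\<^bsub>D\<^esub> h = farr G q \<bullet>\<^bsub>D\<^esub> h'"
    have "\<tau> ?P \<bullet>\<^bsub>D\<^esub> h = \<tau> ?P \<bullet>\<^bsub>D\<^esub> h'"
    proof (rule G.D.pullback_eqI[OF pb])
      show "farr H p \<bullet>\<^bsub>D\<^esub> (\<tau> ?P \<bullet>\<^bsub>D\<^esub> h) = farr H p \<bullet>\<^bsub>D\<^esub> (\<tau> ?P \<bullet>\<^bsub>D\<^esub> h')"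
        using nt'[of p h] nt'[of p h'] h sq by simp
      show "farr H q \<bullet>\<^bsub>D\<^esub> (\<tau> ?P \<bullet>\<^bsub>D\<^esub> h) = farr H q \<bullet>\<^bsub>D\<^esub> (\<tau> ?P \<bullet>\<^bsub>D\<^esub> h')"
        using nt'[of q h] nt'[of q h'] h sq by simp
    qed (use h sq \<tau>[of ?P] in simp_all)
    then show "h = h'"
      using h sq by (intro mono[of ?P h h']) simp_all
  qed (use sq in simp_all)
qed

section \<open>Actions of the Weil category\<close>

locale actegory_context = is_category C
  for C :: "('o, 'm) cat" +
  fixes T :: "('o, 'm) weil_action"
  assumes actegory: "weil_actegory C T"
begin

lemma act_functor: "is_functor (Weil \<times>\<^sub>c C) C (act T)"
  using actegory by (simp add: weil_actegory_def)

lemma act_Cmp: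
  assumes "\<theta> \<in> Hom Weil A B" "\<psi> \<in> Hom Weil B D" "f \<in> Hom C X Y" "g \<in> Hom C Y Z"
  shows "farr (act T) (\<psi> \<bullet>\<^bsub>Weil\<^esub> \<theta>, g \<bullet>\<^bsub>C\<^esub> f) = farr (act T) (\<psi>, g) \<bullet>\<^bsub>C\<^esub> farr (act T) (\<theta>, f)"
  using functorD(4)[OF act_functor, of "(\<theta>, f)" "(A, X)" "(B, Y)" "(\<psi>, g)" "(D, Z)"] assms
  by (simp add: Hom_prod_cat Cmp_prod_cat)

lemma T_functor:
  assumes A: "A \<in> weil_objs"
  shows "functor_between C C (T_at T A)"
proof unfold_locales
  note F = functorD[OF act_functor]
  show "is_functor C C (T_at T A)"
    unfolding is_functor_def
  proof (intro conjI ballI allI impI)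
    show "fobj (T_at T A) X \<in> Obj C" if "X \<in> Obj C" for X
      using F(1)[of "(A, X)"] that A by (simp add: T_at_def Obj_prod_cat weil_Obj)
    show "farr (T_at T A) f \<in> Hom C (fobj (T_at T A) X) (fobj (T_at T A) Y)"
      if "f \<in> Hom C X Y" for X Y f
      using F(2)[of "(Ide Weil A, f)" "(A, X)" "(A, Y)"] that weil_Ide_Hom[OF A]
      by (simp add: T_at_def Hom_prod_cat)
    show "farr (T_at T A) (Ide C X) = Ide C (fobj (T_at T A) X)" if "X \<in> Obj C" for X
      using F(3)[of "(A, X)"] that A by (simp add: T_at_def Obj_prod_cat weil_Obj Ide_prod_cat)
    show "farr (T_at T A) (g \<bullet>\<^bsub>C\<^esub> f) = farr (T_at T A) g \<bullet>\<^bsub>C\<^esub> farr (T_at T A) f"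
      if "f \<in> Hom C X Y" "g \<in> Hom C Y Z" for X Y Z f g
      using act_Cmp[OF weil_Ide_Hom[OF A] weil_Ide_Hom[OF A] that] weil_Cmp_Ide(1)[OF weil_Ide_Hom[OF A]]
      by (simp add: T_at_def)
  qed
qed

lemmas T_obj [simp] = functor_between.obj[OF T_functor]
  and T_arr [simp] = functor_between.arr[OF T_functor]
  and T_Ide [simp] = functor_between.Ide[OF T_functor]
  and T_Cmp [simp] = functor_between.Cmp[OF T_functor]

lemma T_nat:
  assumes "\<theta> \<in> Hom Weil A B" "X \<in> Obj C"
  shows "T_nat C T \<theta> X \<in> Arr C" "Dom C (T_nat C T \<theta> X) = fobj (T_at T A) X"
    "Cod C (T_nat C T \<theta> X) = fobj (T_at T B) X"
proof -
  have "Ide C X \<in> Hom C X X" using assms(2) by (simp add: Hom_def)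
  then have "T_nat C T \<theta> X \<in> Hom C (fobj (T_at T A) X) (fobj (T_at T B) X)"
    using functorD(2)[OF act_functor, of "(\<theta>, Ide C X)" "(A, X)" "(B, X)"] assms(1)
    by (simp add: T_nat_def T_at_def Hom_prod_cat)
  then show "T_nat C T \<theta> X \<in> Arr C" "Dom C (T_nat C T \<theta> X) = fobj (T_at T A) X"
    "Cod C (T_nat C T \<theta> X) = fobj (T_at T B) X"
    by (auto simp: Hom_def)
qed

lemma unit_nat_iso: "is_nat_iso C C \<lparr>fobj = (\<lambda>X. X), farr = (\<lambda>f. f)\<rparr> (T_at T wN) (act_unit T)"
  using actegory by (simp add: weil_actegory_def)

lemma act_unit [simp]:
  assumes "X \<in> Obj C"
  shows "act_unit T X \<in> Arr C" "Dom C (act_unit T X) = X" "Cod C (act_unit T X) = fobj (T_at T wN) X"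
    "is_iso C (act_unit T X)"
  using nat_isoD(1,3)[OF unit_nat_iso assms] by (auto simp: Hom_def)

lemma mult_nat_iso:
  assumes A: "A \<in> weil_objs" and B: "B \<in> weil_objs"
  shows "is_nat_iso C C
    \<lparr>fobj = (\<lambda>X. fobj (T_at T A) (fobj (T_at T B) X)), farr = (\<lambda>f. farr (T_at T A) (farr (T_at T B) f))\<rparr>
    (T_at T (A \<otimes>\<^sub>w B)) (act_mult T A B)"
proof -
  have nat: "is_nat_iso (Weil \<times>\<^sub>c Weil \<times>\<^sub>c C) C
       \<lparr>fobj = (\<lambda>(A, B, X). fobj (act T) (A, fobj (act T) (B, X))),
        farr = (\<lambda>(\<theta>, \<psi>, f). farr (act T) (\<theta>, farr (act T) (\<psi>, f)))\<rparr>
       \<lparr>fobj = (\<lambda>(A, B, X). fobj (act T) (A \<otimes>\<^sub>w B, X)),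
        farr = (\<lambda>(\<theta>, \<psi>, f). farr (act T) (\<theta> \<otimes>\<^sub>a \<psi>, f))\<rparr>
       (\<lambda>(A, B, X). act_mult T A B X)"
    using actegory by (simp add: weil_actegory_def)
  have obj: "(A, B, X) \<in> Obj (Weil \<times>\<^sub>c Weil \<times>\<^sub>c C)" if "X \<in> Obj C" for X
    using that A B by (simp add: Obj_prod_cat weil_Obj)
  have hom: "(Ide Weil A, Ide Weil B, f) \<in> Hom (Weil \<times>\<^sub>c Weil \<times>\<^sub>c C) (A, B, X) (A, B, Y)"
    if "f \<in> Hom C X Y" for f X Y
    using that weil_Ide_Hom[OF A] weil_Ide_Hom[OF B] by (simp add: Hom_prod_cat)
  show ?thesis
    unfolding is_nat_iso_def is_nat_trans_def
    using nat_isoD(1,3)[OF nat obj] nat_isoD(2)[OF nat hom]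
    by (simp add: T_at_def wtensor_arr_Ide[OF A B])
qed

lemma act_mult [simp]:
  assumes "A \<in> weil_objs" "B \<in> weil_objs" "X \<in> Obj C"
  shows "act_mult T A B X \<in> Arr C"
    "Dom C (act_mult T A B X) = fobj (T_at T A) (fobj (T_at T B) X)"
    "Cod C (act_mult T A B X) = fobj (T_at T (A \<otimes>\<^sub>w B)) X"
    "is_iso C (act_mult T A B X)"
  using nat_isoD(1,3)[OF mult_nat_iso[OF assms(1,2)] assms(3)] by (auto simp: Hom_def)

end

definition tan_power :: "('o, 'm) weil_action \<Rightarrow> nat \<Rightarrow> ('o, 'm, 'o, 'm) ftor" where
  "tan_power T k = \<lparr>fobj = tan_obj T ^^ k, farr = tan_arr T ^^ k\<rparr>"

context actegory_context
begin

lemma tan_power_functor: "functor_between C C (tan_power T k)"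
proof unfold_locales
  interpret T: functor_between C C "T_at T wW" by (rule T_functor[OF wW_obj])
  show "is_functor C C (tan_power T k)"
  proof (induction k)
    case 0
    show ?case by (simp add: is_functor_def tan_power_def)
  next
    case (Suc k)
    interpret P: functor_between C C "tan_power T k" by unfold_locales (rule Suc)
    have s: "fobj (tan_power T (Suc k)) X = tan_obj T (fobj (tan_power T k) X)"
      "farr (tan_power T (Suc k)) f = tan_arr T (farr (tan_power T k) f)" for X f
      by (simp_all add: tan_power_def)
    show ?case unfolding is_functor_def s by (auto simp: Hom_def)
  qed
qed

text \<open>Iterating \<open>T\<^sub>W T\<^sub>A \<cong> T\<close> at \<open>W \<otimes> A\<close>, starting from the unit isomorphism. The hypotheses on a
differential functor speak of one Weil algebra at a time, whereas a differential bundle asks for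
preservation by iterates of \<open>T\<close>; this isomorphism connects the two.\<close>

lemma tan_power_nat_iso: "\<exists>\<tau>. is_nat_iso C C (tan_power T k) (T_at T (wW_pow k)) \<tau>"
proof (induction k)
  case 0
  have "tan_power T 0 = \<lparr>fobj = (\<lambda>X. X), farr = (\<lambda>f. f)\<rparr>" by (simp add: tan_power_def id_def)
  then show ?case using unit_nat_iso by auto
next
  case (Suc k)
  then obtain \<tau> where \<tau>: "is_nat_iso C C (tan_power T k) (T_at T (wW_pow k)) \<tau>" by blast
  interpret T: functor_between C C "T_at T wW" by (rule T_functor[OF wW_obj])
  interpret P: functor_between C C "tan_power T k" by (rule tan_power_functor)
  have s: "fobj (tan_power T (Suc k)) X = tan_obj T (fobj (tan_power T k) X)"
    "farr (tan_power T (Suc k)) f = tan_arr T (farr (tan_power T k) f)" for X f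
    by (simp_all add: tan_power_def)
  note m = act_mult[OF wW_obj wW_pow_obj[of k]] and mn = nat_isoD(2)[OF mult_nat_iso[OF wW_obj wW_pow_obj[of k]], simplified]
  have t: "\<tau> X \<in> Arr C" "Dom C (\<tau> X) = fobj (tan_power T k) X" "Cod C (\<tau> X) = fobj (T_at T (wW_pow k)) X"
    "is_iso C (\<tau> X)" if "X \<in> Obj C" for X
    using nat_isoD(1,3)[OF \<tau> that] by (auto simp: Hom_def)
  let ?\<sigma> = "\<lambda>X. act_mult T wW (wW_pow k) X \<bullet>\<^bsub>C\<^esub> tan_arr T (\<tau> X)"
  have "is_nat_iso C C (tan_power T (Suc k)) (T_at T (wW_pow (Suc k))) ?\<sigma>"
    unfolding is_nat_iso_def is_nat_trans_def s wW_pow.simps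
  proof (intro conjI ballI allI impI)
    show "?\<sigma> X \<in> Hom C (tan_obj T (fobj (tan_power T k) X)) (fobj (T_at T (wW \<otimes>\<^sub>w wW_pow k)) X)"
      if "X \<in> Obj C" for X
      using m[OF that] t[OF that] by (simp add: Hom_def)
    show "is_iso C (?\<sigma> X)" if "X \<in> Obj C" for X
      using m[OF that] t[OF that] T.is_iso by (intro is_iso_Cmp) simp_all
    fix X Y f assume f: "f \<in> Hom C X Y"
    then have o: "f \<in> Arr C" "Dom C f = X" "Cod C f = Y" "X \<in> Obj C" "Y \<in> Obj C"
      by (auto simp: Hom_def)
    note facts = o m[OF o(4)] m[OF o(5)] t[OF o(4)] t[OF o(5)] wW_pow_obj
    have "?\<sigma> Y \<bullet>\<^bsub>C\<^esub> tan_arr T (farr (tan_power T k) f) =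
        act_mult T wW (wW_pow k) Y \<bullet>\<^bsub>C\<^esub> tan_arr T (\<tau> Y \<bullet>\<^bsub>C\<^esub> farr (tan_power T k) f)"
      using facts by simp
    also have "\<dots> = act_mult T wW (wW_pow k) Y \<bullet>\<^bsub>C\<^esub> (tan_arr T (farr (T_at T (wW_pow k)) f) \<bullet>\<^bsub>C\<^esub> tan_arr T (\<tau> X))"
      unfolding nat_isoD(2)[OF \<tau> f] using facts by simp
    also have "\<dots> = farr (T_at T (wW \<otimes>\<^sub>w wW_pow k)) f \<bullet>\<^bsub>C\<^esub> ?\<sigma> X"
      by (rule Cmp_eq_assoc[OF mn[OF f]]) (use facts wtensor_obj[OF wW_obj wW_pow_obj] in simp_all)
    finally show "?\<sigma> Y \<bullet>\<^bsub>C\<^esub> tan_arr T (farr (tan_power T k) f) =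
      farr (T_at T (wW \<otimes>\<^sub>w wW_pow k)) f \<bullet>\<^bsub>C\<^esub> ?\<sigma> X" .
  qed
  then show ?case by blast
qed

lemma tan_zero [simp]:
  assumes "X \<in> Obj C"
  shows "tan_zero C T X \<in> Arr C" "Dom C (tan_zero C T X) = X" "Cod C (tan_zero C T X) = tan_obj T X"
  using T_nat[OF weil_zero_Hom assms] assms by (simp_all add: tan_zero_def)

lemma tan_p [simp]:
  assumes "X \<in> Obj C"
  shows "tan_p C T X \<in> Arr C" "Dom C (tan_p C T X) = tan_obj T X" "Cod C (tan_p C T X) = X"
  using T_nat[OF weil_p_Hom assms] inv_arr(2-4)[OF act_unit(4)[OF assms]] assms by (simp_all add: tan_p_def)

text \<open>The structure map without the inverse of the unit isomorphism, the form in which naturality of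
\<open>\<alpha>\<close> applies to it.\<close>

lemma unit_tan_p:
  assumes "X \<in> Obj C"
  shows "act_unit T X \<bullet>\<^bsub>C\<^esub> tan_p C T X = T_nat C T weil_p X"
  using T_nat[OF weil_p_Hom assms] inv_arr_cancel[OF act_unit(4)[OF assms]] assms by (simp add: tan_p_def)

lemma tan_l [simp]:
  assumes "X \<in> Obj C"
  shows "tan_l C T X \<in> Arr C" "Dom C (tan_l C T X) = tan_obj T X" "Cod C (tan_l C T X) = tan_obj T (tan_obj T X)"
  using T_nat[OF weil_l_Hom assms] inv_arr(2-4)[OF act_mult(4)[OF wW_obj wW_obj assms]]
    act_mult[OF wW_obj wW_obj assms]
  by (simp_all add: tan_l_def)

lemma mult_tan_l:
  assumes "X \<in> Obj C"
  shows "act_mult T wW wW X \<bullet>\<^bsub>C\<^esub> tan_l C T X = T_nat C T weil_l X"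
  using T_nat[OF weil_l_Hom assms] inv_arr_cancel[OF act_mult(4)[OF wW_obj wW_obj assms]]
    act_mult[OF wW_obj wW_obj assms] by (simp add: tan_l_def)

end

section \<open>Oplax functors and the tangent structure\<close>

locale differential_functor_context = C: actegory_context C T + D: actegory_context C' T'
  for C :: "('o, 'm) cat" and T :: "('o, 'm) weil_action"
    and C' :: "('p, 'n) cat" and T' :: "('p, 'n) weil_action" +
  fixes t :: 'o and F :: "('o, 'm, 'p, 'n) ftor" and al :: "wobj \<Rightarrow> 'o \<Rightarrow> 'n"
  assumes diff: "differential_functor C T C' T' t F al"
begin

lemma terminal: "terminal C t"
  and oplax: "oplax_weil_functor C T C' T' F al"
  using diff by (simp_all add: differential_functor_def)

sublocale F: functor_between C C' F
  by unfold_locales (use oplax in \<open>simp add: oplax_weil_functor_def\<close>)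

lemma al_nat_trans: "is_nat_trans (Weil \<times>\<^sub>c C) C'
       \<lparr>fobj = (\<lambda>(A, X). fobj F (fobj (act T) (A, X))),
        farr = (\<lambda>(\<theta>, f). farr F (farr (act T) (\<theta>, f)))\<rparr>
       \<lparr>fobj = (\<lambda>(A, X). fobj (act T') (A, fobj F X)),
        farr = (\<lambda>(\<theta>, f). farr (act T') (\<theta>, farr F f))\<rparr>
       (\<lambda>(A, X). al A X)"
  using oplax by (simp add: oplax_weil_functor_def)

lemma al [simp]:
  assumes "A \<in> weil_objs" "X \<in> Obj C"
  shows "al A X \<in> Arr C'" "Dom C' (al A X) = fobj F (fobj (T_at T A) X)"
    "Cod C' (al A X) = fobj (T_at T' A) (fobj F X)"
proof -
  have "(A, X) \<in> Obj (Weil \<times>\<^sub>c C)" using assms by (simp add: Obj_prod_cat weil_Obj)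
  then have "al A X \<in> Hom C' (fobj F (fobj (T_at T A) X)) (fobj (T_at T' A) (fobj F X))"
    using al_nat_trans unfolding is_nat_trans_def by (fastforce simp: T_at_def)
  then show "al A X \<in> Arr C'" "Dom C' (al A X) = fobj F (fobj (T_at T A) X)"
    "Cod C' (al A X) = fobj (T_at T' A) (fobj F X)"
    by (auto simp: Hom_def)
qed

lemma al_natural:
  assumes "\<theta> \<in> Hom Weil A B" "f \<in> Hom C X Y"
  shows "al B Y \<bullet>\<^bsub>C'\<^esub> farr F (farr (act T) (\<theta>, f)) = farr (act T') (\<theta>, farr F f) \<bullet>\<^bsub>C'\<^esub> al A X"
proof -
  have "(\<theta>, f) \<in> Hom (Weil \<times>\<^sub>c C) (A, X) (B, Y)" using assms by (simp add: Hom_prod_cat)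
  then show ?thesis using al_nat_trans unfolding is_nat_trans_def by fastforce
qed

lemma al_T:
  assumes A: "A \<in> weil_objs" and f: "f \<in> Arr C"
  shows "al A (Cod C f) \<bullet>\<^bsub>C'\<^esub> farr F (farr (T_at T A) f) =
    farr (T_at T' A) (farr F f) \<bullet>\<^bsub>C'\<^esub> al A (Dom C f)"
  using al_natural[OF weil_Ide_Hom[OF A], of f "Dom C f" "Cod C f"] f by (simp add: T_at_def Hom_def)

lemma al_T_nat:
  assumes "\<theta> \<in> Hom Weil A B" and X: "X \<in> Obj C"
  shows "al B X \<bullet>\<^bsub>C'\<^esub> farr F (T_nat C T \<theta> X) = T_nat C' T' \<theta> (fobj F X) \<bullet>\<^bsub>C'\<^esub> al A X"
  using al_natural[OF assms(1), of "Ide C X" X X] X by (simp add: T_nat_def Hom_def)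

lemma al_unit: "X \<in> Obj C \<Longrightarrow> al wN X \<bullet>\<^bsub>C'\<^esub> farr F (act_unit T X) = act_unit T' (fobj F X)"
  using oplax by (simp add: oplax_weil_functor_def)

lemma al_mult:
  assumes "A \<in> weil_objs" "B \<in> weil_objs" "X \<in> Obj C"
  shows "al (A \<otimes>\<^sub>w B) X \<bullet>\<^bsub>C'\<^esub> farr F (act_mult T A B X) =
        act_mult T' A B (fobj F X) \<bullet>\<^bsub>C'\<^esub>
          (farr (T_at T' A) (al B X) \<bullet>\<^bsub>C'\<^esub> al A (fobj (T_at T B) X))"
  using oplax assms by (simp add: oplax_weil_functor_def weil_Obj)

lemmas weil_obj_simps = wN_obj wW_obj wW2_obj wtensor_obj

text \<open>Compatibility of \<open>\<alpha>\<close> with the zero of the tangent structure combines naturality in the Weil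
algebra, along \<open>N \<rightarrow> W\<close>, with the unit axiom. For the projection and the vertical lift the structure
isomorphisms have to be cancelled on the side of the target.\<close>

lemma al_tan_zero:
  assumes X: "X \<in> Obj C"
  shows "al wW X \<bullet>\<^bsub>C'\<^esub> farr F (tan_zero C T X) = tan_zero C' T' (fobj F X)"
proof -
  note n = C.T_nat[OF weil_zero_Hom X] and n' = D.T_nat[OF weil_zero_Hom F.obj[OF X]]
  have "al wW X \<bullet>\<^bsub>C'\<^esub> farr F (tan_zero C T X) =
      al wW X \<bullet>\<^bsub>C'\<^esub> (farr F (T_nat C T weil_zero X) \<bullet>\<^bsub>C'\<^esub> farr F (act_unit T X))"
    using X n by (simp add: tan_zero_def)
  also have "\<dots> = T_nat C' T' weil_zero (fobj F X) \<bullet>\<^bsub>C'\<^esub> (al wN X \<bullet>\<^bsub>C'\<^esub> farr F (act_unit T X))"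
    by (rule D.Cmp_eq_assoc[OF al_T_nat[OF weil_zero_Hom X]]) (use X n n' weil_obj_simps in simp_all)
  also have "\<dots> = tan_zero C' T' (fobj F X)"
    by (simp add: al_unit[OF X] tan_zero_def)
  finally show ?thesis .
qed

lemma al_tan_p:
  assumes X: "X \<in> Obj C"
  shows "tan_p C' T' (fobj F X) \<bullet>\<^bsub>C'\<^esub> al wW X = farr F (tan_p C T X)"
proof -
  note n = C.T_nat[OF weil_p_Hom X] and n' = D.T_nat[OF weil_p_Hom F.obj[OF X]]
  note iso = D.act_unit(4)[OF F.obj[OF X]]
  have "T_nat C' T' weil_p (fobj F X) \<bullet>\<^bsub>C'\<^esub> al wW X = al wN X \<bullet>\<^bsub>C'\<^esub> farr F (T_nat C T weil_p X)"
    by (rule al_T_nat[OF weil_p_Hom X, symmetric])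
  also have "\<dots> = al wN X \<bullet>\<^bsub>C'\<^esub> (farr F (act_unit T X) \<bullet>\<^bsub>C'\<^esub> farr F (tan_p C T X))"
    using F.Cmp_eqD1[OF C.unit_tan_p[OF X]] X by simp
  also have "\<dots> = act_unit T' (fobj F X) \<bullet>\<^bsub>C'\<^esub> farr F (tan_p C T X)"
    by (rule D.Cmp_eq_assoc1[OF al_unit[OF X]]) (use X weil_obj_simps in simp_all)
  finally have "T_nat C' T' weil_p (fobj F X) \<bullet>\<^bsub>C'\<^esub> al wW X =
    act_unit T' (fobj F X) \<bullet>\<^bsub>C'\<^esub> farr F (tan_p C T X)" .
  then show ?thesis
    using n' X D.inv_arr(2-4)[OF iso] D.inv_arr_cancel[OF iso] weil_obj_simps by (simp add: tan_p_def[of C' T'])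
qed

lemma al_tan_l:
  assumes X: "X \<in> Obj C"
  shows "tan_l C' T' (fobj F X) \<bullet>\<^bsub>C'\<^esub> al wW X =
    tan_arr T' (al wW X) \<bullet>\<^bsub>C'\<^esub> (al wW (tan_obj T X) \<bullet>\<^bsub>C'\<^esub> farr F (tan_l C T X))"
proof -
  note n = C.T_nat[OF weil_l_Hom X] and n' = D.T_nat[OF weil_l_Hom F.obj[OF X]]
  note iso = D.act_mult(4)[OF wW_obj wW_obj F.obj[OF X]]
  let ?r = "tan_arr T' (al wW X) \<bullet>\<^bsub>C'\<^esub> (al wW (tan_obj T X) \<bullet>\<^bsub>C'\<^esub> farr F (tan_l C T X))"
  have "T_nat C' T' weil_l (fobj F X) \<bullet>\<^bsub>C'\<^esub> al wW X = al (wW \<otimes>\<^sub>w wW) X \<bullet>\<^bsub>C'\<^esub> farr F (T_nat C T weil_l X)"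
    by (rule al_T_nat[OF weil_l_Hom X, symmetric])
  also have "\<dots> = al (wW \<otimes>\<^sub>w wW) X \<bullet>\<^bsub>C'\<^esub> (farr F (act_mult T wW wW X) \<bullet>\<^bsub>C'\<^esub> farr F (tan_l C T X))"
    using F.Cmp_eqD1[OF C.mult_tan_l[OF X]] X weil_obj_simps by simp
  also have "\<dots> = (act_mult T' wW wW (fobj F X) \<bullet>\<^bsub>C'\<^esub>
      (tan_arr T' (al wW X) \<bullet>\<^bsub>C'\<^esub> al wW (tan_obj T X))) \<bullet>\<^bsub>C'\<^esub> farr F (tan_l C T X)"
    by (rule D.Cmp_eq_assoc1[OF al_mult[OF wW_obj wW_obj X]]) (use X weil_obj_simps in simp_all)
  also have "\<dots> = act_mult T' wW wW (fobj F X) \<bullet>\<^bsub>C'\<^esub> ?r"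
    using X weil_obj_simps by simp
  finally have "T_nat C' T' weil_l (fobj F X) \<bullet>\<^bsub>C'\<^esub> al wW X = act_mult T' wW wW (fobj F X) \<bullet>\<^bsub>C'\<^esub> ?r" .
  then show ?thesis
    using n' X D.inv_arr(2-4)[OF iso] D.inv_arr_cancel(1)[OF iso] weil_obj_simps by (simp add: tan_l_def[of C' T'])
qed

section \<open>Preservation of fibre powers\<close>

text \<open>The hypothesis on pullbacks over \<open>t\<close>, transported from the tensor powers of \<open>W\<close> to the iterates
of the tangent functor. For \<open>k = 0\<close>, the algebra \<open>N\<close>, it says that \<open>F\<close> itself preserves them.\<close>

lemma tan_power_pullback:
  assumes pb: "is_pullback C f g p q" and t: "Cod C f = t"
  shows "is_pullback C' ((tan_arr T' ^^ k) (farr F f)) ((tan_arr T' ^^ k) (farr F g))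
    ((tan_arr T' ^^ k) (farr F p)) ((tan_arr T' ^^ k) (farr F q))"
proof -
  note d = C.pullbackD[OF pb]
  obtain \<tau> where \<tau>: "is_nat_iso C' C' (tan_power T' k) (T_at T' (wW_pow k)) \<tau>"
    using D.tan_power_nat_iso by blast
  have "is_pullback C' (farr (T_at T' (wW_pow k)) (farr F f)) (farr (T_at T' (wW_pow k)) (farr F g))
          (farr (T_at T' (wW_pow k)) (farr F p)) (farr (T_at T' (wW_pow k)) (farr F q))"
    using diff pb t wW_pow_obj[of k] unfolding differential_functor_def weil_Obj by blast
  from pullback_along_nat_iso[OF D.tan_power_functor D.T_functor[OF wW_pow_obj] \<tau> _ _ _ _ _ _ _ _ _ this]
  show ?thesis using d F.Cmp_eqD[OF d(9)] by (simp add: tan_power_def)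
qed

lemmas F_pullback = tan_power_pullback[where k = 0, simplified]

lemma tan_power_fibre_power:
  assumes q: "q \<in> Arr C" "Cod C q = t" and ex: "\<And>n. \<exists>b pr. is_fibre_power C q n b pr"
    and fp: "is_fibre_power C q n b pr"
  shows "is_fibre_power C' ((tan_arr T' ^^ k) (farr F q)) n ((tan_arr T' ^^ k) (farr F b))
    (\<lambda>i. (tan_arr T' ^^ k) (farr F (pr i)))"
proof -
  interpret P: functor_between C' C' "tan_power T' k" by (rule D.tan_power_functor)
  interpret PF: functor_between C C' "\<lparr>fobj = (\<lambda>X. fobj (tan_power T' k) (fobj F X)),
      farr = (\<lambda>f. farr (tan_power T' k) (farr F f))\<rparr>"
    by unfold_locales (auto simp: is_functor_def Hom_def)
  show ?thesis
    using PF.fibre_power[where t = t, OF _ q ex fp] tan_power_pullback by (simp add: tan_power_def)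
qed

lemmas F_fibre_power = tan_power_fibre_power[where k = 0, simplified]

end

section \<open>The image of an additive bundle\<close>

text \<open>The shape of a bundle diagram, without limits or laws. The diagrams \<open>T E\<close> and \<open>F E\<close> and the
tangent bundle have it too, and it suffices for computing with additive morphisms.\<close>

definition bundle_data :: "('o, 'm) cat \<Rightarrow> ('o, 'm, 'z) abundle_scheme \<Rightarrow> bool" where
  "bundle_data C B \<longleftrightarrow> proj B \<in> Hom C (tot B) (base B) \<and>
     pr0 B \<in> Hom C (tot2 B) (tot B) \<and> pr1 B \<in> Hom C (tot2 B) (tot B) \<and>
     plus B \<in> Hom C (tot2 B) (tot B) \<and> null B \<in> Hom C (base B) (tot B)"

lemma (in is_category) bundle_dataD:
  assumes "bundle_data C B"
  shows "proj B \<in> Arr C" "Dom C (proj B) = tot B" "Cod C (proj B) = base B"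
    "pr0 B \<in> Arr C" "Dom C (pr0 B) = tot2 B" "Cod C (pr0 B) = tot B"
    "pr1 B \<in> Arr C" "Dom C (pr1 B) = tot2 B" "Cod C (pr1 B) = tot B"
    "plus B \<in> Arr C" "Dom C (plus B) = tot2 B" "Cod C (plus B) = tot B"
    "null B \<in> Arr C" "Dom C (null B) = base B" "Cod C (null B) = tot B"
    "tot B \<in> Obj C" "base B \<in> Obj C" "tot2 B \<in> Obj C"
  using assms[unfolded bundle_data_def Hom_def] Dom_Obj[of "proj B"] Cod_Obj[of "proj B"] Dom_Obj[of "pr0 B"]
  by simp_all

lemma additive_bundle_data: "additive_bundle C B \<Longrightarrow> bundle_data C B"
  by (simp add: additive_bundle_def bundle_data_def)

lemma additive_bundle_axioms:
  assumes "additive_bundle C B"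
  shows "\<And>n. \<exists>b pr. is_fibre_power C (proj B) n b pr"
    "is_pullback C (proj B) (proj B) (pr0 B) (pr1 B)"
    "proj B \<bullet>\<^bsub>C\<^esub> plus B = proj B \<bullet>\<^bsub>C\<^esub> pr0 B"
    "proj B \<bullet>\<^bsub>C\<^esub> null B = Ide C (base B)"
    "\<And>Z a b c ab bc l r. a \<in> Hom C Z (tot B) \<Longrightarrow> b \<in> Hom C Z (tot B) \<Longrightarrow> c \<in> Hom C Z (tot B) \<Longrightarrow>
        is_pair C B a b ab \<Longrightarrow> is_pair C B b c bc \<Longrightarrow>
        is_pair C B (plus B \<bullet>\<^bsub>C\<^esub> ab) c l \<Longrightarrow> is_pair C B a (plus B \<bullet>\<^bsub>C\<^esub> bc) r \<Longrightarrow>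
        plus B \<bullet>\<^bsub>C\<^esub> l = plus B \<bullet>\<^bsub>C\<^esub> r"
    "\<And>Z a b h h'. a \<in> Hom C Z (tot B) \<Longrightarrow> b \<in> Hom C Z (tot B) \<Longrightarrow>
        is_pair C B a b h \<Longrightarrow> is_pair C B b a h' \<Longrightarrow> plus B \<bullet>\<^bsub>C\<^esub> h = plus B \<bullet>\<^bsub>C\<^esub> h'"
    "\<And>Z a h. a \<in> Hom C Z (tot B) \<Longrightarrow> is_pair C B a (null B \<bullet>\<^bsub>C\<^esub> (proj B \<bullet>\<^bsub>C\<^esub> a)) h \<Longrightarrow>
        plus B \<bullet>\<^bsub>C\<^esub> h = a"
  using assms unfolding additive_bundle_def by blast+


lemma (in is_category) is_pairD:
  assumes "is_pair C B a b h"
  shows "h \<in> Arr C" "Dom C h = Dom C a" "Cod C h = tot2 B" "pr0 B \<bullet>\<^bsub>C\<^esub> h = a" "pr1 B \<bullet>\<^bsub>C\<^esub> h = b"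
  using assms by (auto simp: is_pair_def Hom_def)

lemma (in is_category) is_pairI:
  assumes "h \<in> Arr C" "Dom C h = Dom C a" "Cod C h = tot2 B" "pr0 B \<bullet>\<^bsub>C\<^esub> h = a" "pr1 B \<bullet>\<^bsub>C\<^esub> h = b"
  shows "is_pair C B a b h"
  using assms by (auto simp: is_pair_def Hom_def)

lemma (in is_category) pair_exists:
  assumes ab: "additive_bundle C B"
    and "a \<in> Arr C" "b \<in> Arr C" "Dom C b = Dom C a" "Cod C a = tot B" "Cod C b = tot B"
    and "proj B \<bullet>\<^bsub>C\<^esub> a = proj B \<bullet>\<^bsub>C\<^esub> b"
  obtains h where "is_pair C B a b h"
  by (rule pullback_pair[OF additive_bundle_axioms(2)[OF ab], of a b])
     (use assms(2-) bundle_dataD[OF additive_bundle_data[OF ab]] that in \<open>auto intro: is_pairI\<close>)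

lemma (in is_category) pair_unique:
  assumes pb: "is_pullback C (proj B) (proj B) (pr0 B) (pr1 B)"
    and "Dom C (pr0 B) = tot2 B"
    and h: "is_pair C B a b h" and h': "is_pair C B a b h'"
  shows "h = h'"
  by (rule pullback_eqI[OF pb]) (use assms(2) is_pairD[OF h] is_pairD[OF h'] in auto)

context differential_functor_context
begin

lemma functor_image_simps [simp]:
  "tot (functor_image C' F al B) = fobj F (tot B)"
  "base (functor_image C' F al B) = fobj F (base B)"
  "proj (functor_image C' F al B) = farr F (proj B)"
  "tot2 (functor_image C' F al B) = fobj F (tot2 B)"
  "pr0 (functor_image C' F al B) = farr F (pr0 B)"
  "pr1 (functor_image C' F al B) = farr F (pr1 B)"
  "plus (functor_image C' F al B) = farr F (plus B)"
  "null (functor_image C' F al B) = farr F (null B)"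
  "lift (functor_image C' F al B) = al wW (tot B) \<bullet>\<^bsub>C'\<^esub> farr F (lift B)"
  by (simp_all add: functor_image_def)

text \<open>A pairing of generalised elements that factor through the image of \<open>F\<close> is the restriction of the
\<open>F\<close>-image of a pairing. This reduces the laws for arbitrary generalised elements of \<open>F E\<close> to
universal elements, which are \<open>F\<close>-images.\<close>

lemma F_pair_restrict:
  assumes ab: "additive_bundle C B" and base: "base B = t"
    and k: "is_pair C B a b k" and a: "a \<in> Arr C" "b \<in> Arr C"
    and x: "x \<in> Arr C'" "Cod C' x = fobj F (Dom C a)"
    and h: "is_pair C' (functor_image C' F al B) (farr F a \<bullet>\<^bsub>C'\<^esub> x) (farr F b \<bullet>\<^bsub>C'\<^esub> x) h"
  shows "h = farr F k \<bullet>\<^bsub>C'\<^esub> x"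
proof (rule D.pair_unique[OF _ _ h])
  note d = C.bundle_dataD[OF additive_bundle_data[OF ab]] and kd = C.is_pairD[OF k]
  show "is_pullback C' (proj (functor_image C' F al B)) (proj (functor_image C' F al B))
     (pr0 (functor_image C' F al B)) (pr1 (functor_image C' F al B))"
    using F_pullback[OF additive_bundle_axioms(2)[OF ab]] d base by simp
  show "Dom C' (pr0 (functor_image C' F al B)) = tot2 (functor_image C' F al B)"
    using d by simp
  have "farr F (pr0 B) \<bullet>\<^bsub>C'\<^esub> (farr F k \<bullet>\<^bsub>C'\<^esub> x) = farr F a \<bullet>\<^bsub>C'\<^esub> x"
    by (rule D.Cmp_eq_assoc1[OF F.Cmp_eqD1[OF kd(4)]]) (use d kd(1-3) x in simp_all)
  moreover have "farr F (pr1 B) \<bullet>\<^bsub>C'\<^esub> (farr F k \<bullet>\<^bsub>C'\<^esub> x) = farr F b \<bullet>\<^bsub>C'\<^esub> x"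
    by (rule D.Cmp_eq_assoc1[OF F.Cmp_eqD1[OF kd(5)]]) (use d kd(1-3) x in simp_all)
  ultimately show "is_pair C' (functor_image C' F al B) (farr F a \<bullet>\<^bsub>C'\<^esub> x) (farr F b \<bullet>\<^bsub>C'\<^esub> x) (farr F k \<bullet>\<^bsub>C'\<^esub> x)"
    using kd(1-3) d x a by (intro D.is_pairI) simp_all
qed

text \<open>Three generalised elements over the same map to the base are the restriction along some \<open>x\<close> of
the three projections of \<open>F E\<^sub>3\<close>. There both sums are images of sums in \<open>E\<close>, which agree.\<close>

lemma functor_image_assoc:
  assumes ab: "additive_bundle C B" and base: "base B = t"
    and abc: "a \<in> Hom C' Z (fobj F (tot B))" "b \<in> Hom C' Z (fobj F (tot B))" "c \<in> Hom C' Z (fobj F (tot B))"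
    and pab: "is_pair C' (functor_image C' F al B) a b ab'" and pbc: "is_pair C' (functor_image C' F al B) b c bc"
    and pl: "is_pair C' (functor_image C' F al B) (farr F (plus B) \<bullet>\<^bsub>C'\<^esub> ab') c l"
    and pr: "is_pair C' (functor_image C' F al B) a (farr F (plus B) \<bullet>\<^bsub>C'\<^esub> bc) r"
  shows "farr F (plus B) \<bullet>\<^bsub>C'\<^esub> l = farr F (plus B) \<bullet>\<^bsub>C'\<^esub> r"
proof -
  note d = C.bundle_dataD[OF additive_bundle_data[OF ab]] and ax = additive_bundle_axioms[OF ab]
  note pb = F_pullback[OF ax(2), unfolded d(3), OF base]
  note abc' = HomD[OF abc(1)] HomD[OF abc(2)] HomD[OF abc(3)]
  have same: "farr F (proj B) \<bullet>\<^bsub>C'\<^esub> u = farr F (proj B) \<bullet>\<^bsub>C'\<^esub> v"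
    if "is_pair C' (functor_image C' F al B) u v h" for u v h
    using D.Cmp_eq_assoc[OF D.pullbackD(9)[OF pb], of h] D.is_pairD[OF that] d by simp
  obtain p3 P where fp: "is_fibre_power C (proj B) 3 p3 P" using ax(1) by blast
  note fd = C.fibre_powerD[OF fp]
  have P: "P i \<in> Arr C" "Dom C (P i) = Dom C p3" "Cod C (P i) = tot B" "proj B \<bullet>\<^bsub>C\<^esub> P i = p3" if "i < 3" for i
    using fd(4-7)[OF that] d by simp_all
  have Ffp: "is_fibre_power C' (farr F (proj B)) 3 (farr F p3) (\<lambda>i. farr F (P i))"
    by (rule F_fibre_power[OF _ _ ax(1) fp]) (use d base in simp_all)
  \<comment> \<open>The given elements factor through the third fibre power of \<open>F E\<close>, which is \<open>F E\<^sub>3\<close>.\<close>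
  let ?e = "\<lambda>i::nat. if i = 0 then a else if i = 1 then b else c"
  obtain x where x: "x \<in> Arr C'" "Dom C' x = Dom C' (farr F (proj B) \<bullet>\<^bsub>C'\<^esub> a)"
    "Cod C' x = Dom C' (farr F p3)" "farr F p3 \<bullet>\<^bsub>C'\<^esub> x = farr F (proj B) \<bullet>\<^bsub>C'\<^esub> a"
    "\<And>i. i < 3 \<Longrightarrow> farr F (P i) \<bullet>\<^bsub>C'\<^esub> x = ?e i"
    by (rule D.fibre_power_tuple[OF Ffp, of "farr F (proj B) \<bullet>\<^bsub>C'\<^esub> a" ?e])
       (use abc' d same[OF pab] same[OF pbc] in auto)
  have x': "x \<in> Arr C'" "Cod C' x = fobj F (Dom C p3)" using x fd by simp_all
  have e: "a = farr F (P 0) \<bullet>\<^bsub>C'\<^esub> x" "b = farr F (P 1) \<bullet>\<^bsub>C'\<^esub> x" "c = farr F (P 2) \<bullet>\<^bsub>C'\<^esub> x"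
    using x(5)[of 0] x(5)[of 1] x(5)[of 2] by simp_all
  obtain k01 where k01: "is_pair C B (P 0) (P 1) k01"
    by (rule C.pair_exists[OF ab, of "P 0" "P 1"]) (use P in simp_all)
  obtain k12 where k12: "is_pair C B (P 1) (P 2) k12"
    by (rule C.pair_exists[OF ab, of "P 1" "P 2"]) (use P in simp_all)
  have sum: "plus B \<bullet>\<^bsub>C\<^esub> k \<in> Arr C" "Dom C (plus B \<bullet>\<^bsub>C\<^esub> k) = Dom C p3" "Cod C (plus B \<bullet>\<^bsub>C\<^esub> k) = tot B"
    "proj B \<bullet>\<^bsub>C\<^esub> (plus B \<bullet>\<^bsub>C\<^esub> k) = p3"
    if "is_pair C B (P i) (P j) k" "i < 3" for i j k
    using C.is_pairD[OF that(1)] C.Cmp_eq_assoc[OF ax(3), of k] d P[OF that(2)] by simp_all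
  obtain kl where kl: "is_pair C B (plus B \<bullet>\<^bsub>C\<^esub> k01) (P 2) kl"
    by (rule C.pair_exists[OF ab, of "plus B \<bullet>\<^bsub>C\<^esub> k01" "P 2"]) (use P sum[OF k01] in simp_all)
  obtain kr where kr: "is_pair C B (P 0) (plus B \<bullet>\<^bsub>C\<^esub> k12) kr"
    by (rule C.pair_exists[OF ab, of "P 0" "plus B \<bullet>\<^bsub>C\<^esub> k12"]) (use P sum[OF k12] in simp_all)
  have P012: "P 0 \<in> Hom C (Dom C p3) (tot B)" "P 1 \<in> Hom C (Dom C p3) (tot B)" "P 2 \<in> Hom C (Dom C p3) (tot B)"
    using P by (simp_all add: Hom_def)
  have law: "plus B \<bullet>\<^bsub>C\<^esub> kl = plus B \<bullet>\<^bsub>C\<^esub> kr"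
    by (rule ax(5)[OF P012 k01 k12 kl kr])
  have ab'_eq: "ab' = farr F k01 \<bullet>\<^bsub>C'\<^esub> x"
    by (rule F_pair_restrict[OF ab base k01 _ _ x'(1)]) (use P x' pab e in simp_all)
  have bc_eq: "bc = farr F k12 \<bullet>\<^bsub>C'\<^esub> x"
    by (rule F_pair_restrict[OF ab base k12 _ _ x'(1)]) (use P x' pbc e in simp_all)
  have s1: "farr F (plus B) \<bullet>\<^bsub>C'\<^esub> ab' = farr F (plus B \<bullet>\<^bsub>C\<^esub> k01) \<bullet>\<^bsub>C'\<^esub> x"
    unfolding ab'_eq using C.is_pairD(1-3)[OF k01] P x' d by simp
  have s2: "farr F (plus B) \<bullet>\<^bsub>C'\<^esub> bc = farr F (plus B \<bullet>\<^bsub>C\<^esub> k12) \<bullet>\<^bsub>C'\<^esub> x"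
    unfolding bc_eq using C.is_pairD(1-3)[OF k12] P x' d by simp
  have l_eq: "l = farr F kl \<bullet>\<^bsub>C'\<^esub> x"
    by (rule F_pair_restrict[OF ab base kl _ _ x'(1) _ pl[unfolded s1 e(3)]]) (use P x' sum[OF k01] in simp_all)
  have r_eq: "r = farr F kr \<bullet>\<^bsub>C'\<^esub> x"
    by (rule F_pair_restrict[OF ab base kr _ _ x'(1) _ pr[unfolded s2, unfolded e(1)]]) (use P x' sum[OF k12] in simp_all)
  have "farr F (plus B) \<bullet>\<^bsub>C'\<^esub> farr F kl = farr F (plus B) \<bullet>\<^bsub>C'\<^esub> farr F kr"
    by (rule F.Cmp_eqD[OF law]) (use C.is_pairD(1-3)[OF kl] C.is_pairD(1-3)[OF kr] d in simp_all)
  then show ?thesis unfolding l_eq r_eq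
    by (rule D.Cmp_eq_assoc)
       (use C.is_pairD(1-3)[OF kl] C.is_pairD(1-3)[OF kr] d x' sum[OF k01] P in simp_all)
qed

text \<open>The universal pair is the identity of \<open>E\<^sub>2\<close>, and swapping its entries is the \<open>F\<close>-image of the swap
\<open>s\<close> of \<open>E\<^sub>2\<close>, which the addition of \<open>E\<close> absorbs.\<close>

lemma functor_image_comm:
  assumes ab: "additive_bundle C B" and base: "base B = t"
    and h: "is_pair C' (functor_image C' F al B) a b h" and h': "is_pair C' (functor_image C' F al B) b a h'"
  shows "farr F (plus B) \<bullet>\<^bsub>C'\<^esub> h = farr F (plus B) \<bullet>\<^bsub>C'\<^esub> h'"
proof -
  note d = C.bundle_dataD[OF additive_bundle_data[OF ab]] and ax = additive_bundle_axioms[OF ab]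
  note hd = D.is_pairD[OF h, simplified]
  obtain s where s: "is_pair C B (pr1 B) (pr0 B) s"
    by (rule C.pair_exists[OF ab, of "pr1 B" "pr0 B"]) (use d C.pullbackD(9)[OF ax(2)] in simp_all)
  have i: "is_pair C B (pr0 B) (pr1 B) (Ide C (tot2 B))"
    using d by (intro C.is_pairI) simp_all
  have "plus B \<bullet>\<^bsub>C\<^esub> Ide C (tot2 B) = plus B \<bullet>\<^bsub>C\<^esub> s"
    by (rule ax(6)[OF _ _ i s, where Z = "tot2 B"]) (use d in \<open>simp_all add: Hom_def\<close>)
  then have law: "plus B \<bullet>\<^bsub>C\<^esub> s = plus B" using d by simp
  have "h' = farr F s \<bullet>\<^bsub>C'\<^esub> h"
    by (rule F_pair_restrict[OF ab base s]) (use d hd h' in simp_all)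
  then show ?thesis
    using D.Cmp_eq_assoc1[OF F.Cmp_eqD1[OF law], of h] C.is_pairD(1-3)[OF s] d hd by simp
qed

text \<open>The universal element is the identity of \<open>E\<close>.\<close>

lemma functor_image_unit:
  assumes ab: "additive_bundle C B" and base: "base B = t"
    and a: "a \<in> Hom C' Z (fobj F (tot B))"
    and h: "is_pair C' (functor_image C' F al B) a (farr F (null B) \<bullet>\<^bsub>C'\<^esub> (farr F (proj B) \<bullet>\<^bsub>C'\<^esub> a)) h"
  shows "farr F (plus B) \<bullet>\<^bsub>C'\<^esub> h = a"
proof -
  note d = C.bundle_dataD[OF additive_bundle_data[OF ab]] and ax = additive_bundle_axioms[OF ab]
  note ad = HomD[OF a]
  have z: "proj B \<bullet>\<^bsub>C\<^esub> (null B \<bullet>\<^bsub>C\<^esub> proj B) = proj B"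
    using C.Cmp_eq_assoc1[OF ax(4), of "proj B"] d by simp
  obtain k where k: "is_pair C B (Ide C (tot B)) (null B \<bullet>\<^bsub>C\<^esub> proj B) k"
    by (rule C.pair_exists[OF ab, of "Ide C (tot B)" "null B \<bullet>\<^bsub>C\<^esub> proj B"]) (use d z in simp_all)
  have law: "plus B \<bullet>\<^bsub>C\<^esub> k = Ide C (tot B)"
    by (rule ax(7)[where Z = "tot B"]) (use d k in \<open>simp_all add: Hom_def\<close>)
  have "h = farr F k \<bullet>\<^bsub>C'\<^esub> a"
    by (rule F_pair_restrict[OF ab base k]) (use d ad h in simp_all)
  then show ?thesis
    using D.Cmp_eq_assoc1[OF F.Cmp_eqD1[OF law], of a] C.is_pairD(1-3)[OF k] d ad by simp
qed

lemma functor_image_additive_bundle: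
  assumes ab: "additive_bundle C B" and base: "base B = t"
  shows "additive_bundle C' (functor_image C' F al B)"
proof -
  note d = C.bundle_dataD[OF additive_bundle_data[OF ab]] and ax = additive_bundle_axioms[OF ab]
  show ?thesis
    unfolding additive_bundle_def functor_image_simps
  proof (intro conjI allI impI)
    fix n
    obtain b pr where "is_fibre_power C (proj B) n b pr" using ax(1) by blast
    from F_fibre_power[OF d(1) _ ax(1) this] d base
    show "\<exists>b pr. is_fibre_power C' (farr F (proj B)) n b pr" by auto
  next
    show "is_pullback C' (farr F (proj B)) (farr F (proj B)) (farr F (pr0 B)) (farr F (pr1 B))"
      using F_pullback[OF ax(2)] d base by simp
    show "farr F (proj B) \<bullet>\<^bsub>C'\<^esub> farr F (plus B) = farr F (proj B) \<bullet>\<^bsub>C'\<^esub> farr F (pr0 B)"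
      by (rule F.Cmp_eqD[OF ax(3)]) (use d in simp_all)
    show "farr F (proj B) \<bullet>\<^bsub>C'\<^esub> farr F (null B) = Ide C' (fobj F (base B))"
      using F.Cmp_eqD1[OF ax(4)] d by simp
  next
    fix Z a b c ab' bc l r
    assume "a \<in> Hom C' Z (fobj F (tot B))" "b \<in> Hom C' Z (fobj F (tot B))" "c \<in> Hom C' Z (fobj F (tot B))"
      "is_pair C' (functor_image C' F al B) a b ab'" "is_pair C' (functor_image C' F al B) b c bc"
      "is_pair C' (functor_image C' F al B) (farr F (plus B) \<bullet>\<^bsub>C'\<^esub> ab') c l"
      "is_pair C' (functor_image C' F al B) a (farr F (plus B) \<bullet>\<^bsub>C'\<^esub> bc) r"
    then show "farr F (plus B) \<bullet>\<^bsub>C'\<^esub> l = farr F (plus B) \<bullet>\<^bsub>C'\<^esub> r"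
      by (rule functor_image_assoc[OF ab base])
  next
    fix a b h h'
    assume "is_pair C' (functor_image C' F al B) a b h" "is_pair C' (functor_image C' F al B) b a h'"
    then show "farr F (plus B) \<bullet>\<^bsub>C'\<^esub> h = farr F (plus B) \<bullet>\<^bsub>C'\<^esub> h'"
      by (rule functor_image_comm[OF ab base])
  next
    fix Z a h
    assume "a \<in> Hom C' Z (fobj F (tot B))"
      "is_pair C' (functor_image C' F al B) a (farr F (null B) \<bullet>\<^bsub>C'\<^esub> (farr F (proj B) \<bullet>\<^bsub>C'\<^esub> a)) h"
    then show "farr F (plus B) \<bullet>\<^bsub>C'\<^esub> h = a"
      by (rule functor_image_unit[OF ab base])
  qed (use d in \<open>simp_all add: Hom_def\<close>)
qed

end

section \<open>The lift of the image\<close>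

context actegory_context
begin

lemma tan_image_simps:
  "tot (tan_image T B) = tan_obj T (tot B)" "base (tan_image T B) = tan_obj T (base B)"
  "proj (tan_image T B) = tan_arr T (proj B)" "tot2 (tan_image T B) = tan_obj T (tot2 B)"
  "pr0 (tan_image T B) = tan_arr T (pr0 B)" "pr1 (tan_image T B) = tan_arr T (pr1 B)"
  "plus (tan_image T B) = tan_arr T (plus B)" "null (tan_image T B) = tan_arr T (null B)"
  by (simp_all add: tan_image_def)

lemma tan_bundle_simps:
  "tot (tan_bundle C T E) = tan_obj T E" "base (tan_bundle C T E) = E"
  "proj (tan_bundle C T E) = tan_p C T E" "tot2 (tan_bundle C T E) = fobj (T_at T wW2) E"
  "pr0 (tan_bundle C T E) = T_nat C T (weil_pr 0) E" "pr1 (tan_bundle C T E) = T_nat C T (weil_pr 1) E"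
  "plus (tan_bundle C T E) = T_nat C T weil_plus E" "null (tan_bundle C T E) = tan_zero C T E"
  by (simp_all add: tan_bundle_def)

lemma tan_image_data: "bundle_data C B \<Longrightarrow> bundle_data C (tan_image T B)"
  by (auto simp: bundle_data_def tan_image_simps Hom_def wW_obj)

lemma tan_bundle_data: "E \<in> Obj C \<Longrightarrow> bundle_data C (tan_bundle C T E)"
  using T_nat[OF weil_pr_Hom] T_nat[OF weil_plus_Hom]
  by (simp add: bundle_data_def tan_bundle_simps Hom_def)

end

context differential_functor_context
begin

text \<open>The maps \<open>u\<close>, \<open>v\<close>, \<open>w\<close> constitute a map of bundle diagrams from the \<open>F\<close>-image of \<open>B'\<close> to \<open>Q\<close>,
and additive morphisms compose with such maps. All the additivity statements about images are
instances: \<open>Q\<close> is the image of another bundle with identities for \<open>u\<close>, \<open>v\<close>, \<open>w\<close>, or one of the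
two tangent bundles with components of \<open>\<alpha>\<close>.\<close>

lemma additive_morphism_image:
  assumes mor: "additive_morphism C B B' f g" and B: "bundle_data C B" and B': "bundle_data C B'"
    and Q: "bundle_data C' Q"
    and u: "u \<in> Hom C' (fobj F (tot B')) (tot Q)"
    and v: "v \<in> Hom C' (fobj F (base B')) (base Q)"
    and w: "w \<in> Hom C' (fobj F (tot2 B')) (tot2 Q)"
    and proj: "proj Q \<bullet>\<^bsub>C'\<^esub> u = v \<bullet>\<^bsub>C'\<^esub> farr F (proj B')"
    and pr0: "pr0 Q \<bullet>\<^bsub>C'\<^esub> w = u \<bullet>\<^bsub>C'\<^esub> farr F (pr0 B')"
    and pr1: "pr1 Q \<bullet>\<^bsub>C'\<^esub> w = u \<bullet>\<^bsub>C'\<^esub> farr F (pr1 B')"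
    and plus: "plus Q \<bullet>\<^bsub>C'\<^esub> w = u \<bullet>\<^bsub>C'\<^esub> farr F (plus B')"
    and null: "null Q \<bullet>\<^bsub>C'\<^esub> v = u \<bullet>\<^bsub>C'\<^esub> farr F (null B')"
  shows "additive_morphism C' (functor_image C' F al B) Q (u \<bullet>\<^bsub>C'\<^esub> farr F f) (v \<bullet>\<^bsub>C'\<^esub> farr F g)"
proof -
  note b = C.bundle_dataD[OF B] and b' = C.bundle_dataD[OF B'] and q = D.bundle_dataD[OF Q]
  note uvw = HomD[OF u] HomD[OF v] HomD[OF w]
  obtain f2 where f2: "is_pair C B' (f \<bullet>\<^bsub>C\<^esub> pr0 B) (f \<bullet>\<^bsub>C\<^esub> pr1 B) f2"
    and fplus: "f \<bullet>\<^bsub>C\<^esub> plus B = plus B' \<bullet>\<^bsub>C\<^esub> f2"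
    and fnull: "f \<bullet>\<^bsub>C\<^esub> null B = null B' \<bullet>\<^bsub>C\<^esub> g"
    and fg: "f \<in> Hom C (tot B) (tot B')" "g \<in> Hom C (base B) (base B')"
    and fproj: "proj B' \<bullet>\<^bsub>C\<^esub> f = g \<bullet>\<^bsub>C\<^esub> proj B"
    using mor unfolding additive_morphism_def bundle_morphism_def by blast
  note fgd = HomD[OF fg(1)] HomD[OF fg(2)]
  have f2d: "f2 \<in> Arr C" "Dom C f2 = tot2 B" "Cod C f2 = tot2 B'"
    using C.is_pairD(1-3)[OF f2] fgd b by simp_all
  note facts = b b' q uvw fgd f2d
  have 1: "proj Q \<bullet>\<^bsub>C'\<^esub> (u \<bullet>\<^bsub>C'\<^esub> farr F f) = v \<bullet>\<^bsub>C'\<^esub> (farr F g \<bullet>\<^bsub>C'\<^esub> farr F (proj B))"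
    using D.Cmp_eq_assoc[OF proj, of "farr F f"] F.Cmp_eqD[OF fproj] facts by simp
  have 2: "pr0 Q \<bullet>\<^bsub>C'\<^esub> (w \<bullet>\<^bsub>C'\<^esub> farr F f2) = u \<bullet>\<^bsub>C'\<^esub> (farr F f \<bullet>\<^bsub>C'\<^esub> farr F (pr0 B))"
    using D.Cmp_eq_assoc[OF pr0, of "farr F f2"] F.Cmp_eqD[OF C.is_pairD(4)[OF f2]] facts by simp
  have 3: "pr1 Q \<bullet>\<^bsub>C'\<^esub> (w \<bullet>\<^bsub>C'\<^esub> farr F f2) = u \<bullet>\<^bsub>C'\<^esub> (farr F f \<bullet>\<^bsub>C'\<^esub> farr F (pr1 B))"
    using D.Cmp_eq_assoc[OF pr1, of "farr F f2"] F.Cmp_eqD[OF C.is_pairD(5)[OF f2]] facts by simp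
  have 4: "plus Q \<bullet>\<^bsub>C'\<^esub> (w \<bullet>\<^bsub>C'\<^esub> farr F f2) = u \<bullet>\<^bsub>C'\<^esub> (farr F f \<bullet>\<^bsub>C'\<^esub> farr F (plus B))"
    using D.Cmp_eq_assoc[OF plus, of "farr F f2"] F.Cmp_eqD[OF fplus] facts by simp
  have 5: "null Q \<bullet>\<^bsub>C'\<^esub> (v \<bullet>\<^bsub>C'\<^esub> farr F g) = u \<bullet>\<^bsub>C'\<^esub> (farr F f \<bullet>\<^bsub>C'\<^esub> farr F (null B))"
    using D.Cmp_eq_assoc[OF null, of "farr F g"] F.Cmp_eqD[OF fnull] facts by simp
  have "is_pair C' Q ((u \<bullet>\<^bsub>C'\<^esub> farr F f) \<bullet>\<^bsub>C'\<^esub> farr F (pr0 B)) ((u \<bullet>\<^bsub>C'\<^esub> farr F f) \<bullet>\<^bsub>C'\<^esub> farr F (pr1 B))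
      (w \<bullet>\<^bsub>C'\<^esub> farr F f2)"
    by (rule D.is_pairI) (use facts 2 3 in simp_all)
  then show ?thesis
    unfolding additive_morphism_def bundle_morphism_def functor_image_simps
    using facts 1 4 5 by (auto simp: Hom_def intro!: exI[of _ "w \<bullet>\<^bsub>C'\<^esub> farr F f2"])
qed

lemma functor_image_morphism:
  assumes "additive_morphism C B B' f g" "bundle_data C B" and B': "bundle_data C B'"
  shows "additive_morphism C' (functor_image C' F al B) (functor_image C' F al B') (farr F f) (farr F g)"
proof -
  note b' = C.bundle_dataD[OF B']
  have fg: "f \<in> Hom C (tot B) (tot B')" "g \<in> Hom C (base B) (base B')"
    using assms(1) by (auto simp: additive_morphism_def bundle_morphism_def)
  have "additive_morphism C' (functor_image C' F al B) (functor_image C' F al B')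
     (Ide C' (fobj F (tot B')) \<bullet>\<^bsub>C'\<^esub> farr F f) (Ide C' (fobj F (base B')) \<bullet>\<^bsub>C'\<^esub> farr F g)"
    by (rule additive_morphism_image[OF assms, where w = "Ide C' (fobj F (tot2 B'))"])
       (use b' in \<open>auto simp: bundle_data_def Hom_def\<close>)
  then show ?thesis using HomD[OF fg(1)] HomD[OF fg(2)] by simp
qed

lemma functor_image_data: "bundle_data C B \<Longrightarrow> bundle_data C' (functor_image C' F al B)"
  by (auto simp: bundle_data_def Hom_def)

lemma functor_image_lift_linear:
  assumes B: "bundle_data C B"
    and mor: "additive_morphism C B (tan_image T B) (lift B) (tan_zero C T (base B))"
  shows "additive_morphism C' (functor_image C' F al B) (tan_image T' (functor_image C' F al B))
     (lift (functor_image C' F al B)) (tan_zero C' T' (base (functor_image C' F al B)))"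
proof -
  note b = C.bundle_dataD[OF B]
  let ?Q = "tan_image T' (functor_image C' F al B)"
  have "additive_morphism C' (functor_image C' F al B) ?Q
     (al wW (tot B) \<bullet>\<^bsub>C'\<^esub> farr F (lift B)) (al wW (base B) \<bullet>\<^bsub>C'\<^esub> farr F (tan_zero C T (base B)))"
    by (rule additive_morphism_image[OF mor B C.tan_image_data[OF B]
          D.tan_image_data[OF functor_image_data[OF B]], where w = "al wW (tot2 B)"])
       (use b wW_obj al_T[OF wW_obj, symmetric, of "proj B"] al_T[OF wW_obj, symmetric, of "pr0 B"]
         al_T[OF wW_obj, symmetric, of "pr1 B"] al_T[OF wW_obj, symmetric, of "plus B"]
         al_T[OF wW_obj, symmetric, of "null B"]
         in \<open>simp_all add: C.tan_image_simps D.tan_image_simps Hom_def\<close>)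
  then show ?thesis using al_tan_zero b by simp
qed

lemma functor_image_lift_tan_linear:
  assumes B: "bundle_data C B"
    and mor: "additive_morphism C B (tan_bundle C T (tot B)) (lift B) (null B)"
  shows "additive_morphism C' (functor_image C' F al B)
     (tan_bundle C' T' (tot (functor_image C' F al B))) (lift (functor_image C' F al B))
     (null (functor_image C' F al B))"
proof -
  note b = C.bundle_dataD[OF B]
  let ?E = "tot B"
  note n = C.T_nat[OF weil_pr_Hom b(16)] C.T_nat[OF weil_plus_Hom b(16)]
  have "additive_morphism C' (functor_image C' F al B) (tan_bundle C' T' (fobj F ?E))
     (al wW ?E \<bullet>\<^bsub>C'\<^esub> farr F (lift B)) (Ide C' (fobj F ?E) \<bullet>\<^bsub>C'\<^esub> farr F (null B))"
    by (rule additive_morphism_image[OF mor B C.tan_bundle_data[OF b(16)]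
          D.tan_bundle_data[OF F.obj[OF b(16)]], where w = "al wW2 ?E"])
       (use b wW_obj wW2_obj al_tan_p[OF b(16)] al_tan_zero[OF b(16)]
         al_T_nat[OF weil_pr_Hom b(16), symmetric] al_T_nat[OF weil_plus_Hom b(16), symmetric] n
         in \<open>simp_all add: C.tan_bundle_simps D.tan_bundle_simps Hom_def\<close>)
  then show ?thesis using b by simp
qed

text \<open>Both sides are \<open>T'(\<alpha>) \<circ> \<alpha> \<circ> F(T \<lambda> \<circ> \<lambda>)\<close>: on the left by compatibility of \<open>\<alpha>\<close> with \<open>\<ell>\<close> and the
law for \<open>\<lambda>\<close>, on the right by naturality of \<open>\<alpha>\<close> at \<open>\<lambda>\<close>.\<close>

lemma functor_image_lift_coassoc:
  assumes E: "E \<in> Obj C" and L: "L \<in> Hom C E (tan_obj T E)"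
    and eq: "tan_l C T E \<bullet>\<^bsub>C\<^esub> L = tan_arr T L \<bullet>\<^bsub>C\<^esub> L"
  shows "tan_l C' T' (fobj F E) \<bullet>\<^bsub>C'\<^esub> (al wW E \<bullet>\<^bsub>C'\<^esub> farr F L) =
    tan_arr T' (al wW E \<bullet>\<^bsub>C'\<^esub> farr F L) \<bullet>\<^bsub>C'\<^esub> (al wW E \<bullet>\<^bsub>C'\<^esub> farr F L)"
proof -
  note l = HomD[OF L]
  have "tan_l C' T' (fobj F E) \<bullet>\<^bsub>C'\<^esub> (al wW E \<bullet>\<^bsub>C'\<^esub> farr F L) =
    (tan_arr T' (al wW E) \<bullet>\<^bsub>C'\<^esub> (al wW (tan_obj T E) \<bullet>\<^bsub>C'\<^esub> farr F (tan_l C T E))) \<bullet>\<^bsub>C'\<^esub> farr F L"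
    by (rule D.Cmp_eq_assoc1[OF al_tan_l[OF E]]) (use E l wW_obj in simp_all)
  also have "\<dots> = tan_arr T' (al wW E) \<bullet>\<^bsub>C'\<^esub>
      (al wW (tan_obj T E) \<bullet>\<^bsub>C'\<^esub> (farr F (tan_arr T L) \<bullet>\<^bsub>C'\<^esub> farr F L))"
    using F.Cmp_eqD[OF eq] E l wW_obj by simp
  also have "al wW (tan_obj T E) \<bullet>\<^bsub>C'\<^esub> (farr F (tan_arr T L) \<bullet>\<^bsub>C'\<^esub> farr F L) =
      tan_arr T' (farr F L) \<bullet>\<^bsub>C'\<^esub> (al wW E \<bullet>\<^bsub>C'\<^esub> farr F L)"
    by (rule D.Cmp_eq_assoc[OF al_T[OF wW_obj l(1), unfolded l]]) (use E l wW_obj in simp_all)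
  finally show ?thesis using E l wW_obj by simp
qed

lemma functor_image_pre_differential_bundle:
  assumes pre: "pre_differential_bundle C T B" and base: "base B = t"
  shows "pre_differential_bundle C' T' (functor_image C' F al B)"
proof -
  have ab: "additive_bundle C B" and L: "lift B \<in> Hom C (tot B) (tan_obj T (tot B))"
    and m1: "additive_morphism C B (tan_image T B) (lift B) (tan_zero C T (base B))"
    and m2: "additive_morphism C B (tan_bundle C T (tot B)) (lift B) (null B)"
    and co: "tan_l C T (tot B) \<bullet>\<^bsub>C\<^esub> lift B = tan_arr T (lift B) \<bullet>\<^bsub>C\<^esub> lift B"
    using pre unfolding pre_differential_bundle_def by blast+
  note B = additive_bundle_data[OF ab]
  note b = C.bundle_dataD[OF B] and ax = additive_bundle_axioms[OF ab] and l = HomD[OF L]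
  have pres: "is_fibre_power C' ((tan_arr T' ^^ k) (farr F (proj B))) n
          ((tan_arr T' ^^ k) c) (\<lambda>i. (tan_arr T' ^^ k) (pr i))"
    if fp: "is_fibre_power C' (farr F (proj B)) n c pr" for n k c pr
  proof -
    \<comment> \<open>Any fibre power of \<open>F q\<close> is isomorphic to the \<open>F\<close>-image of one of \<open>q\<close>, which every iterate of \<open>T'\<close> preserves.\<close>
    interpret P: functor_between C' C' "tan_power T' k" by (rule D.tan_power_functor)
    obtain c0 pr0 where fp0: "is_fibre_power C (proj B) n c0 pr0" using ax(1) by blast
    have q: "proj B \<in> Arr C" "Cod C (proj B) = t" using b base by simp_all
    show ?thesis
      using P.fibre_power_transfer[OF F_fibre_power[OF q ax(1) fp0] _ fp]
        tan_power_fibre_power[OF q ax(1) fp0, of k] by (simp add: tan_power_def)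
  qed
  show ?thesis
    unfolding pre_differential_bundle_def
    using functor_image_additive_bundle[OF ab base] pres functor_image_lift_linear[OF B m1]
      functor_image_lift_tan_linear[OF B m2] functor_image_lift_coassoc[OF b(16) L co] l b(16) wW_obj
    by (simp add: Hom_def)
qed

section \<open>Universality of the lift\<close>

text \<open>Pullbacks over \<open>t\<close> are preserved by hypothesis. A pullback over another terminal object becomes
one over \<open>t\<close> after composition with the unique isomorphism, and the \<open>F\<close>-image of that isomorphism
can be cancelled from the resulting pullback.\<close>

lemma F_pullback_over_terminal:
  assumes pb: "is_pullback C f g p q" and u: "terminal C (Cod C f)"
  shows "is_pullback C' (farr F f) (farr F g) (farr F p) (farr F q)"
proof -
  note d = C.pullbackD[OF pb]
  let ?u = "Cod C f"
  have o: "t \<in> Obj C" "?u \<in> Obj C" using terminal u by (simp_all add: terminal_def)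
  have "\<exists>!i. i \<in> Hom C ?u t" "\<exists>!j. j \<in> Hom C t ?u"
    using terminal u o by (simp_all add: terminal_def)
  then obtain i j where "i \<in> Hom C ?u t" "j \<in> Hom C t ?u" by blast
  note i = HomD[OF this(1)] and j = HomD[OF this(2)]
  have "j \<bullet>\<^bsub>C\<^esub> i = Ide C ?u" by (rule C.terminal_eq[OF u]) (use i j o in simp_all)
  moreover have "i \<bullet>\<^bsub>C\<^esub> j = Ide C t" by (rule C.terminal_eq[OF terminal]) (use i j o in simp_all)
  ultimately have iso: "is_iso C i" using i j by (intro C.is_isoI[of i j]) simp_all
  have "is_pullback C' (farr F (i \<bullet>\<^bsub>C\<^esub> f)) (farr F (i \<bullet>\<^bsub>C\<^esub> g)) (farr F p) (farr F q)"
    by (rule F_pullback[OF C.pullback_postcomp_iso[OF pb iso]]) (use i d in simp_all)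
  then have "is_pullback C' (farr F i \<bullet>\<^bsub>C'\<^esub> farr F f) (farr F i \<bullet>\<^bsub>C'\<^esub> farr F g) (farr F p) (farr F q)"
    using i d(1-3) by simp
  then show ?thesis
    by (rule D.pullback_cancel_postcomp) (use i d(1-8) F.Cmp_eqD[OF d(9)] in simp_all)
qed

text \<open>The square of the image is the pasting of the \<open>F\<close>-image of the square of the lift with the
naturality square of \<open>\<alpha>\<close> at the projection. The comparison map \<open>\<langle>\<alpha> F(\<lambda>) \<pi>\<^sub>0, 0 \<pi>\<^sub>1\<rangle>\<close> is the
\<open>F\<close>-image of the one for \<open>\<lambda>\<close>, followed by \<open>\<alpha>\<close>.\<close>

lemma functor_image_universal_lift:
  assumes B: "bundle_data C B" and base: "base B = t" and L: "lift B \<in> Hom C (tot B) (tan_obj T (tot B))"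
    and univ: "universal_lift C T B" and Tt: "terminal C (tan_obj T t)"
  shows "universal_lift C' T' (functor_image C' F al B)"
proof -
  note b = C.bundle_dataD[OF B] and l = HomD[OF L]
  obtain v where v: "is_pair C (tan_image T B)
            (lift B \<bullet>\<^bsub>C\<^esub> pr0 B) (tan_zero C T (tot B) \<bullet>\<^bsub>C\<^esub> pr1 B) v"
    and pb: "is_pullback C (tan_zero C T (base B)) (tan_arr T (proj B))
          (proj B \<bullet>\<^bsub>C\<^esub> pr0 B) (tan_arr T (plus B) \<bullet>\<^bsub>C\<^esub> v)"
    using univ unfolding universal_lift_def by blast
  note vd = C.is_pairD[OF v, unfolded C.tan_image_simps]
  have v': "v \<in> Arr C" "Dom C v = tot2 B" "Cod C v = tan_obj T (tot2 B)"
    using vd(1-3) b l wW_obj by simp_all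
  have "is_pullback C' (farr F (tan_zero C T (base B))) (farr F (tan_arr T (proj B)))
          (farr F (proj B \<bullet>\<^bsub>C\<^esub> pr0 B)) (farr F (tan_arr T (plus B) \<bullet>\<^bsub>C\<^esub> v))"
    by (rule F_pullback_over_terminal[OF pb]) (use b base Tt in simp)
  moreover have "is_pullback C' (tan_arr T' (farr F (proj B))) (al wW (base B))
      (al wW (tot B)) (farr F (tan_arr T (proj B)))"
    using diff wW_obj B unfolding differential_functor_def bundle_data_def weil_Obj by blast
  ultimately have "is_pullback C' (al wW (base B) \<bullet>\<^bsub>C'\<^esub> farr F (tan_zero C T (base B)))
      (tan_arr T' (farr F (proj B))) (farr F (proj B \<bullet>\<^bsub>C\<^esub> pr0 B))
      (al wW (tot B) \<bullet>\<^bsub>C'\<^esub> farr F (tan_arr T (plus B) \<bullet>\<^bsub>C\<^esub> v))"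
    by (rule D.pullback_paste)
  moreover have "al wW (tot B) \<bullet>\<^bsub>C'\<^esub> farr F (tan_arr T (plus B) \<bullet>\<^bsub>C\<^esub> v) =
      tan_arr T' (farr F (plus B)) \<bullet>\<^bsub>C'\<^esub> (al wW (tot2 B) \<bullet>\<^bsub>C'\<^esub> farr F v)"
    using D.Cmp_eq_assoc[OF al_T[OF wW_obj b(10), unfolded b], of "farr F v"] b v' wW_obj by simp
  ultimately have pb': "is_pullback C' (tan_zero C' T' (fobj F (base B))) (tan_arr T' (farr F (proj B)))
      (farr F (proj B) \<bullet>\<^bsub>C'\<^esub> farr F (pr0 B))
      (tan_arr T' (farr F (plus B)) \<bullet>\<^bsub>C'\<^esub> (al wW (tot2 B) \<bullet>\<^bsub>C'\<^esub> farr F v))"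
    using al_tan_zero[of "base B"] b by simp
  have "is_pair C' (tan_image T' (functor_image C' F al B))
      ((al wW (tot B) \<bullet>\<^bsub>C'\<^esub> farr F (lift B)) \<bullet>\<^bsub>C'\<^esub> farr F (pr0 B))
      (tan_zero C' T' (fobj F (tot B)) \<bullet>\<^bsub>C'\<^esub> farr F (pr1 B))
      (al wW (tot2 B) \<bullet>\<^bsub>C'\<^esub> farr F v)"
  proof (rule D.is_pairI, unfold D.tan_image_simps functor_image_simps)
    have "tan_arr T' (farr F (pr0 B)) \<bullet>\<^bsub>C'\<^esub> (al wW (tot2 B) \<bullet>\<^bsub>C'\<^esub> farr F v) =
        al wW (tot B) \<bullet>\<^bsub>C'\<^esub> (farr F (tan_arr T (pr0 B)) \<bullet>\<^bsub>C'\<^esub> farr F v)"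
      using D.Cmp_eq_assoc[OF al_T[OF wW_obj b(4), unfolded b], of "farr F v"] b v' wW_obj by simp
    also have "farr F (tan_arr T (pr0 B)) \<bullet>\<^bsub>C'\<^esub> farr F v = farr F (lift B) \<bullet>\<^bsub>C'\<^esub> farr F (pr0 B)"
      by (rule F.Cmp_eqD[OF vd(4)]) (use b v' l wW_obj in simp_all)
    finally show "tan_arr T' (farr F (pr0 B)) \<bullet>\<^bsub>C'\<^esub> (al wW (tot2 B) \<bullet>\<^bsub>C'\<^esub> farr F v) =
        (al wW (tot B) \<bullet>\<^bsub>C'\<^esub> farr F (lift B)) \<bullet>\<^bsub>C'\<^esub> farr F (pr0 B)"
      using b l wW_obj by simp
    have "tan_arr T' (farr F (pr1 B)) \<bullet>\<^bsub>C'\<^esub> (al wW (tot2 B) \<bullet>\<^bsub>C'\<^esub> farr F v) =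
        al wW (tot B) \<bullet>\<^bsub>C'\<^esub> (farr F (tan_arr T (pr1 B)) \<bullet>\<^bsub>C'\<^esub> farr F v)"
      using D.Cmp_eq_assoc[OF al_T[OF wW_obj b(7), unfolded b], of "farr F v"] b v' wW_obj by simp
    also have "farr F (tan_arr T (pr1 B)) \<bullet>\<^bsub>C'\<^esub> farr F v = farr F (tan_zero C T (tot B)) \<bullet>\<^bsub>C'\<^esub> farr F (pr1 B)"
      by (rule F.Cmp_eqD[OF vd(5)]) (use b v' wW_obj in simp_all)
    also have "al wW (tot B) \<bullet>\<^bsub>C'\<^esub> (farr F (tan_zero C T (tot B)) \<bullet>\<^bsub>C'\<^esub> farr F (pr1 B)) =
        tan_zero C' T' (fobj F (tot B)) \<bullet>\<^bsub>C'\<^esub> farr F (pr1 B)"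
      by (rule D.Cmp_eq_assoc1[OF al_tan_zero]) (use b wW_obj in simp_all)
    finally show "tan_arr T' (farr F (pr1 B)) \<bullet>\<^bsub>C'\<^esub> (al wW (tot2 B) \<bullet>\<^bsub>C'\<^esub> farr F v) =
        tan_zero C' T' (fobj F (tot B)) \<bullet>\<^bsub>C'\<^esub> farr F (pr1 B)" .
  qed (use b v' l wW_obj in simp_all)
  with pb' show ?thesis
    unfolding universal_lift_def functor_image_simps D.tan_image_simps
    by (intro exI[of _ "al wW (tot2 B) \<bullet>\<^bsub>C'\<^esub> farr F v"]) simp
qed

end

section \<open>Additive morphisms between images of differential objects\<close>

theorem proposition4p6:
  fixes X :: "('o, 'm) cat" and T :: "('o, 'm) weil_action"
    and X' :: "('p, 'n) cat" and T' :: "('p, 'n) weil_action"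
    and F :: "('o, 'm, 'p, 'n) ftor" and al :: "wobj \<Rightarrow> 'o \<Rightarrow> 'n"
    and t :: 'o and A B :: "('o, 'm) dbundle" and f :: 'm
  assumes "tangent_actegory X T" and "tangent_actegory X' T'"
    and "terminal X t"
    and "differential_functor X T X' T' t F al"
    and "differential_object X T t A" and "differential_object X T t B"
    and "additive_morphism X A B f (Ide X t)"
  shows "additive_morphism X' (functor_image X' F al A) (functor_image X' F al B)
           (farr F f) (Ide X' (fobj F t)) \<and>
         pre_differential_bundle X' T' (functor_image X' F al A) \<and>
         pre_differential_bundle X' T' (functor_image X' F al B) \<and>
         (terminal X (tan_obj T t) \<longrightarrow>
            differential_bundle X' T' (functor_image X' F al A) \<and>
            differential_bundle X' T' (functor_image X' F al B))"
proof -
  interpret differential_functor_context X T X' T' t F al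
    by unfold_locales
       (use assms(1,2,4) in \<open>auto simp: tangent_actegory_def weil_actegory_def\<close>)
  have image: "pre_differential_bundle X' T' (functor_image X' F al E) \<and>
      (terminal X (tan_obj T t) \<longrightarrow> differential_bundle X' T' (functor_image X' F al E)) \<and> bundle_data X E"
    if "differential_object X T t E" for E
  proof -
    have pre: "pre_differential_bundle X T E" and base: "base E = t" and univ: "universal_lift X T E"
      using that by (auto simp: differential_object_def differential_bundle_def)
    have E: "bundle_data X E" and L: "lift E \<in> Hom X (tot E) (tan_obj T (tot E))"
      using pre by (auto simp: pre_differential_bundle_def intro: additive_bundle_data)
    show ?thesis
      using functor_image_pre_differential_bundle[OF pre base]
        functor_image_universal_lift[OF E base L univ] E
      by (auto simp: differential_bundle_def)
  qed
  have "farr F (Ide X t) = Ide X' (fobj F t)"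
    using assms(3) by (simp add: terminal_def)
  with functor_image_morphism[OF assms(7)] image[OF assms(5)] image[OF assms(6)]
  show ?thesis by auto
qed

end
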